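(* There exists a constant $\beta>0$ such that, for every real $c>2$ with $c\notin\mathbb{N}$, the inequality $$P(\lfloor n^c\rfloor)>n^{\beta/c^2}$$ holds for infinitely many natural numbers $n$.
   Context: $\lfloor t\rfloor$ is the integer part of the real number $t$. For an integer $m\ge 2$, $P(m)$ denotes the largest prime factor of $m$. *)

theory Defs
  imports Complex_Main "HOL-Computational_Algebra.Primes"
begin

(* Meaningful only for m >= 2: for m < 2 the set is empty and Max {} is unspecified. *)
definition largest_prime_factor :: "nat \<Rightarrow> nat" where
  "largest_prime_factor m = Max (prime_factors m)"

end

theory Submission
  imports Defs "HOL-Analysis.Analysis" "HOL-Computational_Algebra.Polynomial_FPS" "HOL-Real_Asymp.Real_Asymp"
begin

text \<open>
  Fix a prime \<open>p\<close> of size \<open>N powr \<delta>\<close> with \<open>\<delta>\<close> a small multiple of \<open>1 / c\<^sup>2\<close>. If \<open>p\<close> divides none of the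
  numbers \<open>\<lfloor>x powr c\<rfloor>\<close> with \<open>x = N + u v\<close>, then the fractional parts of \<open>x powr c / p\<close> avoid an
  interval of length \<open>1 / p\<close>, so some exponential sum with phase \<open>l x powr c / p\<close> has relative size at
  least \<open>1 / (4 p\<^sup>2)\<close>. By the binomial series the phase is, up to a negligible error,
  a polynomial in \<open>u v\<close> of degree \<open>k\<close> about \<open>2 c\<close>. Vinogradov's method bounds such a bilinear
  sum: applying Hoelder's inequality in both variables turns \<open>u\<close> and \<open>v\<close> into vectors of power sums,
  which by the mean value theorem are nearly uniformly distributed in a box, and then the coefficients
  of index between \<open>1.2 c\<close> and \<open>1.8 c\<close>, which are small but nonzero because \<open>c\<close> is not an integer,
  each save a power of \<open>N\<close> proportional to \<open>c\<close>. The total saving has exponent of order \<open>c\<^sup>2\<close>, spread over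
  a Hoelder exponent of order \<open>c ^ 4\<close>, so it beats \<open>1 / p\<^sup>2\<close>.

  The mean value theorem is proved by induction on the number of variables. An interval is cut into a
  bounded number of pieces. Either \<open>k\<close> non-adjacent pieces carry a fixed proportion of the exponential
  sum, and one counts \<open>k\<close>-tuples of separated variables with nearly equal power sums, or one piece
  dominates, and one passes to a shorter interval.
\<close>

subsection \<open>Power sums of separated tuples\<close>

text \<open>With \<open>N = 2^(8n)\<close>, \<open>u < 2^n\<close> and \<open>v < 2^(3n)\<close>,
  the product \<open>u v\<close> stays below the square root of \<open>N\<close>, which is why a
  degree slightly above \<open>2c\<close> suffices for the truncation. The lopsided split 1 : 3
  opens the window of useful indices. In coordinate \<open>j\<close> the two power sum vectors have
  entries of size \<open>2^(nj)\<close> and \<open>2^(3nj)\<close>, and the coefficient is about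
  \<open>2^(8n(c-j))\<close>. There is a saving when the coefficient times the shorter side is below
  1, so \<open>j > 8c/7\<close>, and its inverse is below the full volume \<open>2^(4nj)\<close>, so
  \<open>j < 2c\<close>. The range from \<open>1.2c\<close> to \<open>1.8c\<close> lies strictly
  inside, and the slack absorbs \<open>p\<close>, \<open>l\<close>, logarithms and constants. The
  mean value theorem need not be optimal, but its defect must cost less than the saving of about
  \<open>0.18 c^2\<close>. This takes \<open>9k\<close> steps of \<open>k\<close> variables each,
  hence \<open>s\<close> of order \<open>k^2\<close>; two applications of Hoelder and one of
  Cauchy-Schwarz make the exponent \<open>8 s^2\<close>, of order \<open>c^4\<close>. The quotient
  of the two orders is the \<open>1 / c^2\<close> of the theorem. All lengths are powers of two so
  that intervals can be cut exactly.\<close>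

lemma newton_identity_fps:
  fixes x :: "'i \<Rightarrow> real"
  assumes "finite A"
  shows "fps_deriv (\<Prod>i\<in>A. 1 - fps_const (x i) * fps_X)
       = - (\<Prod>i\<in>A. 1 - fps_const (x i) * fps_X) * Abs_fps (\<lambda>n. \<Sum>i\<in>A. x i ^ Suc n)"
  using assms
proof induction
  case empty
  have "Abs_fps (\<lambda>n. 0::real) = 0" by (simp add: fps_eq_iff)
  then show ?case by simp
next
  case (insert a A)
  define E where "E = (\<Prod>i\<in>A. 1 - fps_const (x i) * fps_X)"
  define S where "S = Abs_fps (\<lambda>n. \<Sum>i\<in>A. x i ^ Suc n)"
  define Sa where "Sa = Abs_fps (\<lambda>n. x a ^ Suc n)"
  have sum: "Abs_fps (\<lambda>n. \<Sum>i\<in>insert a A. x i ^ Suc n) = Sa + S"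
    using insert by (simp add: fps_eq_iff Sa_def S_def)
  \<comment> \<open>The logarithmic derivative of a factor \<open>1 - x X\<close> is
    \<open>- x / (1 - x X)\<close>, a geometric series in the powers of \<open>x\<close>; summed
    over the factors these series give the power sums.\<close>
  have geom: "(1 - fps_const (x a) * fps_X) * Sa = fps_const (x a)"
  proof -
    have "fps_nth ((1 - fps_const (x a) * fps_X) * Sa) n = fps_nth (fps_const (x a)) n" for n
      by (cases n) (simp_all add: Sa_def left_diff_distrib mult.assoc)
    then show ?thesis by (simp add: fps_eq_iff)
  qed
  have IH: "fps_deriv E = - E * S" using insert by (simp add: E_def S_def)
  have "fps_deriv ((1 - fps_const (x a) * fps_X) * E)
      = (1 - fps_const (x a) * fps_X) * (- E * S) - fps_const (x a) * E"
    using IH by (simp add: algebra_simps)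
  also have "\<dots> = - ((1 - fps_const (x a) * fps_X) * E) * (Sa + S)"
    by (subst geom[symmetric]) (simp add: algebra_simps)
  finally show ?case using insert unfolding sum E_def by simp
qed

context
  fixes A :: "'i set" and k :: nat
  assumes fin: "finite A" and card: "card A = k"
begin

text \<open>This is the elementary symmetric polynomial with the sign \<open>(-1)^n\<close>; with
  the sign included, Newton's identities do not alternate.\<close>

definition esym :: "('i \<Rightarrow> real) \<Rightarrow> nat \<Rightarrow> real" where
  "esym x n = fps_nth (\<Prod>i\<in>A. 1 - fps_const (x i) * fps_X) n"

lemma esym_0: "esym x 0 = 1"
proof -
  have "fps_nth (\<Prod>i\<in>B. 1 - fps_const (x i) * fps_X) 0 = 1" if "finite B" for B
    using that by induction auto
  then show ?thesis using fin by (simp add: esym_def)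
qed

lemma newton_identity:
  "real (Suc n) * esym x (Suc n) = - (\<Sum>m\<le>n. esym x m * (\<Sum>i\<in>A. x i ^ Suc (n - m)))"
  using arg_cong[OF newton_identity_fps[OF fin, of x], of "\<lambda>f. fps_nth f n"]
  by (simp add: fps_mult_nth esym_def sum_negf atLeast0AtMost algebra_simps)

text \<open>Newton's recursion, divided by \<open>n\<close>, is an average of \<open>n\<close>
  terms, each at most \<open>k (k + 1)^(n - 1)\<close>, which is below
  \<open>(k + 1)^n\<close>.\<close>

lemma esym_bound:
  assumes "\<And>i. i \<in> A \<Longrightarrow> \<bar>x i\<bar> \<le> 1"
  shows "\<bar>esym x n\<bar> \<le> real (Suc k) ^ n"
proof (induction n rule: less_induct)
  case (less n)
  show ?case
  proof (cases n)
    case 0 then show ?thesis by (simp add: esym_0)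
  next
    case (Suc m)
    have p: "\<bar>\<Sum>i\<in>A. x i ^ Suc j\<bar> \<le> real k" for j
    proof -
      have "\<bar>\<Sum>i\<in>A. x i ^ Suc j\<bar> \<le> (\<Sum>i\<in>A. 1)"
        by (rule order_trans[OF sum_abs sum_mono]) (simp add: power_abs power_le_one assms flip: power_Suc)
      then show ?thesis by (simp add: card)
    qed
    have "real n * \<bar>esym x n\<bar> = \<bar>\<Sum>l\<le>m. esym x l * (\<Sum>i\<in>A. x i ^ Suc (m - l))\<bar>"
      using arg_cong[OF newton_identity[of m x], of abs] Suc by (simp add: abs_mult)
    also have "\<dots> \<le> (\<Sum>l\<le>m. real (Suc k) ^ m * real k)"
    proof (rule order_trans[OF sum_abs sum_mono], unfold abs_mult)
      fix l assume "l \<in> {..m}"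
      then have "\<bar>esym x l\<bar> \<le> real (Suc k) ^ l" using less Suc by auto
      also have "\<dots> \<le> real (Suc k) ^ m" using \<open>l \<in> {..m}\<close> by (intro power_increasing) auto
      finally show "\<bar>esym x l\<bar> * \<bar>\<Sum>i\<in>A. x i ^ Suc (m - l)\<bar> \<le> real (Suc k) ^ m * real k"
        by (intro mult_mono p) auto
    qed
    also have "\<dots> = real n * (real (Suc k) ^ m * real k)" using Suc by simp
    finally have "\<bar>esym x n\<bar> \<le> real (Suc k) ^ m * real k"
      by (rule mult_left_le_imp_le) (use Suc in simp)
    also have "\<dots> \<le> real (Suc k) ^ m * real (Suc k)" by (intro mult_left_mono) auto
    finally show ?thesis using Suc by (simp add: mult.commute)
  qed
qed

text \<open>The products in Newton's recursion are compared by changing one factor at a time.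
  Division by \<open>n\<close> again cancels the number of terms, so the loss depends on
  \<open>k\<close> and \<open>n\<close> only and is linear in \<open>\<eta>\<close>.\<close>

lemma esym_close:
  assumes x: "\<And>i. i \<in> A \<Longrightarrow> \<bar>x i\<bar> \<le> 1" and y: "\<And>i. i \<in> A \<Longrightarrow> \<bar>y i\<bar> \<le> 1"
    and close: "\<And>j. 1 \<le> j \<Longrightarrow> j \<le> k \<Longrightarrow> \<bar>(\<Sum>i\<in>A. x i ^ j) - (\<Sum>i\<in>A. y i ^ j)\<bar> \<le> \<eta>"
    and "\<eta> \<ge> 0" "n \<le> k"
  shows "\<bar>esym x n - esym y n\<bar> \<le> real n * real (Suc k) ^ n * \<eta>"
  using \<open>n \<le> k\<close>
proof (induction n rule: less_induct)
  case (less n)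
  show ?case
  proof (cases n)
    case 0 then show ?thesis by (simp add: esym_0)
  next
    case (Suc m)
    have p: "\<bar>\<Sum>i\<in>A. x i ^ Suc j\<bar> \<le> real k" for j
    proof -
      have "\<bar>\<Sum>i\<in>A. x i ^ Suc j\<bar> \<le> (\<Sum>i\<in>A. 1)"
        by (rule order_trans[OF sum_abs sum_mono]) (simp add: power_abs power_le_one x flip: power_Suc)
      then show ?thesis by (simp add: card)
    qed
    define p q where "p l = (\<Sum>i\<in>A. x i ^ Suc (m - l))" and "q l = (\<Sum>i\<in>A. y i ^ Suc (m - l))" for l
    have "real n * esym x n = - (\<Sum>l\<le>m. esym x l * p l)" "real n * esym y n = - (\<Sum>l\<le>m. esym y l * q l)"
      using newton_identity[of m x] newton_identity[of m y] Suc by (simp_all add: p_def q_def)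
    then have "real n * (esym x n - esym y n) = - (\<Sum>l\<le>m. esym x l * p l - esym y l * q l)"
      by (simp add: right_diff_distrib sum_subtractf)
    also have "(\<Sum>l\<le>m. esym x l * p l - esym y l * q l)
        = (\<Sum>l\<le>m. (esym x l - esym y l) * p l + esym y l * (p l - q l))"
      by (intro sum.cong) (auto simp: algebra_simps)
    finally have "real n * (esym x n - esym y n)
        = - (\<Sum>l\<le>m. (esym x l - esym y l) * (\<Sum>i\<in>A. x i ^ Suc (m - l))
            + esym y l * ((\<Sum>i\<in>A. x i ^ Suc (m - l)) - (\<Sum>i\<in>A. y i ^ Suc (m - l))))"
      unfolding p_def q_def .
    from arg_cong[OF this, of abs] have "real n * \<bar>esym x n - esym y n\<bar>
        = \<bar>\<Sum>l\<le>m. (esym x l - esym y l) * (\<Sum>i\<in>A. x i ^ Suc (m - l))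
            + esym y l * ((\<Sum>i\<in>A. x i ^ Suc (m - l)) - (\<Sum>i\<in>A. y i ^ Suc (m - l)))\<bar>"
      by (simp only: abs_mult abs_minus_cancel abs_of_nat)
    also have "\<dots> \<le> (\<Sum>l\<le>m. real m * real (Suc k) ^ m * \<eta> * real k + real (Suc k) ^ m * \<eta>)"
    proof (rule order_trans[OF sum_abs sum_mono])
      fix l assume l: "l \<in> {..m}"
      have mono: "real (Suc k) ^ l \<le> real (Suc k) ^ m" using l by (intro power_increasing) auto
      have "\<bar>esym x l - esym y l\<bar> \<le> real l * real (Suc k) ^ l * \<eta>" using less l Suc by auto
      also have "\<dots> \<le> real m * real (Suc k) ^ m * \<eta>"
        using l mono \<open>\<eta> \<ge> 0\<close> by (intro mult_mono) auto
      finally have 1: "\<bar>esym x l - esym y l\<bar> \<le> real m * real (Suc k) ^ m * \<eta>" .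
      have 2: "\<bar>esym y l\<bar> \<le> real (Suc k) ^ m" using esym_bound[of y l, OF y] mono by linarith
      have 3: "\<bar>(\<Sum>i\<in>A. x i ^ Suc (m - l)) - (\<Sum>i\<in>A. y i ^ Suc (m - l))\<bar> \<le> \<eta>"
        using less(2) Suc l by (intro close) auto
      show "\<bar>(esym x l - esym y l) * (\<Sum>i\<in>A. x i ^ Suc (m - l))
            + esym y l * ((\<Sum>i\<in>A. x i ^ Suc (m - l)) - (\<Sum>i\<in>A. y i ^ Suc (m - l)))\<bar>
         \<le> real m * real (Suc k) ^ m * \<eta> * real k + real (Suc k) ^ m * \<eta>"
        by (rule order_trans[OF abs_triangle_ineq], unfold abs_mult, intro add_mono mult_mono 1 2 3 p)
          (use \<open>\<eta> \<ge> 0\<close> in auto)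
    qed
    also have "\<dots> = real n * (real m * real (Suc k) ^ m * \<eta> * real k + real (Suc k) ^ m * \<eta>)"
      using Suc by simp
    finally have "\<bar>esym x n - esym y n\<bar> \<le> real m * real (Suc k) ^ m * \<eta> * real k + real (Suc k) ^ m * \<eta>"
      by (rule mult_left_le_imp_le) (use Suc in simp)
    also have "\<dots> \<le> (real m * real (Suc k) ^ m * \<eta>) * real (Suc k) + (real (Suc k) ^ m * \<eta>) * real (Suc k)"
    proof (intro add_mono mult_left_mono)
      show "real (Suc k) ^ m * \<eta> \<le> real (Suc k) ^ m * \<eta> * real (Suc k)"
        using \<open>\<eta> \<ge> 0\<close> mult_left_mono[of 1 "real (Suc k)" "real (Suc k) ^ m * \<eta>"] by simp
    qed (use \<open>\<eta> \<ge> 0\<close> in auto)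
    finally show ?thesis using Suc by (simp add: algebra_simps)
  qed
qed

text \<open>\<open>esym\<close> was read off the product of the factors \<open>1 - x i X\<close>,
  the reversed polynomial, so its values appear here as coefficients in descending order.\<close>

lemma prod_diff_eq_esym:
  "(\<Prod>i\<in>A. t - x i) = (\<Sum>n\<le>k. esym x n * t ^ (k - n))"
proof -
  define f where "f = (\<Prod>i\<in>A. [:- x i, 1:])"
  have deg: "degree f = k"
    unfolding f_def by (subst degree_prod_eq_sum_degree) (auto simp: card)
  have "reflect_poly f = (\<Prod>i\<in>A. [:1, - x i:])"
    unfolding f_def reflect_poly_prod by (intro prod.cong) (auto simp: reflect_poly_def cCons_def)
  then have reflect: "fps_of_poly (reflect_poly f) = (\<Prod>i\<in>A. 1 - fps_const (x i) * fps_X)"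
    by (simp add: fps_of_poly_prod fps_of_poly_pCons mult.commute flip: fps_const_neg)
  then have coeff: "poly.coeff f (k - n) = esym x n" if "n \<le> k" for n
    using that deg unfolding esym_def reflect[symmetric] by (simp add: coeff_reflect_poly)
  have "(\<Prod>i\<in>A. t - x i) = poly f t" by (simp add: f_def poly_prod)
  also have "\<dots> = (\<Sum>n\<le>k. poly.coeff f n * t ^ n)" by (simp add: poly_altdef deg)
  also have "\<dots> = (\<Sum>n\<le>k. poly.coeff f (k - n) * t ^ (k - n))"
    by (rule sum.reindex_bij_witness[of _ "\<lambda>n. k - n" "\<lambda>n. k - n"]) auto
  finally show ?thesis by (simp add: coeff)
qed

text \<open>The polynomials with roots \<open>x\<close> and \<open>y\<close> have nearby coefficients by Newton's identities;
  evaluating the first one at \<open>y i\<close> isolates the factor \<open>y i - x i\<close>.\<close>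

lemma close_if_power_sums_close:
  assumes x: "\<And>i. i \<in> A \<Longrightarrow> \<bar>x i\<bar> \<le> 1" and y: "\<And>i. i \<in> A \<Longrightarrow> \<bar>y i\<bar> \<le> 1"
    and close: "\<And>j. 1 \<le> j \<Longrightarrow> j \<le> k \<Longrightarrow> \<bar>(\<Sum>i\<in>A. x i ^ j) - (\<Sum>i\<in>A. y i ^ j)\<bar> \<le> \<eta>"
    and sep: "\<And>i m. i \<in> A \<Longrightarrow> m \<in> A \<Longrightarrow> i \<noteq> m \<Longrightarrow> g \<le> \<bar>y i - x m\<bar>"
    and "\<eta> \<ge> 0" "g > 0" "i \<in> A"
  shows "\<bar>x i - y i\<bar> \<le> real (Suc k) ^ (k + 2) / g ^ (k - 1) * \<eta>"
proof -
  have "(\<Prod>m\<in>A. y i - y m) = 0" using \<open>i \<in> A\<close> fin by auto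
  then have "\<bar>\<Prod>m\<in>A. y i - x m\<bar> = \<bar>(\<Prod>m\<in>A. y i - x m) - (\<Prod>m\<in>A. y i - y m)\<bar>" by simp
  also have "\<dots> = \<bar>\<Sum>n\<le>k. (esym x n - esym y n) * y i ^ (k - n)\<bar>"
    unfolding prod_diff_eq_esym by (simp add: sum_subtractf algebra_simps)
  also have "\<dots> \<le> (\<Sum>n\<le>k. real (Suc k) * real (Suc k) ^ k * \<eta>)"
  proof (rule order_trans[OF sum_abs sum_mono])
    fix n assume n: "n \<in> {..k}"
    have "\<bar>(esym x n - esym y n) * y i ^ (k - n)\<bar> \<le> \<bar>esym x n - esym y n\<bar> * 1"
      unfolding abs_mult power_abs by (intro mult_left_mono power_le_one y \<open>i \<in> A\<close>) auto
    also have "\<dots> \<le> real n * real (Suc k) ^ n * \<eta>"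
      using esym_close[OF x y close \<open>\<eta> \<ge> 0\<close>] n by simp
    also have "\<dots> \<le> real (Suc k) * real (Suc k) ^ k * \<eta>"
      using n \<open>\<eta> \<ge> 0\<close> by (intro mult_mono power_increasing) auto
    finally show "\<bar>(esym x n - esym y n) * y i ^ (k - n)\<bar> \<le> real (Suc k) * real (Suc k) ^ k * \<eta>" .
  qed
  also have "\<dots> = real (Suc k) ^ (k + 2) * \<eta>" by simp
  finally have 1: "\<bar>\<Prod>m\<in>A. y i - x m\<bar> \<le> real (Suc k) ^ (k + 2) * \<eta>" .
  \<comment> \<open>Every factor except the one of index \<open>i\<close> is at least
    \<open>g\<close>; dividing by them is the source of the denominator
    \<open>g ^ (k - 1)\<close>.\<close>
  have "g ^ (k - 1) = (\<Prod>m\<in>A - {i}. g)" using fin \<open>i \<in> A\<close> card by simp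
  also have "\<dots> \<le> (\<Prod>m\<in>A - {i}. \<bar>y i - x m\<bar>)"
    using sep \<open>i \<in> A\<close> \<open>g > 0\<close> by (intro prod_mono) auto
  finally have "\<bar>y i - x i\<bar> * g ^ (k - 1) \<le> \<bar>y i - x i\<bar> * (\<Prod>m\<in>A - {i}. \<bar>y i - x m\<bar>)"
    by (intro mult_left_mono) auto
  also have "\<dots> = \<bar>\<Prod>m\<in>A. y i - x m\<bar>"
    by (subst prod.remove[OF fin \<open>i \<in> A\<close>]) (simp add: abs_mult abs_prod)
  finally have "\<bar>y i - x i\<bar> * g ^ (k - 1) \<le> real (Suc k) ^ (k + 2) * \<eta>" using 1 by linarith
  then show ?thesis using \<open>g > 0\<close> by (simp add: field_simps abs_minus_commute)
qed

end

subsection \<open>Additive characters\<close>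

definition add_char :: "real \<Rightarrow> complex" where "add_char t = cis (2 * pi * t)"

lemma norm_add_char [simp]: "norm (add_char t) = 1"
  by (simp add: add_char_def)

lemma add_char_0 [simp]: "add_char 0 = 1"
  by (simp add: add_char_def)

lemma add_char_add: "add_char (s + t) = add_char s * add_char t"
  by (simp add: add_char_def cis_mult algebra_simps)

lemma add_char_minus: "add_char (- t) = cnj (add_char t)"
  by (simp add: add_char_def cis_cnj)

lemma add_char_diff: "add_char (s - t) = add_char s * cnj (add_char t)"
  using add_char_add[of s "- t"] by (simp add: add_char_minus)

lemma add_char_of_int [simp]: "add_char (of_int n) = 1"
  by (simp add: add_char_def cis_multiple_2pi)

lemma add_char_sum: "add_char (\<Sum>i\<in>A. f i) = (\<Prod>i\<in>A. add_char (f i))"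
  by (induction A rule: infinite_finite_induct) (auto simp: add_char_add)

lemma add_char_of_nat_mult: "add_char (real n * t) = add_char t ^ n"
  by (induction n) (auto simp: add_char_add algebra_simps)

lemma add_char_eq_1D:
  assumes "add_char t = 1"
  shows "t \<in> \<int>"
proof -
  have "cos (2 * pi * t) = 1" using arg_cong[OF assms, of Re] by (simp add: add_char_def)
  then obtain n :: int where "2 * pi * t = of_int n * 2 * pi" by (auto simp: cos_one_2pi_int)
  then have "t = of_int n" by simp
  then show ?thesis by simp
qed

lemma sum_add_char_residues:
  assumes "R > 0"
  shows "(\<Sum>x<R. add_char (real x * of_int d / real R)) = (if int R dvd d then of_nat R else 0)"
proof (cases "int R dvd d")
  case True
  then obtain e where d: "d = int R * e" by auto
  have "add_char (real x * of_int d / real R) = 1" for x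
    using assms add_char_of_int[of "int x * e"] by (simp add: d field_simps)
  then show ?thesis using True by simp
next
  case False
  define w where "w = add_char (of_int d / real R)"
  have w: "w \<noteq> 1"
  proof
    assume "w = 1"
    then obtain e where "of_int d / real R = of_int e"
      using add_char_eq_1D by (metis w_def Ints_cases)
    then have "real_of_int d = of_int (int R * e)" using assms by (simp add: field_simps)
    then have "d = int R * e" by linarith
    then show False using False by simp
  qed
  have "w ^ R = add_char (of_int d)"
    unfolding w_def add_char_of_nat_mult[symmetric] using assms by simp
  then have "w ^ R = 1" by simp
  have "(\<Sum>x<R. add_char (real x * of_int d / real R)) = (\<Sum>x<R. w ^ x)"
    by (simp add: w_def flip: add_char_of_nat_mult)
  also have "\<dots> = 0" using w \<open>w ^ R = 1\<close> by (simp add: geometric_sum)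
  finally show ?thesis using False by simp
qed

lemma power_mean_even:
  fixes a :: "'i \<Rightarrow> real"
  assumes "finite I" "I \<noteq> {}" "even p"
  shows "((\<Sum>i\<in>I. a i) / card I) ^ p \<le> (\<Sum>i\<in>I. a i ^ p) / card I"
proof -
  have "(\<Sum>i\<in>I. (1 / card I) *\<^sub>R a i) ^ p \<le> (\<Sum>i\<in>I. 1 / card I * a i ^ p)"
    using assms by (intro convex_on_sum[OF _ _ convex_power_even]) (auto simp: field_simps)
  then show ?thesis by (simp add: sum_divide_distrib)
qed

subsection \<open>Mean values of exponential sums\<close>

definition dotp :: "nat \<Rightarrow> nat \<Rightarrow> (nat \<Rightarrow> nat) \<Rightarrow> (nat \<Rightarrow> int) \<Rightarrow> real" where
  "dotp k R x w = (\<Sum>j=1..k. real (x j) * of_int (w j) / real R)"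

lemma dotp_add: "dotp k R x (\<lambda>j. w j + v j) = dotp k R x w + dotp k R x v"
  by (simp add: dotp_def sum.distrib[symmetric] algebra_simps add_divide_distrib)

lemma dotp_diff: "dotp k R x (\<lambda>j. w j - v j) = dotp k R x w - dotp k R x v"
  by (simp add: dotp_def sum_subtractf[symmetric] algebra_simps diff_divide_distrib)

lemma dotp_sum: "dotp k R x (\<lambda>j. \<Sum>i\<in>I. w i j) = (\<Sum>i\<in>I. dotp k R x (w i))"
  unfolding dotp_def by (subst sum.swap) (simp add: sum_distrib_left sum_divide_distrib)

text \<open>Averages over the torus are replaced by averages over the points with denominator \<open>R\<close>, which
  detect equality of integer vectors with entries below \<open>R\<close> in absolute value.\<close>

definition freqs :: "nat \<Rightarrow> nat \<Rightarrow> (nat \<Rightarrow> nat) set" where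
  "freqs k R = PiE {1..k} (\<lambda>_. {..<R})"

lemma finite_freqs [simp]: "finite (freqs k R)"
  by (auto simp: freqs_def intro: finite_PiE)

lemma card_freqs [simp]: "card (freqs k R) = R ^ k"
  by (simp add: freqs_def card_PiE)

lemma orthogonality:
  assumes "R > 0"
  shows "(\<Sum>x\<in>freqs k R. add_char (dotp k R x w))
       = (if \<forall>j\<in>{1..k}. int R dvd w j then of_nat R ^ k else 0)"
proof -
  have "(\<Sum>x\<in>freqs k R. add_char (dotp k R x w))
      = (\<Prod>j=1..k. \<Sum>y<R. add_char (real y * of_int (w j) / real R))"
    unfolding dotp_def add_char_sum freqs_def by (subst prod_sum_PiE) auto
  also have "\<dots> = (\<Prod>j=1..k. if int R dvd w j then of_nat R else 0)"
    using assms by (simp add: sum_add_char_residues)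
  also have "\<dots> = (if \<forall>j\<in>{1..k}. int R dvd w j then of_nat R ^ k else 0)"
  proof (cases "\<forall>j\<in>{1..k}. int R dvd w j")
    case True
    then have "(\<Prod>j=1..k. if int R dvd w j then of_nat R else 0) = (\<Prod>j=1..k. of_nat R :: complex)"
      by (intro prod.cong) auto
    then show ?thesis using True by simp
  next
    case False
    then have "(\<Prod>j=1..k. if int R dvd w j then of_nat R else 0) = (0 :: complex)"
      by (subst prod_zero_iff) auto
    then show ?thesis by (simp only: False if_False)
  qed
  finally show ?thesis .
qed

text \<open>Index set and attached vectors are arbitrary, so that powers of one exponential sum,
  products over different pieces and sums over pairs of tuples are all instances and share one
  orthogonality argument.\<close>

definition multisum :: "nat \<Rightarrow> nat \<Rightarrow> (nat \<Rightarrow> nat) \<Rightarrow> 't set \<Rightarrow> ('t \<Rightarrow> nat \<Rightarrow> int) \<Rightarrow> complex" where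
  "multisum k R x T \<mu> = (\<Sum>t\<in>T. add_char (dotp k R x (\<mu> t)))"

lemma norm_sq_multisum:
  "of_real ((norm (multisum k R x T \<mu>))\<^sup>2)
   = (\<Sum>(t, t')\<in>T \<times> T. add_char (dotp k R x (\<lambda>j. \<mu> t j - \<mu> t' j)))"
  unfolding complex_norm_square multisum_def
  by (simp add: sum_product sum.cartesian_product dotp_diff add_char_diff)

lemma mean_sq_multisum:
  assumes "finite T" "R > 0"
  shows "(\<Sum>x\<in>freqs k R. (norm (multisum k R x T \<mu>))\<^sup>2)
    = real R ^ k * card {(t, t'). t \<in> T \<and> t' \<in> T \<and> (\<forall>j\<in>{1..k}. int R dvd \<mu> t j - \<mu> t' j)}"
proof -
  have "complex_of_real (\<Sum>x\<in>freqs k R. (norm (multisum k R x T \<mu>))\<^sup>2)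
     = (\<Sum>(t, t')\<in>T \<times> T. \<Sum>x\<in>freqs k R. add_char (dotp k R x (\<lambda>j. \<mu> t j - \<mu> t' j)))"
    unfolding of_real_sum norm_sq_multisum by (subst sum.swap) (simp add: case_prod_unfold)
  also have "\<dots> = (\<Sum>p\<in>T \<times> T. if \<forall>j\<in>{1..k}. int R dvd \<mu> (fst p) j - \<mu> (snd p) j then of_nat R ^ k else 0)"
    using assms by (simp add: orthogonality case_prod_unfold)
  also have "\<dots> = (\<Sum>p\<in>{p \<in> T \<times> T. \<forall>j\<in>{1..k}. int R dvd \<mu> (fst p) j - \<mu> (snd p) j}. of_nat R ^ k)"
    using assms by (intro sum.inter_filter[symmetric]) auto
  also have "{p \<in> T \<times> T. \<forall>j\<in>{1..k}. int R dvd \<mu> (fst p) j - \<mu> (snd p) j}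
      = {(t, t'). t \<in> T \<and> t' \<in> T \<and> (\<forall>j\<in>{1..k}. int R dvd \<mu> t j - \<mu> t' j)}" by auto
  finally have "complex_of_real (\<Sum>x\<in>freqs k R. (norm (multisum k R x T \<mu>))\<^sup>2)
     = of_real (real R ^ k * card {(t, t'). t \<in> T \<and> t' \<in> T \<and> (\<forall>j\<in>{1..k}. int R dvd \<mu> t j - \<mu> t' j)})"
    by simp
  then show ?thesis by (simp only: of_real_eq_iff)
qed

text \<open>Only the first square is expanded. For a pair \<open>(t, t')\<close> the average of its
  character against the second square vanishes, by orthogonality, unless some \<open>z, z'\<close>
  compensate the difference; otherwise it is bounded trivially by the average of the second square.
  The first factor thus costs just the number of pairs that can be compensated.\<close>

lemma mean_product_le:
  assumes "finite T" "finite Z" "R > 0"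
  shows "(\<Sum>x\<in>freqs k R. (norm (multisum k R x T \<mu>))\<^sup>2 * (norm (multisum k R x Z \<nu>))\<^sup>2)
    \<le> card {(t, t'). t \<in> T \<and> t' \<in> T \<and>
          (\<exists>z\<in>Z. \<exists>z'\<in>Z. \<forall>j\<in>{1..k}. int R dvd (\<mu> t j - \<mu> t' j) + (\<nu> z j - \<nu> z' j))}
      * (\<Sum>x\<in>freqs k R. (norm (multisum k R x Z \<nu>))\<^sup>2)"
proof -
  define N where "N = {(t, t'). t \<in> T \<and> t' \<in> T \<and>
          (\<exists>z\<in>Z. \<exists>z'\<in>Z. \<forall>j\<in>{1..k}. int R dvd (\<mu> t j - \<mu> t' j) + (\<nu> z j - \<nu> z' j))}"
  define H where "H x = (norm (multisum k R x Z \<nu>))\<^sup>2" for x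
  define I where "I p = (\<Sum>x\<in>freqs k R. add_char (dotp k R x (\<lambda>j. \<mu> (fst p) j - \<mu> (snd p) j)) * of_real (H x))" for p
  have N: "N \<subseteq> T \<times> T" by (auto simp: N_def)
  have zero: "I p = 0" if "p \<in> T \<times> T - N" for p
  proof -
    have "I p = (\<Sum>q\<in>Z \<times> Z. \<Sum>x\<in>freqs k R. add_char (dotp k R x
              (\<lambda>j. (\<mu> (fst p) j - \<mu> (snd p) j) + (\<nu> (fst q) j - \<nu> (snd q) j))))"
      unfolding I_def H_def norm_sq_multisum sum_distrib_left
      by (subst sum.swap) (simp add: case_prod_unfold dotp_add add_char_add)
    also have "\<dots> = 0"
    proof (rule sum.neutral, rule ballI)
      fix q assume q: "q \<in> Z \<times> Z"
      have "\<not> (\<forall>j\<in>{1..k}. int R dvd (\<mu> (fst p) j - \<mu> (snd p) j) + (\<nu> (fst q) j - \<nu> (snd q) j))"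
        using that q unfolding N_def by (cases p, cases q) auto
      then show "(\<Sum>x\<in>freqs k R. add_char (dotp k R x
              (\<lambda>j. (\<mu> (fst p) j - \<mu> (snd p) j) + (\<nu> (fst q) j - \<nu> (snd q) j)))) = 0"
        unfolding orthogonality[OF assms(3)] by (simp only: if_False)
    qed
    finally show ?thesis .
  qed
  have bound: "norm (I p) \<le> (\<Sum>x\<in>freqs k R. H x)" for p
    unfolding I_def by (rule order_trans[OF norm_sum sum_mono]) (auto simp: norm_mult norm_power H_def)
  have "complex_of_real (\<Sum>x\<in>freqs k R. (norm (multisum k R x T \<mu>))\<^sup>2 * H x) = (\<Sum>p\<in>T \<times> T. I p)"
    unfolding of_real_sum of_real_mult norm_sq_multisum I_def sum_distrib_right
    by (subst sum.swap) (simp add: case_prod_unfold)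
  also have "\<dots> = (\<Sum>p\<in>N. I p)"
    using assms N zero by (intro sum.mono_neutral_right) auto
  finally have "\<bar>\<Sum>x\<in>freqs k R. (norm (multisum k R x T \<mu>))\<^sup>2 * H x\<bar> = norm (\<Sum>p\<in>N. I p)"
    by (metis norm_of_real)
  also have "\<dots> \<le> (\<Sum>p\<in>N. \<Sum>x\<in>freqs k R. H x)"
    by (rule order_trans[OF norm_sum sum_mono[OF bound]])
  finally show ?thesis by (simp add: N_def H_def)
qed

definition expsum :: "nat \<Rightarrow> nat \<Rightarrow> (nat \<Rightarrow> nat) \<Rightarrow> int set \<Rightarrow> complex" where
  "expsum k R x A = (\<Sum>h\<in>A. add_char (dotp k R x (\<lambda>j. h ^ j)))"

definition psum :: "'i set \<Rightarrow> ('i \<Rightarrow> int) \<Rightarrow> nat \<Rightarrow> int" where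
  "psum I t j = (\<Sum>i\<in>I. t i ^ j)"

lemma prod_expsum:
  assumes "finite I" "\<And>i. i \<in> I \<Longrightarrow> finite (J i)"
  shows "(\<Prod>i\<in>I. expsum k R x (J i)) = multisum k R x (PiE I J) (psum I)"
  unfolding expsum_def multisum_def psum_def dotp_sum add_char_sum
  using assms by (simp add: prod_sum_PiE)

lemma expsum_power:
  assumes "finite A"
  shows "expsum k R x A ^ s = multisum k R x (PiE {..<s} (\<lambda>_. A)) (psum {..<s})"
  using prod_expsum[of "{..<s}" "\<lambda>_. A" k R x] assms by simp

text \<open>Not normalised: by \<open>mean_sq_multisum\<close> it is \<open>R ^ k\<close> times the
  number of solutions of the power sum congruences modulo \<open>R\<close>. Hence the factor
  \<open>R ^ k\<close> in all bounds.\<close>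

definition mean_value :: "nat \<Rightarrow> nat \<Rightarrow> nat \<Rightarrow> int set \<Rightarrow> real" where
  "mean_value k R s A = (\<Sum>x\<in>freqs k R. norm (expsum k R x A) ^ (2 * s))"

lemma mean_value_eq:
  assumes "finite A"
  shows "mean_value k R s A = (\<Sum>x\<in>freqs k R. (norm (multisum k R x (PiE {..<s} (\<lambda>_. A)) (psum {..<s})))\<^sup>2)"
  unfolding mean_value_def expsum_power[OF assms, symmetric]
  by (simp add: norm_power power_mult[symmetric] mult.commute)

lemma expsum_norm_le: "norm (expsum k R x A) \<le> card A"
  unfolding expsum_def using sum_norm_le[of A "\<lambda>h. add_char (dotp k R x (\<lambda>j. h ^ j))" "\<lambda>_. 1"] by simp

lemma mean_value_trivial: "mean_value k R s A \<le> real R ^ k * real (card A) ^ (2 * s)"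
proof -
  have "mean_value k R s A \<le> (\<Sum>x\<in>freqs k R. real (card A) ^ (2 * s))"
    unfolding mean_value_def by (intro sum_mono power_mono expsum_norm_le) auto
  then show ?thesis by simp
qed

lemma mean_value_nonneg: "mean_value k R s A \<ge> 0"
  unfolding mean_value_def by (intro sum_nonneg) auto

subsection \<open>Tuples with nearly equal power sums\<close>

lemma card_le_card_image_mult_fiber:
  assumes "finite X" "\<And>y. y \<in> f ` X \<Longrightarrow> real (card {x \<in> X. f x = y}) \<le> B"
  shows "real (card X) \<le> real (card (f ` X)) * B"
proof -
  have "real (card X) = (\<Sum>y\<in>f ` X. real (card {x \<in> X. f x = y}))"
    using sum.image_gen[OF assms(1), of "\<lambda>_. 1 :: real" f] by simp
  also have "\<dots> \<le> (\<Sum>y\<in>f ` X. B)" by (intro sum_mono assms)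
  finally show ?thesis by simp
qed

lemma card_int_interval_le:
  fixes a b :: real
  assumes "a \<le> b"
  shows "real (card {\<lfloor>a\<rfloor>..\<lfloor>b\<rfloor>}) \<le> b - a + 2"
proof -
  have "\<lfloor>a\<rfloor> \<le> \<lfloor>b\<rfloor>" using assms by (rule floor_mono)
  then have "real (card {\<lfloor>a\<rfloor>..\<lfloor>b\<rfloor>}) = of_int \<lfloor>b\<rfloor> - of_int \<lfloor>a\<rfloor> + 1" by simp
  then show ?thesis by linarith
qed

text \<open>The power sums are localised to cells of size \<open>V ^ (j - 1)\<close>; two separated tuples in the
  same cell differ by a bounded amount in each coordinate.\<close>

lemma card_near_le:
  fixes J :: "'i \<Rightarrow> int set" and b :: int
  assumes fin: "finite T" and card: "card T = k"
    and J: "\<And>i h. i \<in> T \<Longrightarrow> h \<in> J i \<Longrightarrow> \<bar>of_int (h - b)\<bar> \<le> V" and finJ: "\<And>i. i \<in> T \<Longrightarrow> finite (J i)"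
    and sep: "\<And>i m h h'. i \<in> T \<Longrightarrow> m \<in> T \<Longrightarrow> i \<noteq> m \<Longrightarrow> h \<in> J i \<Longrightarrow> h' \<in> J m \<Longrightarrow> g * V \<le> \<bar>of_int (h - h')\<bar>"
    and V: "V \<ge> 1" "W \<ge> 0" "\<And>j. 1 \<le> j \<Longrightarrow> j \<le> k \<Longrightarrow> V ^ (j - 1) \<le> W ^ j" and "g > 0"
  shows "real (card {t \<in> PiE T J. \<forall>j\<in>{1..k}. \<bar>of_int (psum T (\<lambda>i. t i - b) j) - c j\<bar> \<le> real s * W ^ j})
     \<le> (2 * real s + 2) ^ k * (2 * (real (Suc k) ^ (k + 2) / g ^ (k - 1)) + 2) ^ k * (\<Prod>j=1..k. W ^ j / V ^ (j - 1))"
proof -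
  define X where "X = {t \<in> PiE T J. \<forall>j\<in>{1..k}. \<bar>of_int (psum T (\<lambda>i. t i - b) j) - c j\<bar> \<le> real s * W ^ j}"
  define D where "D = real (Suc k) ^ (k + 2) / g ^ (k - 1)"
  define lo hi where "lo j = (c j - real s * W ^ j) / V ^ (j - 1)" and "hi j = (c j + real s * W ^ j) / V ^ (j - 1)" for j
  \<comment> \<open>\<open>f\<close> records, for each degree, the cell of width
    \<open>V ^ (j - 1)\<close> that contains the power sum. The count is at most the number of cells
    met times the largest fibre.\<close>
  define f where "f t = restrict (\<lambda>j. \<lfloor>of_int (psum T (\<lambda>i. t i - b) j) / V ^ (j - 1)\<rfloor>) {1..k}" for t
  have "D > 0" unfolding D_def using \<open>g > 0\<close> by simp
  have "finite (PiE T J)" using fin finJ by (intro finite_PiE) auto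
  then have finX: "finite X" by (simp add: X_def)
  have im: "f ` X \<subseteq> PiE {1..k} (\<lambda>j. {\<lfloor>lo j\<rfloor>..\<lfloor>hi j\<rfloor>})"
  proof (intro image_subsetI PiE_I)
    fix t j assume "t \<in> X" and j: "j \<in> {1..k}"
    then have "\<bar>of_int (psum T (\<lambda>i. t i - b) j) - c j\<bar> \<le> real s * W ^ j" by (auto simp: X_def)
    then have "lo j \<le> of_int (psum T (\<lambda>i. t i - b) j) / V ^ (j - 1)"
        "of_int (psum T (\<lambda>i. t i - b) j) / V ^ (j - 1) \<le> hi j"
      unfolding lo_def hi_def using V(1) by (intro divide_right_mono; simp add: abs_le_iff)+
    then show "f t j \<in> {\<lfloor>lo j\<rfloor>..\<lfloor>hi j\<rfloor>}" using j by (auto simp: f_def intro: floor_mono)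
  qed (auto simp: f_def)
  have fiber: "real (card {t \<in> X. f t = y}) \<le> (2 * D + 2) ^ k" if y: "y \<in> f ` X" for y
  proof -
    obtain t0 where t0: "t0 \<in> X" "y = f t0" using y by auto
    have "{t \<in> X. f t = y} \<subseteq> PiE T (\<lambda>i. {\<lfloor>of_int (t0 i) - D\<rfloor>..\<lfloor>of_int (t0 i) + D\<rfloor>})"
    proof (intro subsetI PiE_I)
      fix t i assume t: "t \<in> {t \<in> X. f t = y}" and i: "i \<in> T"
      have tJ: "t i \<in> J i" "t0 i \<in> J i" if "i \<in> T" for i using t t0 that by (auto simp: X_def)
      \<comment> \<open>Division by \<open>V\<close> brings all variables into
        \<open>[-1, 1]\<close>. Sharing a cell then means that the normalised power sums agree up to
        \<open>1 / V\<close>, so the variables themselves differ by at most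
        \<open>D\<close>.\<close>
      have "\<bar>of_int (t i - b) / V - of_int (t0 i - b) / V\<bar> \<le> real (Suc k) ^ (k + 2) / g ^ (k - 1) * (1 / V)"
      proof (rule close_if_power_sums_close[OF fin card])
        fix j assume j: "1 \<le> j" "j \<le> k"
        let ?u = "of_int (psum T (\<lambda>i. t i - b) j) :: real" and ?v = "of_int (psum T (\<lambda>i. t0 i - b) j) :: real"
        have "f t j = f t0 j" using t t0 by simp
        then have "\<lfloor>?u / V ^ (j - 1)\<rfloor> = \<lfloor>?v / V ^ (j - 1)\<rfloor>" using j by (simp add: f_def)
        then have "\<bar>?u / V ^ (j - 1) - ?v / V ^ (j - 1)\<bar> \<le> 1" by linarith
        then have "\<bar>?u - ?v\<bar> / V ^ (j - 1) \<le> 1"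
          using V(1) by (simp add: diff_divide_distrib[symmetric] abs_divide)
        then have "\<bar>?u - ?v\<bar> / V ^ (j - 1) / V \<le> 1 / V" using V(1) by (intro divide_right_mono) auto
        moreover have "V ^ (j - 1) * V = V ^ j" using j by (cases j) auto
        ultimately have "\<bar>?u - ?v\<bar> / V ^ j \<le> 1 / V" by simp
        then have "\<bar>(?u - ?v) / V ^ j\<bar> \<le> 1 / V" using V(1) by (simp add: abs_divide)
        moreover have "(?u - ?v) / V ^ j = (\<Sum>i\<in>T. (of_int (t i - b) / V) ^ j) - (\<Sum>i\<in>T. (of_int (t0 i - b) / V) ^ j)"
          by (simp add: psum_def power_divide sum_divide_distrib diff_divide_distrib del: of_int_diff)
        ultimately show "\<bar>(\<Sum>i\<in>T. (of_int (t i - b) / V) ^ j) - (\<Sum>i\<in>T. (of_int (t0 i - b) / V) ^ j)\<bar> \<le> 1 / V"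
          by simp
      next
        fix i m assume im: "i \<in> T" "m \<in> T" "i \<noteq> m"
        have "g * V \<le> \<bar>of_int (t0 i - t m)\<bar>" using sep[OF im tJ(2) tJ(1)] im by simp
        then have "g \<le> \<bar>of_int (t0 i - t m)\<bar> / V" using V(1) by (simp add: field_simps)
        also have "\<dots> = \<bar>of_int (t0 i - t m) / V\<bar>" using V(1) by (simp add: abs_divide)
        also have "of_int (t0 i - t m) / V = of_int (t0 i - b) / V - of_int (t m - b) / V"
          by (simp add: diff_divide_distrib)
        finally show "g \<le> \<bar>of_int (t0 i - b) / V - of_int (t m - b) / V\<bar>" .
      qed (use i J tJ V \<open>g > 0\<close> in \<open>auto simp: abs_divide\<close>)
      then have "\<bar>of_int (t i - t0 i)\<bar> / V \<le> D / V"
        using V(1) by (simp add: D_def abs_divide flip: diff_divide_distrib)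
      then have "\<bar>of_int (t i - t0 i)\<bar> \<le> D" using V(1) by (simp add: divide_le_cancel)
      then have "\<lfloor>of_int (t0 i) - D\<rfloor> \<le> t i" "of_int (t i) \<le> of_int (t0 i) + D" by (simp_all add: abs_le_iff) linarith
      then show "t i \<in> {\<lfloor>of_int (t0 i) - D\<rfloor>..\<lfloor>of_int (t0 i) + D\<rfloor>}"
        by (simp only: atLeastAtMost_iff le_floor_iff simp_thms)
    qed (auto simp: X_def)
    then have "real (card {t \<in> X. f t = y}) \<le> real (card (PiE T (\<lambda>i. {\<lfloor>of_int (t0 i) - D\<rfloor>..\<lfloor>of_int (t0 i) + D\<rfloor>})))"
      using fin by (intro of_nat_mono card_mono finite_PiE) auto
    also have "\<dots> = (\<Prod>i\<in>T. real (card {\<lfloor>of_int (t0 i) - D\<rfloor>..\<lfloor>of_int (t0 i) + D\<rfloor>}))"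
      using fin by (simp add: card_PiE)
    also have "\<dots> \<le> (\<Prod>i\<in>T. 2 * D + 2)"
    proof (intro prod_mono conjI)
      fix i
      show "real (card {\<lfloor>of_int (t0 i) - D\<rfloor>..\<lfloor>of_int (t0 i) + D\<rfloor>}) \<le> 2 * D + 2"
        using card_int_interval_le[of "of_int (t0 i) - D" "of_int (t0 i) + D"] \<open>D > 0\<close> by simp
    qed auto
    finally show ?thesis by (simp add: card)
  qed
  have "real (card (f ` X)) \<le> real (card (PiE {1..k} (\<lambda>j. {\<lfloor>lo j\<rfloor>..\<lfloor>hi j\<rfloor>})))"
    using im by (intro of_nat_mono card_mono finite_PiE) auto
  also have "\<dots> = (\<Prod>j=1..k. real (card {\<lfloor>lo j\<rfloor>..\<lfloor>hi j\<rfloor>}))"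
    by (simp add: card_PiE)
  also have "\<dots> \<le> (\<Prod>j=1..k. (2 * real s + 2) * (W ^ j / V ^ (j - 1)))"
  proof (intro prod_mono conjI)
    fix j assume j: "j \<in> {1..k}"
    have "lo j \<le> hi j" unfolding lo_def hi_def using V by (intro divide_right_mono) auto
    then have "real (card {\<lfloor>lo j\<rfloor>..\<lfloor>hi j\<rfloor>}) \<le> hi j - lo j + 2" by (rule card_int_interval_le)
    also have "hi j - lo j = 2 * real s * (W ^ j / V ^ (j - 1))"
      by (simp add: hi_def lo_def field_simps diff_divide_distrib add_divide_distrib)
    \<comment> \<open>The 2 from rounding is absorbed because a range \<open>W ^ j\<close> is at
      least one cell wide; this is the purpose of the hypothesis relating \<open>V\<close> and
      \<open>W\<close>.\<close>
    also have "2 * real s * (W ^ j / V ^ (j - 1)) + 2 \<le> 2 * real s * (W ^ j / V ^ (j - 1)) + 2 * (W ^ j / V ^ (j - 1))"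
    proof -
      have "V ^ (j - 1) > 0" using V(1) by simp
      then have "1 \<le> W ^ j / V ^ (j - 1)" using V(3)[of j] j by (simp add: le_divide_eq del: One_nat_def)
      then show ?thesis by linarith
    qed
    finally show "real (card {\<lfloor>lo j\<rfloor>..\<lfloor>hi j\<rfloor>}) \<le> (2 * real s + 2) * (W ^ j / V ^ (j - 1))"
      by (simp only: distrib_right)
  qed auto
  also have "\<dots> = (2 * real s + 2) ^ k * (\<Prod>j=1..k. W ^ j / V ^ (j - 1))"
    unfolding prod.distrib by simp
  finally have cells: "real (card (f ` X)) \<le> (2 * real s + 2) ^ k * (\<Prod>j=1..k. W ^ j / V ^ (j - 1))" .
  have "real (card X) \<le> real (card (f ` X)) * (2 * D + 2) ^ k"
    by (rule card_le_card_image_mult_fiber[OF finX fiber])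
  also have "\<dots> \<le> (2 * real s + 2) ^ k * (\<Prod>j=1..k. W ^ j / V ^ (j - 1)) * (2 * D + 2) ^ k"
    using \<open>D > 0\<close> by (intro mult_right_mono cells) auto
  finally show ?thesis unfolding X_def D_def by (simp add: mult_ac)
qed

text \<open>Translation invariance of the system: by the binomial theorem the shifted power sum of
  degree \<open>j\<close> is a combination of the unshifted ones of degree at most \<open>j\<close>,
  with coefficients depending only on \<open>b\<close> and \<open>j\<close>. Degree 0 has to be
  included.\<close>

lemma psum_translate:
  assumes "finite T" "finite I" "\<And>m. m \<le> j \<Longrightarrow> psum T t m + psum I z m = psum T t' m + psum I z' m"
  shows "psum T (\<lambda>i. t i - b) j + psum I (\<lambda>i. z i - b) j = psum T (\<lambda>i. t' i - b) j + psum I (\<lambda>i. z' i - b) j"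
proof -
  have expand: "psum A (\<lambda>i. w i - b) j = (\<Sum>m\<le>j. of_nat (j choose m) * psum A w m * (- b) ^ (j - m))"
    for A :: "'c set" and w
    using binomial_ring[of _ "- b" j] unfolding psum_def
    by (simp add: sum_distrib_left sum_distrib_right) (subst sum.swap, simp)
  have "psum T (\<lambda>i. t i - b) j + psum I (\<lambda>i. z i - b) j
      = (\<Sum>m\<le>j. of_nat (j choose m) * (psum T t m + psum I z m) * (- b) ^ (j - m))"
    unfolding expand by (simp add: sum.distrib[symmetric] algebra_simps)
  also have "\<dots> = (\<Sum>m\<le>j. of_nat (j choose m) * (psum T t' m + psum I z' m) * (- b) ^ (j - m))"
    using assms by simp
  also have "\<dots> = psum T (\<lambda>i. t' i - b) j + psum I (\<lambda>i. z' i - b) j"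
    unfolding expand by (simp add: sum.distrib[symmetric] algebra_simps)
  finally show ?thesis .
qed

lemma psum_bounds:
  assumes "finite I" "\<And>i. i \<in> I \<Longrightarrow> 0 \<le> t i" "\<And>i. i \<in> I \<Longrightarrow> t i \<le> W"
  shows "0 \<le> psum I t j" "psum I t j \<le> int (card I) * W ^ j"
proof -
  show "0 \<le> psum I t j" unfolding psum_def using assms by (intro sum_nonneg) auto
  have "psum I t j \<le> (\<Sum>i\<in>I. W ^ j)" unfolding psum_def using assms by (intro sum_mono power_mono) auto
  then show "psum I t j \<le> int (card I) * W ^ j" by simp
qed

text \<open>Translation by \<open>b\<close> makes the contribution of \<open>z, z'\<close> as small
  as their interval is short, so \<open>t\<close> must have power sums close to those of
  \<open>t'\<close>. There are \<open>P ^ k\<close> choices of \<open>t'\<close>, and for each of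
  them the count of nearby separated tuples applies.\<close>

lemma card_near_pairs_le:
  fixes J :: "'i \<Rightarrow> int set" and b :: int and W :: nat
  assumes fin: "finite T" and card: "card T = k" and "k > 0"
    and J: "\<And>i h. i \<in> T \<Longrightarrow> h \<in> J i \<Longrightarrow> \<bar>of_int (h - b)\<bar> \<le> V" and finJ: "\<And>i. i \<in> T \<Longrightarrow> finite (J i)"
    and cardJ: "\<And>i. i \<in> T \<Longrightarrow> card (J i) = P"
    and JY: "\<And>i h. i \<in> T \<Longrightarrow> h \<in> J i \<Longrightarrow> 0 \<le> h \<and> h \<le> int Y"
    and bY: "0 \<le> b" "b + int W \<le> int Y" and R: "(k + s) * Y ^ k < R" and "Y > 0"
    and sep: "\<And>i m h h'. i \<in> T \<Longrightarrow> m \<in> T \<Longrightarrow> i \<noteq> m \<Longrightarrow> h \<in> J i \<Longrightarrow> h' \<in> J m \<Longrightarrow> g * V \<le> \<bar>of_int (h - h')\<bar>"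
    and V: "V \<ge> 1" "\<And>j. 1 \<le> j \<Longrightarrow> j \<le> k \<Longrightarrow> V ^ (j - 1) \<le> real W ^ j" and "g > 0"
  shows "real (card {(t, t'). t \<in> PiE T J \<and> t' \<in> PiE T J \<and>
          (\<exists>z\<in>PiE {..<s} (\<lambda>_. {b..<b + int W}). \<exists>z'\<in>PiE {..<s} (\<lambda>_. {b..<b + int W}).
            \<forall>j\<in>{1..k}. int R dvd (psum T t j - psum T t' j) + (psum {..<s} z j - psum {..<s} z' j))})
     \<le> real P ^ k * ((2 * real s + 2) ^ k * (2 * (real (Suc k) ^ (k + 2) / g ^ (k - 1)) + 2) ^ k
        * (\<Prod>j=1..k. real W ^ j / V ^ (j - 1)))"
proof -
  define near where "near t' = {t \<in> PiE T J. \<forall>j\<in>{1..k}. \<bar>of_int (psum T (\<lambda>i. t i - b) j)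
      - of_int (psum T (\<lambda>i. t' i - b) j)\<bar> \<le> real s * real W ^ j}" for t'
  define B where "B = (2 * real s + 2) ^ k * (2 * (real (Suc k) ^ (k + 2) / g ^ (k - 1)) + 2) ^ k
        * (\<Prod>j=1..k. real W ^ j / V ^ (j - 1))"
  have finP: "finite (PiE T J)" using fin finJ by (intro finite_PiE) auto
  have "{(t, t'). t \<in> PiE T J \<and> t' \<in> PiE T J \<and>
          (\<exists>z\<in>PiE {..<s} (\<lambda>_. {b..<b + int W}). \<exists>z'\<in>PiE {..<s} (\<lambda>_. {b..<b + int W}).
            \<forall>j\<in>{1..k}. int R dvd (psum T t j - psum T t' j) + (psum {..<s} z j - psum {..<s} z' j))}
      \<subseteq> (\<lambda>(t', t). (t, t')) ` (SIGMA t':PiE T J. near t')" (is "?S \<subseteq> _")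
  proof (rule subsetI)
    fix p assume pS: "p \<in> ?S"
    obtain t t' where p: "p = (t, t')" by (cases p)
    note pS' = pS[unfolded p mem_Collect_eq prod.case]
    have t: "t \<in> PiE T J" "t' \<in> PiE T J"
      using pS'[THEN conjunct1] pS'[THEN conjunct2, THEN conjunct1] .
    from pS'[THEN conjunct2, THEN conjunct2]
    obtain z z' where z: "z \<in> PiE {..<s} (\<lambda>_. {b..<b + int W})" "z' \<in> PiE {..<s} (\<lambda>_. {b..<b + int W})"
      and dvd: "\<And>j. j \<in> {1..k} \<Longrightarrow> int R dvd (psum T t j - psum T t' j) + (psum {..<s} z j - psum {..<s} z' j)"
      by (elim bexE) (rule that, assumption, assumption, drule (1) bspec, assumption)
    have tY: "0 \<le> t i" "t i \<le> int Y" "0 \<le> t' i" "t' i \<le> int Y" if "i \<in> T" for i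
      using JY[OF that] t that by (auto simp: PiE_iff)
    have zW: "b \<le> z i" "z i < b + int W" "b \<le> z' i" "z' i < b + int W" if "i \<in> {..<s}" for i
      using z that by (auto simp: PiE_iff)
    have eq: "psum T t j + psum {..<s} z j = psum T t' j + psum {..<s} z' j" if "j \<le> k" for j
    proof (cases "j = 0")
      case True then show ?thesis by (simp add: psum_def)
    next
      case False
      have b: "0 \<le> psum T w j \<and> psum T w j \<le> int k * int Y ^ j" if "w = t \<or> w = t'" for w
        using that psum_bounds[OF fin, of w "int Y" j] tY card by auto
      have b': "0 \<le> psum {..<s} w j \<and> psum {..<s} w j \<le> int s * int Y ^ j" if "w = z \<or> w = z'" for w
        using that psum_bounds[of "{..<s}" w "int Y" j] zW bY by fastforce
      \<comment> \<open>\<open>R\<close> exceeds every value that \<open>d\<close> can take in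
        absolute value, so the congruence is an equation.\<close>
      define d where "d = (psum T t j - psum T t' j) + (psum {..<s} z j - psum {..<s} z' j)"
      have "\<bar>d\<bar> \<le> int k * int Y ^ j + int s * int Y ^ j"
        unfolding d_def using b[OF disjI1[OF refl]] b[OF disjI2[OF refl]] b'[OF disjI1[OF refl]] b'[OF disjI2[OF refl]] by linarith
      also have "\<dots> \<le> int k * int Y ^ k + int s * int Y ^ k"
        using that \<open>Y > 0\<close> by (intro add_mono mult_left_mono power_increasing) auto
      also have "\<dots> = int ((k + s) * Y ^ k)" by (simp add: algebra_simps)
      also have "\<dots> < int R" using R by linarith
      finally have "\<bar>d\<bar> < int R" .
      moreover have "int R dvd d" unfolding d_def using dvd[of j] that False by simp
      ultimately have "d = 0" using dvd_imp_le_int[of d "int R"] by (cases "d = 0") auto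
      then show ?thesis by (simp add: d_def)
    qed
    have "\<bar>of_int (psum T (\<lambda>i. t i - b) j) - of_int (psum T (\<lambda>i. t' i - b) j)\<bar> \<le> real s * real W ^ j"
      if j: "j \<in> {1..k}" for j
    proof -
      \<comment> \<open>After the shift the entries of \<open>z\<close> and \<open>z'\<close> lie in
        \<open>[0, W)\<close>, so their power sums differ by at most \<open>s W ^ j\<close>.\<close>
      have "psum T (\<lambda>i. t i - b) j + psum {..<s} (\<lambda>i. z i - b) j
          = psum T (\<lambda>i. t' i - b) j + psum {..<s} (\<lambda>i. z' i - b) j"
        using j by (intro psum_translate[OF fin _ eq]) auto
      moreover have "0 \<le> psum {..<s} (\<lambda>i. w i - b) j \<and> psum {..<s} (\<lambda>i. w i - b) j \<le> int s * int W ^ j"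
        if "w = z \<or> w = z'" for w
        using that psum_bounds[of "{..<s}" "\<lambda>i. w i - b" "int W" j] zW by fastforce
      note this[OF disjI1[OF refl]] this[OF disjI2[OF refl]]
      ultimately have "\<bar>psum T (\<lambda>i. t i - b) j - psum T (\<lambda>i. t' i - b) j\<bar> \<le> int s * int W ^ j"
        by auto
      then have "of_int \<bar>psum T (\<lambda>i. t i - b) j - psum T (\<lambda>i. t' i - b) j\<bar> \<le> real_of_int (int s * int W ^ j)"
        by (simp only: of_int_le_iff)
      then show ?thesis by simp
    qed
    then show "p \<in> (\<lambda>(t', t). (t, t')) ` (SIGMA t':PiE T J. near t')"
      using t unfolding p near_def by force
  qed
  moreover have finN: "finite (near t')" for t' unfolding near_def using finP by simp
  ultimately have "real (card ?S) \<le> real (card ((\<lambda>(t', t). (t, t')) ` (SIGMA t':PiE T J. near t')))"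
    using finP by (intro of_nat_mono card_mono finite_imageI finite_SigmaI) auto
  also have "\<dots> \<le> real (card (SIGMA t':PiE T J. near t'))"
    using finP finN by (intro of_nat_mono card_image_le finite_SigmaI) auto
  also have "\<dots> = (\<Sum>t'\<in>PiE T J. real (card (near t')))"
    using finP finN by simp
  also have "\<dots> \<le> (\<Sum>t'\<in>PiE T J. B)"
    unfolding B_def near_def using assms by (intro sum_mono card_near_le) auto
  also have "\<dots> = real P ^ k * B"
    using fin cardJ card by (simp add: card_PiE)
  finally show ?thesis unfolding B_def by simp
qed

subsection \<open>Vinogradov's mean value theorem\<close>

text \<open>Distinct indices of the same parity are non-adjacent, so the corresponding pieces of an interval
  are separated by a full piece.\<close>

lemma separated_or_dominant:
  fixes f :: "nat \<Rightarrow> real"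
  assumes f: "\<forall>i<Q. 0 \<le> f i" and "Q > 0" "k > 0" and S: "S = (\<Sum>i<Q. f i)"
  shows "(\<exists>T\<subseteq>{..<Q}. card T = k \<and> (\<forall>a\<in>T. \<forall>b\<in>T. even a = even b) \<and> (\<forall>a\<in>T. S \<le> 2 * real Q * f a))
     \<or> (\<exists>i<Q. S \<le> 4 * real k * f i)"
proof -
  define B where "B = {i\<in>{..<Q}. S \<le> 2 * real Q * f i}"
  have [simp]: "finite B" by (simp add: B_def)
  have *: ?thesis if "k \<le> card {i\<in>B. even i = p}" for p
  proof -
    from obtain_subset_with_card_n[OF that] obtain T where "T \<subseteq> {i\<in>B. even i = p}" "card T = k"
      by metis
    then show ?thesis by (intro disjI1 exI[of _ T]) (auto simp: B_def)
  qed
  show ?thesis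
  proof (cases "k \<le> card {i\<in>B. even i = True} \<or> k \<le> card {i\<in>B. even i = False}")
    case True
    then show ?thesis using * by blast
  next
    case False
    have "B = {i\<in>B. even i = True} \<union> {i\<in>B. even i = False}" by auto
    then have "card B \<le> card {i\<in>B. even i = True} + card {i\<in>B. even i = False}"
      by (metis card_Un_le)
    then have cB: "card B \<le> 2 * k" using False by linarith
    have rest: "(\<Sum>i\<in>{..<Q} - B. f i) \<le> S / 2"
    proof -
      have "(\<Sum>i\<in>{..<Q} - B. f i) \<le> (\<Sum>i\<in>{..<Q} - B. S / (2 * real Q))"
        using \<open>Q > 0\<close> by (intro sum_mono) (auto simp: B_def field_simps)
      also have "\<dots> \<le> (\<Sum>i<Q. S / (2 * real Q))"
        using assms by (intro sum_mono2) (auto intro!: divide_nonneg_nonneg sum_nonneg)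
      also have "\<dots> = S / 2" using \<open>Q > 0\<close> by simp
      finally show ?thesis .
    qed
    have split: "S = (\<Sum>i\<in>B. f i) + (\<Sum>i\<in>{..<Q} - B. f i)"
      unfolding S by (subst sum.subset_diff[of B]) (auto simp: B_def)
    show ?thesis
    proof (cases "B = {}")
      case True
      then have "S \<le> 0" using split rest by simp
      then have "S \<le> 4 * real k * f 0" using f[rule_format, OF \<open>Q > 0\<close>] by (meson mult_nonneg_nonneg of_nat_0_le_iff order_trans zero_le_numeral)
      then show ?thesis using \<open>Q > 0\<close> by blast
    next
      case False
      then have "Max (f ` B) \<in> f ` B" by (intro Max_in) auto
      then obtain m where m: "m \<in> B" "Max (f ` B) = f m" by auto
      have "f i \<le> f m" if "i \<in> B" for i using that m(2)[symmetric] by simp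
      then have "(\<Sum>i\<in>B. f i) \<le> real (card B) * f m" by (intro sum_bounded_above) auto
      also have "\<dots> \<le> real (2 * k) * f m"
        using cB m f by (intro mult_right_mono of_nat_mono) (auto simp: B_def)
      finally have "S \<le> 4 * real k * f m" using split rest by simp
      then show ?thesis using m by (auto simp: B_def)
    qed
  qed
qed

text \<open>The separated set \<open>T\<close> and the dominant index vary with the frequency, so
  the bound sums over all possibilities. In the separated case only \<open>2 k\<close> of the
  factors are traded for pieces; the other \<open>2 s\<close> keep the whole sum, which can then be
  cut in a different way.\<close>

lemma power_le_separated_plus_dominant:
  fixes f :: "nat \<Rightarrow> real"
  assumes f: "\<forall>i<Q. 0 \<le> f i" and "Q > 0" "k > 0" and N: "0 \<le> N" "N \<le> (\<Sum>i<Q. f i)"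
  shows "N ^ (2 * (k + s)) \<le> (2 * real Q) ^ (2 * k)
        * (\<Sum>T\<in>{T. T \<subseteq> {..<Q} \<and> card T = k \<and> (\<forall>a\<in>T. \<forall>b\<in>T. even a = even b)}. (\<Prod>a\<in>T. (f a)\<^sup>2) * N ^ (2 * s))
      + (4 * real k) ^ (2 * (k + s)) * (\<Sum>i<Q. f i ^ (2 * (k + s)))"
    (is "_ \<le> ?c * (\<Sum>T\<in>?T. ?g T) + ?d * (\<Sum>i<Q. ?h i)")
proof -
  define S where "S = (\<Sum>i<Q. f i)"
  have finT: "finite ?T" by simp
  have nn: "0 \<le> (\<Sum>T\<in>?T. ?g T)" "0 \<le> (\<Sum>i<Q. ?h i)"
    using f \<open>0 \<le> N\<close> by (auto intro!: sum_nonneg mult_nonneg_nonneg prod_nonneg)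
  from separated_or_dominant[OF f \<open>Q > 0\<close> \<open>k > 0\<close> S_def] show ?thesis
  proof (elim disjE exE conjE)
    fix T assume T: "T \<subseteq> {..<Q}" "card T = k" "\<forall>a\<in>T. \<forall>b\<in>T. even a = even b" "\<forall>a\<in>T. S \<le> 2 * real Q * f a"
    have "N ^ (2 * k) = (\<Prod>a\<in>T. N\<^sup>2)" using T by (simp add: power_mult[symmetric])
    also have "\<dots> \<le> (\<Prod>a\<in>T. (2 * real Q)\<^sup>2 * (f a)\<^sup>2)"
    proof (intro prod_mono conjI)
      fix a assume "a \<in> T"
      then have "N \<le> 2 * real Q * f a" using T(4) N S_def by auto
      then show "N\<^sup>2 \<le> (2 * real Q)\<^sup>2 * (f a)\<^sup>2" using power_mono[of N "2 * real Q * f a" 2] N by (simp add: power_mult_distrib)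
    qed auto
    also have "\<dots> = ?c * (\<Prod>a\<in>T. (f a)\<^sup>2)" using T by (simp add: prod.distrib power_mult)
    finally have "N ^ (2 * (k + s)) \<le> ?c * (\<Prod>a\<in>T. (f a)\<^sup>2) * N ^ (2 * s)"
      using N by (simp add: power_add distrib_left mult_right_mono)
    also have "\<dots> = ?c * ?g T" by simp
    also have "T \<in> ?T" using T(1-3) by blast
    then have "?g T \<le> (\<Sum>T\<in>?T. ?g T)"
      by (rule member_le_sum[OF _ _ finT]) (use N in \<open>simp add: prod_nonneg\<close>)
    then have "?c * ?g T \<le> ?c * (\<Sum>T\<in>?T. ?g T)" by (intro mult_left_mono) auto
    finally have 1: "N ^ (2 * (k + s)) \<le> ?c * (\<Sum>T\<in>?T. ?g T)" .
    have "0 \<le> ?d * (\<Sum>i<Q. ?h i)" by (rule mult_nonneg_nonneg[OF _ nn(2)]) simp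
    from add_mono[OF 1 this] show ?thesis by (simp only: add_0_right)
  next
    fix i assume i: "i < Q" "S \<le> 4 * real k * f i"
    have "N ^ (2 * (k + s)) \<le> (4 * real k * f i) ^ (2 * (k + s))"
      using i N by (intro power_mono) (auto simp: S_def)
    also have "\<dots> = ?d * ?h i" by (simp add: power_mult_distrib)
    also have "?h i \<le> (\<Sum>i<Q. ?h i)" using i f by (intro member_le_sum) auto
    then have "?d * ?h i \<le> ?d * (\<Sum>i<Q. ?h i)" by (intro mult_left_mono) auto
    finally have 1: "N ^ (2 * (k + s)) \<le> ?d * (\<Sum>i<Q. ?h i)" .
    have "0 \<le> ?c * (\<Sum>T\<in>?T. ?g T)" by (rule mult_nonneg_nonneg[OF _ nn(1)]) simp
    from add_mono[OF this 1] show ?thesis by (simp only: add_0_left)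
  qed
qed

lemma sum_int_interval_pieces:
  fixes f :: "int \<Rightarrow> 'a::comm_monoid_add"
  assumes "P \<ge> 0"
  shows "(\<Sum>h\<in>{a..<a + int m * P}. f h) = (\<Sum>i<m. \<Sum>h\<in>{a + int i * P..<a + (int i + 1) * P}. f h)"
proof (induction m)
  case (Suc m)
  have "{a..<a + int (Suc m) * P} = {a..<a + int m * P} \<union> {a + int m * P..<a + (int m + 1) * P}"
    using assms by (auto simp: algebra_simps intro: order_less_le_trans add_increasing2)
      (smt (verit) mult_nonneg_nonneg of_nat_0_le_iff)+
  then have "(\<Sum>h\<in>{a..<a + int (Suc m) * P}. f h)
      = (\<Sum>h\<in>{a..<a + int m * P}. f h) + (\<Sum>h\<in>{a + int m * P..<a + (int m + 1) * P}. f h)"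
    by (simp add: sum.union_disjoint)
  then show ?case using Suc by simp
qed simp

lemma expsum_pieces:
  assumes "P \<ge> 0"
  shows "expsum k R x {a..<a + int m * P} = (\<Sum>i<m. expsum k R x {a + int i * P..<a + (int i + 1) * P})"
  unfolding expsum_def by (rule sum_int_interval_pieces[OF assms])

lemma prod_cells:
  assumes "V > 0" "W > 0"
  shows "(\<Prod>j=1..k. W ^ j / V ^ (j - 1) :: real) = W ^ (k * (k + 1) div 2) / V ^ (k * (k - 1) div 2)"
proof (induction k)
  case (Suc k)
  have 1: "Suc k * (Suc k + 1) div 2 = k * (k + 1) div 2 + Suc k"
    using div_mult_self1[of 2 "k * (k + 1)" "Suc k"] by (simp add: algebra_simps)
  have 2: "Suc k * (Suc k - 1) div 2 = k * (k - 1) div 2 + k"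
  proof (cases k)
    case (Suc m)
    then show ?thesis using div_mult_self1[of 2 "Suc m * m" "Suc m"] by (simp add: algebra_simps)
  qed simp
  show ?case unfolding 1 2 power_add using Suc assms by (simp add: field_simps)
qed simp

text \<open>The constant of \<open>card_near_pairs_le\<close> for the gap
  \<open>g = 1 / 2 ^ q\<close>, the length of one piece relative to the interval.\<close>

definition near_const :: "nat \<Rightarrow> nat \<Rightarrow> nat \<Rightarrow> real" where
  "near_const k q s = (2 * real s + 2) ^ k * (2 * (real (Suc k) ^ (k + 2) / (1 / 2 ^ q) ^ (k - 1)) + 2) ^ k"

lemma near_const_nonneg: "0 \<le> near_const k q s"
  by (simp add: near_const_def)

text \<open>The remaining \<open>2 s\<close> factors are cut anew, into pieces of length
  \<open>W = 2 ^ (n - n div k)\<close>, about the power \<open>1 - 1 / k\<close> of the full length.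
  This is the shortest power of two for which a range \<open>W ^ j\<close> still contains a cell
  \<open>V ^ (j - 1)\<close> in every degree. The short pieces confine the separated tuples and
  carry the inductive bound \<open>M\<close>.\<close>

lemma separated_mean_le:
  fixes a :: int
  assumes "k > 0" "q \<le> n"
    and T: "T \<subseteq> {..<2 ^ q}" "card T = k" "\<forall>i\<in>T. \<forall>m\<in>T. even i = even m"
    and a: "0 \<le> a" "a + 2 ^ n \<le> int Y" and R: "(k + s) * Y ^ k < R"
    and M: "\<And>b. 0 \<le> b \<Longrightarrow> b + 2 ^ (n - n div k) \<le> int Y \<Longrightarrow>
        mean_value k R s {b..<b + 2 ^ (n - n div k)} \<le> M"
    and J: "\<And>i. J i = {a + int i * 2 ^ (n - q)..<a + (int i + 1) * 2 ^ (n - q)}"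
  shows "(\<Sum>x\<in>freqs k R. (\<Prod>i\<in>T. (norm (expsum k R x (J i)))\<^sup>2) * norm (expsum k R x {a..<a + 2 ^ n}) ^ (2 * s))
    \<le> (2 ^ (n div k)) ^ (2 * s) * ((2 ^ (n - q)) ^ k * (near_const k q s
        * ((2 ^ (n - n div k)) ^ (k * (k + 1) div 2) / (2 ^ n) ^ (k * (k - 1) div 2))) * M)"
proof -
  define m :: nat where "m = 2 ^ (n div k)"
  define W :: nat where "W = 2 ^ (n - n div k)"
  define P :: nat where "P = 2 ^ (n - q)"
  define V :: real where "V = 2 ^ n"
  define B where "B = real P ^ k * (near_const k q s * (real W ^ (k * (k + 1) div 2) / V ^ (k * (k - 1) div 2)))"
  define I where "I i = {a + int i * int W..<a + (int i + 1) * int W}" for i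
  define G where "G x = (\<Prod>i\<in>T. (norm (expsum k R x (J i)))\<^sup>2)" for x
  have mW: "m * W = 2 ^ n" unfolding m_def W_def by (simp add: power_add[symmetric])
  have PQ: "P * 2 ^ q = 2 ^ n" unfolding P_def using \<open>q \<le> n\<close> by (simp add: power_add[symmetric])
  have [simp]: "finite T" using T finite_subset by blast
  have "R > 0" using R by simp
  have "int Y > 0" using a by (smt (verit) zero_less_power)
  then have "Y > 0" by simp
  have mpos: "m > 0" by (simp add: m_def)
  have J': "J i = {a + int i * int P..<a + (int i + 1) * int P}" for i by (simp add: J P_def)
  have Jsub: "a \<le> h \<and> h < a + 2 ^ n" if "i \<in> T" "h \<in> J i" for i h
  proof -
    have "i < 2 ^ q" using T(1) that(1) by auto
    then have "int (Suc i) \<le> int (2 ^ q)" by (simp only: of_nat_le_iff Suc_le_eq)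
    then have "(int i + 1) * int P \<le> 2 ^ q * int P" by (intro mult_right_mono) auto
    also have "\<dots> = 2 ^ n" using arg_cong[OF PQ, of int] by (simp add: mult.commute)
    finally have "(int i + 1) * int P \<le> 2 ^ n" .
    moreover have "0 \<le> int i * int P" by simp
    ultimately show ?thesis using that(2)[unfolded J' atLeastLessThan_iff] by linarith
  qed
  have Isub: "0 \<le> a + int i * int W \<and> a \<le> a + int i * int W \<and> a + int i * int W + int W \<le> a + 2 ^ n" if "i < m" for i
  proof -
    have "(int i + 1) * int W \<le> int m * int W" using that by (intro mult_right_mono) auto
    also have "\<dots> = 2 ^ n" using arg_cong[OF mW, of int] by simp
    finally show ?thesis using a by (simp add: algebra_simps)
  qed
  have piece: "(\<Sum>x\<in>freqs k R. G x * norm (expsum k R x (I i)) ^ (2 * s)) \<le> B * M" if i: "i < m" for i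
  proof -
    define b where "b = a + int i * int W"
    have Ib: "I i = {b..<b + int W}" by (simp add: I_def b_def algebra_simps)
    have b: "0 \<le> b" "a \<le> b" "b + int W \<le> a + 2 ^ n" using Isub[OF i] by (auto simp: b_def)
    let ?Z = "PiE {..<s} (\<lambda>_. {b..<b + int W})"
    have "(\<Sum>x\<in>freqs k R. G x * norm (expsum k R x (I i)) ^ (2 * s))
       = (\<Sum>x\<in>freqs k R. (norm (multisum k R x (PiE T J) (psum T)))\<^sup>2 * (norm (multisum k R x ?Z (psum {..<s})))\<^sup>2)"
    proof (intro sum.cong arg_cong2[of _ _ _ _ times] refl)
      fix x
      show "G x = (norm (multisum k R x (PiE T J) (psum T)))\<^sup>2"
        using J by (subst prod_expsum[symmetric]) (auto simp: G_def prod_norm[symmetric] prod_power_distrib)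
      show "norm (expsum k R x (I i)) ^ (2 * s) = (norm (multisum k R x ?Z (psum {..<s})))\<^sup>2"
        unfolding Ib by (subst expsum_power[symmetric]) (auto simp: norm_power power_mult[symmetric] mult.commute)
    qed
    also have "\<dots> \<le> real (card {(t, t'). t \<in> PiE T J \<and> t' \<in> PiE T J \<and>
          (\<exists>z\<in>?Z. \<exists>z'\<in>?Z. \<forall>j\<in>{1..k}. int R dvd (psum T t j - psum T t' j) + (psum {..<s} z j - psum {..<s} z' j))})
        * (\<Sum>x\<in>freqs k R. (norm (multisum k R x ?Z (psum {..<s})))\<^sup>2)"
      using J \<open>R > 0\<close> by (intro mean_product_le finite_PiE) auto
    also have "(\<Sum>x\<in>freqs k R. (norm (multisum k R x ?Z (psum {..<s})))\<^sup>2) = mean_value k R s {b..<b + int W}"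
      by (simp add: mean_value_eq)
    also have "real (card {(t, t'). t \<in> PiE T J \<and> t' \<in> PiE T J \<and>
          (\<exists>z\<in>?Z. \<exists>z'\<in>?Z. \<forall>j\<in>{1..k}. int R dvd (psum T t j - psum T t' j) + (psum {..<s} z j - psum {..<s} z' j))})
        * mean_value k R s {b..<b + int W} \<le> B * M"
    proof (rule mult_mono)
      show "mean_value k R s {b..<b + int W} \<le> M" using M[of b] b a by (simp add: W_def)
      have "real (card {(t, t'). t \<in> PiE T J \<and> t' \<in> PiE T J \<and>
          (\<exists>z\<in>?Z. \<exists>z'\<in>?Z. \<forall>j\<in>{1..k}. int R dvd (psum T t j - psum T t' j) + (psum {..<s} z j - psum {..<s} z' j))})
        \<le> real P ^ k * ((2 * real s + 2) ^ k * (2 * (real (Suc k) ^ (k + 2) / (1 / 2 ^ q) ^ (k - 1)) + 2) ^ k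
          * (\<Prod>j=1..k. real W ^ j / V ^ (j - 1)))"
      proof (rule card_near_pairs_le[OF \<open>finite T\<close> T(2) \<open>k > 0\<close>])
        fix i h assume "i \<in> T" "h \<in> J i"
        note h = Jsub[OF this]
        show "0 \<le> h \<and> h \<le> int Y" using h a by auto
        have "\<bar>h - b\<bar> \<le> 2 ^ n" using h b by auto
        then have "real_of_int \<bar>h - b\<bar> \<le> real_of_int (2 ^ n)" by (simp only: of_int_le_iff)
        then show "\<bar>real_of_int (h - b)\<bar> \<le> V" by (simp add: V_def)
      next
        fix i m h h' assume *: "i \<in> T" "m \<in> T" "i \<noteq> m" "h \<in> J i" "h' \<in> J m"
        have "even i = even m" using T * by blast
        have "int i + 1 < int m \<or> int m + 1 < int i"
        proof -
          have "i \<noteq> Suc m" "m \<noteq> Suc i" using \<open>even i = even m\<close> by auto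
          then show ?thesis using \<open>i \<noteq> m\<close> by linarith
        qed
        then have "int P \<le> \<bar>h - h'\<bar>"
        proof
          assume "int i + 1 < int m"
          then have "(int i + 2) * int P \<le> int m * int P" by (intro mult_right_mono) auto
          then show ?thesis using *(4,5) unfolding J' by (auto simp: algebra_simps)
        next
          assume "int m + 1 < int i"
          then have "(int m + 2) * int P \<le> int i * int P" by (intro mult_right_mono) auto
          then show ?thesis using *(4,5) unfolding J' by (auto simp: algebra_simps)
        qed
        then have "real_of_int (int P) \<le> real_of_int \<bar>h - h'\<bar>" by (simp only: of_int_le_iff)
        moreover have "1 / 2 ^ q * V = real P"
          using arg_cong[OF PQ, of real] by (simp add: V_def field_simps)
        ultimately show "1 / 2 ^ q * V \<le> \<bar>real_of_int (h - h')\<bar>" by simp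
      next
        fix j assume j: "1 \<le> j" "j \<le> k"
        \<comment> \<open>Rounding down in \<open>n div k\<close> keeps the short pieces long
          enough; degree \<open>k\<close> is the tightest case.\<close>
        have "(n div k) * j \<le> n div k * k" using j by (intro mult_le_mono) auto
        also have "\<dots> \<le> n" by simp
        finally have "n * (j - 1) \<le> (n - n div k) * j"
          using j by (cases j) (auto simp: algebra_simps diff_mult_distrib)
        then have "(2::real) ^ (n * (j - 1)) \<le> 2 ^ ((n - n div k) * j)" by (intro power_increasing) auto
        then show "V ^ (j - 1) \<le> real W ^ j" by (simp add: V_def W_def power_mult)
      qed (use J' a b R \<open>Y > 0\<close> in \<open>auto simp: algebra_simps V_def\<close>)
      also have "\<dots> = B"
        unfolding B_def near_const_def by (subst prod_cells) (auto simp: V_def W_def)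
      finally show "real (card {(t, t'). t \<in> PiE T J \<and> t' \<in> PiE T J \<and>
          (\<exists>z\<in>?Z. \<exists>z'\<in>?Z. \<forall>j\<in>{1..k}. int R dvd (psum T t j - psum T t' j) + (psum {..<s} z j - psum {..<s} z' j))}) \<le> B" .
      show "0 \<le> B" unfolding B_def using near_const_nonneg by (auto simp: V_def)
      show "0 \<le> mean_value k R s {b..<b + int W}" by (rule mean_value_nonneg)
    qed
    finally show ?thesis .
  qed
  \<comment> \<open>The power mean inequality replaces the \<open>2 s\<close>-th power of a sum over
    \<open>m\<close> pieces by the sum of the powers, at the price \<open>m ^ (2 * s) / m\<close>;
    summing \<open>m\<close> equal bounds restores the last factor.\<close>
  have "(\<Sum>x\<in>freqs k R. G x * norm (expsum k R x {a..<a + 2 ^ n}) ^ (2 * s))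
     \<le> (\<Sum>x\<in>freqs k R. G x * (real m ^ (2 * s) * ((\<Sum>i<m. norm (expsum k R x (I i)) ^ (2 * s)) / real m)))"
  proof (intro sum_mono mult_left_mono)
    fix x
    have "a + 2 ^ n = a + int m * int W" using arg_cong[OF mW, of int] by simp
    then have "norm (expsum k R x {a..<a + 2 ^ n}) \<le> (\<Sum>i<m. norm (expsum k R x (I i)))"
      using expsum_pieces[of "int W" k R x a m] by (simp add: I_def norm_sum)
    then have "norm (expsum k R x {a..<a + 2 ^ n}) ^ (2 * s) \<le> (\<Sum>i<m. norm (expsum k R x (I i))) ^ (2 * s)"
      by (intro power_mono) auto
    also have "\<dots> = real m ^ (2 * s) * ((\<Sum>i<m. norm (expsum k R x (I i))) / real m) ^ (2 * s)"
      using mpos by (simp add: power_divide)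
    also have "\<dots> \<le> real m ^ (2 * s) * ((\<Sum>i<m. norm (expsum k R x (I i)) ^ (2 * s)) / real m)"
      using power_mean_even[of "{..<m}" "2 * s" "\<lambda>i. norm (expsum k R x (I i))"] mpos
      by (intro mult_left_mono) auto
    finally show "norm (expsum k R x {a..<a + 2 ^ n}) ^ (2 * s)
        \<le> real m ^ (2 * s) * ((\<Sum>i<m. norm (expsum k R x (I i)) ^ (2 * s)) / real m)" .
  qed (auto simp: G_def intro: prod_nonneg)
  also have "\<dots> = real m ^ (2 * s) / real m * (\<Sum>i<m. \<Sum>x\<in>freqs k R. G x * norm (expsum k R x (I i)) ^ (2 * s))"
    by (subst sum.swap) (simp add: sum_distrib_left sum_divide_distrib mult_ac)
  also have "\<dots> \<le> real m ^ (2 * s) / real m * (\<Sum>i<m. B * M)"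
    by (intro mult_left_mono sum_mono piece) auto
  also have "\<dots> = real m ^ (2 * s) * (B * M)" using mpos by simp
  finally show ?thesis unfolding G_def B_def m_def P_def W_def V_def by simp
qed

section \<open>Exponents and the induction for the mean value theorem\<close>

definition defect :: "nat \<Rightarrow> nat \<Rightarrow> real" where
  "defect k r = real (k * (k + 1)) / 2 * (1 - 1 / real k) ^ r"

text \<open>\<open>2 s - k (k + 1) / 2\<close> is the true order for large \<open>s\<close>, and
  \<open>defect\<close> is the excess over it. At \<open>r = 0\<close> the excess gives the trivial
  bound; each step that spends \<open>k\<close> variables multiplies it by
  \<open>1 - 1 / k\<close>.\<close>

definition mv_exp :: "nat \<Rightarrow> nat \<Rightarrow> nat \<Rightarrow> real" where
  "mv_exp k r s = 2 * real s - real (k * (k + 1)) / 2 + defect k r"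

lemma defect_nonneg: "k > 0 \<Longrightarrow> 0 \<le> defect k r"
  by (simp add: defect_def)

text \<open>The number and the length of the short pieces multiply to \<open>2 ^ n\<close>, so all
  powers combine to the optimal exponent except for the old defect, now taken on an interval of
  logarithmic length about \<open>n (1 - 1 / k)\<close>. Rounding in \<open>n div k\<close> loses at
  most 1 there, whence the factor \<open>2 powr defect k r\<close>.\<close>

lemma separated_exponent_le:
  assumes "k > 0" "q \<le> n"
  shows "(2 ^ (n div k)) ^ (2 * s) * ((2 ^ (n - q)) ^ k * ((2 ^ (n - n div k)) ^ (k * (k + 1) div 2) / (2 ^ n) ^ (k * (k - 1) div 2)))
      * 2 powr (real (n - n div k) * mv_exp k r s)
    \<le> 2 powr defect k r * 2 powr (real n * mv_exp k (Suc r) (k + s))"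
proof -
  define d where "d = defect k r"
  define D where "D = real (n div k)"
  define n' where "n' = real (n - n div k)"
  have nD: "n' = real n - D" unfolding n'_def D_def by (subst of_nat_diff) auto
  have e1: "real (k * (k + 1) div 2) = real k * (real k + 1) / 2"
    by (subst real_of_nat_div) (auto simp: field_simps)
  have e2: "real (k * (k - 1) div 2) = real k * (real k - 1) / 2"
    using \<open>k > 0\<close> by (subst real_of_nat_div) (auto simp: field_simps of_nat_diff)
  have "real (n mod k) < real k" using assms by simp
  moreover have "real n = real k * D + real (n mod k)"
    unfolding D_def by (metis mult_div_mod_eq of_nat_add of_nat_mult)
  ultimately have "real n - real k \<le> real k * D" by linarith
  then have D: "real n / real k - 1 \<le> D" using \<open>k > 0\<close> by (simp add: field_simps)
  have "(2 ^ (n div k)) ^ (2 * s) * ((2 ^ (n - q)) ^ k * ((2 ^ (n - n div k)) ^ (k * (k + 1) div 2) / (2 ^ n) ^ (k * (k - 1) div 2)))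
      * 2 powr (real (n - n div k) * mv_exp k r s)
    = 2 powr (D * (2 * real s) + (real (n - q) * real k + (n' * (real k * (real k + 1) / 2) - real n * (real k * (real k - 1) / 2)))
        + n' * (2 * real s - real (k * (k + 1)) / 2 + d))"
  proof -
    have "((2::real) ^ i) ^ j = 2 powr (real i * real j)" for i j
      by (simp add: powr_realpow flip: power_mult of_nat_mult)
    then show ?thesis
      unfolding n'_def D_def mv_exp_def d_def powr_add powr_diff e1[symmetric] e2[symmetric]
      by simp
  qed
  also have "\<dots> \<le> 2 powr (d + real n * mv_exp k (Suc r) (k + s))"
  proof (intro powr_mono)
    have "D * (2 * real s) + (real (n - q) * real k + (n' * (real k * (real k + 1) / 2) - real n * (real k * (real k - 1) / 2)))
        + n' * (2 * real s - real (k * (k + 1)) / 2 + d)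
      = (D + n') * (2 * real s) + real (n - q) * real k - real n * (real k * (real k - 1) / 2) + n' * d"
      by (simp add: algebra_simps)
    also have "\<dots> \<le> real n * (2 * real s) + real n * real k - real n * (real k * (real k - 1) / 2)
        + (real n * (1 - 1 / real k) + 1) * d"
    proof -
      have "n' * d \<le> (real n * (1 - 1 / real k) + 1) * d"
        using D defect_nonneg[OF \<open>k > 0\<close>] by (intro mult_right_mono) (auto simp: nD d_def algebra_simps)
      moreover have "real (n - q) * real k \<le> real n * real k" by (intro mult_right_mono) auto
      ultimately show ?thesis by (simp add: nD)
    qed
    also have "\<dots> = d + real n * (2 * real (k + s) - real (k * (k + 1)) / 2 + d * (1 - 1 / real k))"
      by (simp add: algebra_simps add_divide_distrib diff_divide_distrib)
    also have "d * (1 - 1 / real k) = defect k (Suc r)" by (simp add: d_def defect_def)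
    finally show "D * (2 * real s) + (real (n - q) * real k + (n' * (real k * (real k + 1) / 2) - real n * (real k * (real k - 1) / 2)))
        + n' * (2 * real s - real (k * (k + 1)) / 2 + d) \<le> d + real n * mv_exp k (Suc r) (k + s)"
      by (simp add: mv_exp_def)
  qed auto
  finally show ?thesis by (simp add: powr_add d_def)
qed

text \<open>The outer induction spends \<open>k\<close> variables per step and treats the separated
  case. For fixed \<open>s\<close> a second induction, on \<open>n\<close>, treats the dominant
  case, which keeps \<open>s\<close> but shortens the interval. \<open>Y\<close> only bounds the
  position of the interval and \<open>R\<close> only has to turn congruences into equations, so
  \<open>C\<close> is uniform in both.\<close>

theorem vinogradov_mean_value:
  assumes "k > 0"
  shows "k * k + 2 + k * r \<le> s \<Longrightarrow> \<exists>C>0. \<forall>n a Y R. 0 \<le> a \<longrightarrow> a + 2 ^ n \<le> int Y \<longrightarrow> s * Y ^ k < R \<longrightarrow>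
      mean_value k R s {a..<a + 2 ^ n} \<le> C * real R ^ k * 2 powr (real n * mv_exp k r s)"
proof (induction r arbitrary: s)
  case 0
  have "mean_value k R s {a..<a + 2 ^ n} \<le> 1 * real R ^ k * 2 powr (real n * mv_exp k 0 s)" for n a R
  proof -
    have "mv_exp k 0 s = 2 * real s" by (simp add: mv_exp_def defect_def)
    then have "2 powr (real n * mv_exp k 0 s) = (2 ^ n) ^ (2 * s)"
      by (simp only: power_mult[symmetric]) (simp flip: powr_realpow)
    then show ?thesis using mean_value_trivial[of k R s "{a..<a + 2 ^ n}"] by (simp add: nat_power_eq)
  qed
  then show ?case by (intro exI[of _ 1]) auto
next
  case (Suc r)
  define s' where "s' = s - k"
  have s: "s = k + s'" using Suc.prems by (simp add: s'_def)
  have "k * k + 2 + k * r \<le> s'" using Suc.prems s by simp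
  then obtain C where "C > 0" and C: "\<And>n a Y R. 0 \<le> a \<Longrightarrow> a + 2 ^ n \<le> int Y \<Longrightarrow> s' * Y ^ k < R \<Longrightarrow>
      mean_value k R s' {a..<a + 2 ^ n} \<le> C * real R ^ k * 2 powr (real n * mv_exp k r s')"
    using Suc.IH by metis
  define e where "e = mv_exp k (Suc r) s"
  \<comment> \<open>This is what the size condition on \<open>s\<close> buys: \<open>2 ^ q\<close>
    dominant pieces, each smaller by \<open>2 powr (- q e)\<close>, together still save
    \<open>2 ^ q\<close>.\<close>
  have e2: "e \<ge> 2"
  proof -
    have "k * (k + 1) \<le> k * k + k * k" using \<open>k > 0\<close> by (cases k) auto
    then have "real (k * (k + 1)) \<le> real (2 * (k * k))" by (simp only: of_nat_le_iff)
    moreover have "real (k * k) + 2 \<le> real s"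
    proof -
      have "k * k + 2 \<le> s" using Suc.prems by simp
      then show ?thesis by (metis of_nat_add of_nat_le_iff of_nat_numeral)
    qed
    moreover have "real (k * k) \<ge> 0" by simp
    ultimately show ?thesis
      using defect_nonneg[OF \<open>k > 0\<close>, of "Suc r"] unfolding e_def mv_exp_def by linarith
  qed
  \<comment> \<open>The saving \<open>2 ^ q\<close> is made to beat the constant of the dominant
    case twice over, so that this case contributes at most half of the claimed bound.\<close>
  obtain q where q: "2 * (4 * real k) ^ (2 * s) \<le> 2 ^ q"
    using real_arch_pow[of 2 "2 * (4 * real k) ^ (2 * s)"] by (auto intro: less_imp_le)
  define Ts where "Ts = {T. T \<subseteq> {..<(2::nat) ^ q} \<and> card T = k \<and> (\<forall>a\<in>T. \<forall>b\<in>T. even a = even b)}"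
  define G where "G = (2 * 2 ^ q) ^ (2 * k) * (real (card Ts) * (near_const k q s' * C * 2 powr defect k r))"
  \<comment> \<open>\<open>2 * G\<close> leaves room for the separated case beside that half, the
    power of two is the trivial bound for \<open>n < q\<close>, and 1 ensures positivity.\<close>
  define C' where "C' = 2 * G + 2 ^ (q * (2 * s)) + 1"
  have "G \<ge> 0" unfolding G_def using near_const_nonneg \<open>C > 0\<close> by simp
  then have "C' > 0" unfolding C'_def by (simp add: add_nonneg_pos)
  have "\<forall>a Y R. 0 \<le> a \<longrightarrow> a + 2 ^ n \<le> int Y \<longrightarrow> s * Y ^ k < R \<longrightarrow>
      mean_value k R s {a..<a + 2 ^ n} \<le> C' * real R ^ k * 2 powr (real n * e)" for n
  proof (induction n rule: less_induct)
    case (less n)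
    show ?case
    proof (intro allI impI)
      fix a Y R assume a: "0 \<le> a" "a + 2 ^ n \<le> int Y" and R: "s * Y ^ k < R"
      show "mean_value k R s {a..<a + 2 ^ n} \<le> C' * real R ^ k * 2 powr (real n * e)"
      proof (cases "n < q")
        case True
        have "((2::real) ^ n) ^ (2 * s) \<le> 2 ^ (q * (2 * s))"
          unfolding power_mult[of 2 q] using True by (intro power_mono power_increasing) auto
        also have "\<dots> \<le> C' * 1" unfolding C'_def using \<open>G \<ge> 0\<close> by simp
        also have "C' * 1 \<le> C' * 2 powr (real n * e)"
          using \<open>C' > 0\<close> e2 by (intro mult_left_mono ge_one_powr_ge_zero) auto
        finally have "real R ^ k * (2 ^ n) ^ (2 * s) \<le> real R ^ k * (C' * 2 powr (real n * e))"
          by (intro mult_left_mono) auto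
        moreover have "mean_value k R s {a..<a + 2 ^ n} \<le> real R ^ k * (2 ^ n) ^ (2 * s)"
          using mean_value_trivial[of k R s "{a..<a + 2 ^ n}"] by (simp add: nat_power_eq)
        ultimately show ?thesis by (simp add: mult_ac)
      next
        case False
        then have "q \<le> n" by simp
        define P :: int where "P = 2 ^ (n - q)"
        define J where "J i = {a + int i * 2 ^ (n - q)..<a + (int i + 1) * 2 ^ (n - q)}" for i
        have PQ: "int (2 ^ q) * P = 2 ^ n" unfolding P_def using \<open>q \<le> n\<close> by (simp add: power_add[symmetric])
        have "R > 0" using R by simp
        have "q > 0"
        proof (rule ccontr)
          assume "\<not> q > 0"
          moreover have "1 \<le> (4 * real k) ^ (2 * s)" using \<open>k > 0\<close> by (intro one_le_power) auto
          ultimately show False using q by simp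
        qed
        define good where "good T = (\<Sum>x\<in>freqs k R. (\<Prod>i\<in>T. (norm (expsum k R x (J i)))\<^sup>2) * norm (expsum k R x {a..<a + 2 ^ n}) ^ (2 * s'))" for T
        have "mean_value k R s {a..<a + 2 ^ n} \<le> (\<Sum>x\<in>freqs k R. (2 * 2 ^ q) ^ (2 * k)
            * (\<Sum>T\<in>Ts. (\<Prod>i\<in>T. (norm (expsum k R x (J i)))\<^sup>2) * norm (expsum k R x {a..<a + 2 ^ n}) ^ (2 * s'))
            + (4 * real k) ^ (2 * s) * (\<Sum>i<2 ^ q. norm (expsum k R x (J i)) ^ (2 * s)))"
          unfolding mean_value_def
        proof (intro sum_mono)
          fix x
          have "expsum k R x {a..<a + 2 ^ n} = (\<Sum>i<2 ^ q. expsum k R x (J i))"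
            using expsum_pieces[of P k R x a "2 ^ q"] PQ by (simp add: J_def P_def)
          then have "norm (expsum k R x {a..<a + 2 ^ n}) \<le> (\<Sum>i<2 ^ q. norm (expsum k R x (J i)))"
            by (simp add: norm_sum)
          from power_le_separated_plus_dominant[OF _ _ \<open>k > 0\<close> _ this, of s']
          show "norm (expsum k R x {a..<a + 2 ^ n}) ^ (2 * s) \<le> (2 * 2 ^ q) ^ (2 * k)
            * (\<Sum>T\<in>Ts. (\<Prod>i\<in>T. (norm (expsum k R x (J i)))\<^sup>2) * norm (expsum k R x {a..<a + 2 ^ n}) ^ (2 * s'))
            + (4 * real k) ^ (2 * s) * (\<Sum>i<2 ^ q. norm (expsum k R x (J i)) ^ (2 * s))"
            unfolding Ts_def s by simp
        qed
        also have "\<dots> = (2 * 2 ^ q) ^ (2 * k) * (\<Sum>T\<in>Ts. good T)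
            + (4 * real k) ^ (2 * s) * (\<Sum>i<2 ^ q. mean_value k R s (J i))"
          unfolding good_def mean_value_def sum.distrib
          by (subst (1 2) sum.swap) (simp add: sum_distrib_left)
        finally have split: "mean_value k R s {a..<a + 2 ^ n} \<le> (2 * 2 ^ q) ^ (2 * k) * (\<Sum>T\<in>Ts. good T)
            + (4 * real k) ^ (2 * s) * (\<Sum>i<2 ^ q. mean_value k R s (J i))" .
        have good_le: "(\<Sum>T\<in>Ts. good T) \<le> (\<Sum>T\<in>Ts. near_const k q s' * C * 2 powr defect k r * (real R ^ k * 2 powr (real n * e)))"
        proof (intro sum_mono)
          fix T assume "T \<in> Ts"
          then have T: "T \<subseteq> {..<2 ^ q}" "card T = k" "\<forall>i\<in>T. \<forall>m\<in>T. even i = even m" unfolding Ts_def by blast+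
          define M where "M = C * real R ^ k * 2 powr (real (n - n div k) * mv_exp k r s')"
          have "s' * Y ^ k \<le> s * Y ^ k" by (simp add: s)
          then have R': "s' * Y ^ k < R" using R by linarith
          define E :: real where "E = (2 ^ (n div k)) ^ (2 * s') * ((2 ^ (n - q)) ^ k *
              ((2 ^ (n - n div k)) ^ (k * (k + 1) div 2) / (2 ^ n) ^ (k * (k - 1) div 2)))
              * 2 powr (real (n - n div k) * mv_exp k r s')"
          have "good T \<le> (2 ^ (n div k)) ^ (2 * s') * ((2 ^ (n - q)) ^ k * (near_const k q s'
            * ((2 ^ (n - n div k)) ^ (k * (k + 1) div 2) / (2 ^ n) ^ (k * (k - 1) div 2))) * M)"
            unfolding good_def
            by (rule separated_mean_le[OF \<open>k > 0\<close> \<open>q \<le> n\<close> T a R[unfolded s] _ J_def])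
              (unfold M_def, rule C[OF _ _ R'])
          also have "\<dots> = near_const k q s' * C * real R ^ k * E"
            unfolding M_def E_def by (simp add: mult_ac)
          also have "\<dots> \<le> near_const k q s' * C * real R ^ k * (2 powr defect k r * 2 powr (real n * e))"
            unfolding e_def s E_def using \<open>C > 0\<close> near_const_nonneg
            by (intro mult_left_mono separated_exponent_le \<open>k > 0\<close> \<open>q \<le> n\<close>) auto
          finally show "good T \<le> near_const k q s' * C * 2 powr defect k r * (real R ^ k * 2 powr (real n * e))"
            by (simp add: mult_ac)
        qed
        have "(\<Sum>i<2 ^ q. mean_value k R s (J i)) \<le> (\<Sum>i<(2::nat) ^ q. C' * real R ^ k * 2 powr (real (n - q) * e))"
        proof (intro sum_mono)
          fix i assume i: "i \<in> {..<(2::nat) ^ q}"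
          then have "int (Suc i) \<le> int (2 ^ q)" by (simp only: of_nat_le_iff Suc_le_eq lessThan_iff)
          then have "(int i + 1) * P \<le> int (2 ^ q) * P" by (intro mult_right_mono) (auto simp: P_def)
          then have "a + int i * P + P \<le> int Y" using PQ a by (simp add: algebra_simps)
          moreover have "0 \<le> a + int i * P" using a by (simp add: P_def)
          moreover have "J i = {a + int i * P..<a + int i * P + P}" by (simp add: J_def P_def algebra_simps)
          ultimately show "mean_value k R s (J i) \<le> C' * real R ^ k * 2 powr (real (n - q) * e)"
            using less.IH[of "n - q"] \<open>q > 0\<close> \<open>q \<le> n\<close> R by (simp add: P_def)
        qed
        also have "\<dots> = 2 ^ q * (C' * real R ^ k * 2 powr (real (n - q) * e))" by simp
        finally have bad_le: "(\<Sum>i<2 ^ q. mean_value k R s (J i)) \<le> 2 ^ q * (C' * real R ^ k * 2 powr (real (n - q) * e))" .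
        have main: "mean_value k R s {a..<a + 2 ^ n} \<le> G * (real R ^ k * 2 powr (real n * e))
            + (4 * real k) ^ (2 * s) * (2 ^ q * (C' * real R ^ k * 2 powr (real (n - q) * e)))"
        proof (rule order_trans[OF split], rule add_mono)
          have "(2 * 2 ^ q) ^ (2 * k) * (\<Sum>T\<in>Ts. good T)
              \<le> (2 * 2 ^ q) ^ (2 * k) * (\<Sum>T\<in>Ts. near_const k q s' * C * 2 powr defect k r * (real R ^ k * 2 powr (real n * e)))"
            by (intro mult_left_mono good_le) auto
          then show "(2 * 2 ^ q) ^ (2 * k) * (\<Sum>T\<in>Ts. good T) \<le> G * (real R ^ k * 2 powr (real n * e))"
            by (simp add: G_def mult_ac)
        qed (intro mult_left_mono bad_le, simp)
        have "(4 * real k) ^ (2 * s) * (2 ^ q * 2 powr (real (n - q) * e)) \<le> 2 powr (real n * e) / 2"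
        proof -
          have "(4 * real k) ^ (2 * s) * (2 ^ q * 2 powr (real (n - q) * e)) \<le> 2 ^ q / 2 * (2 ^ q * 2 powr (real (n - q) * e))"
            using q by (intro mult_right_mono) auto
          also have "\<dots> = 2 powr (real q + real q + real (n - q) * e) / 2"
            unfolding powr_add by (simp add: powr_realpow)
          also have "\<dots> \<le> 2 powr (real n * e) / 2"
          proof (intro divide_right_mono powr_mono)
            have "real q + real q + real (n - q) * e \<le> real q * e + real (n - q) * e"
              using mult_left_mono[OF e2, of "real q"] by simp
            also have "\<dots> = real n * e" using \<open>q \<le> n\<close> by (simp add: of_nat_diff algebra_simps)
            finally show "real q + real q + real (n - q) * e \<le> real n * e" .
          qed auto
          finally show ?thesis .
        qed
        then have "C' * real R ^ k * ((4 * real k) ^ (2 * s) * (2 ^ q * 2 powr (real (n - q) * e)))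
            \<le> C' * real R ^ k * (2 powr (real n * e) / 2)"
          using \<open>C' > 0\<close> by (intro mult_left_mono) auto
        with main have "mean_value k R s {a..<a + 2 ^ n} \<le> (G + C' / 2) * (real R ^ k * 2 powr (real n * e))"
          by (simp add: algebra_simps)
        also have "\<dots> \<le> C' * (real R ^ k * 2 powr (real n * e))"
          unfolding C'_def by (intro mult_right_mono) auto
        finally show ?thesis by (simp add: mult_ac)
      qed
    qed
  qed
  then show ?case using \<open>C' > 0\<close> unfolding e_def by blast
qed

subsection \<open>Dirichlet kernels\<close>

text \<open>Jordan's inequality, from the concavity of sine between 0 and
  \<open>pi / 2\<close>.\<close>

lemma sin_ge_linear:
  assumes "0 \<le> t" "t \<le> 1"
  shows "t \<le> sin (t * (pi / 2))"
proof -
  have "convex_on {0..pi / 2} (\<lambda>x. - sin x)"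
  proof (rule f''_ge0_imp_convex)
    fix x :: real assume x: "x \<in> {0..pi / 2}"
    show "((\<lambda>x. - sin x) has_real_derivative - cos x) (at x)" by (auto intro!: derivative_eq_intros)
    show "((\<lambda>x. - cos x) has_real_derivative sin x) (at x)" by (auto intro!: derivative_eq_intros)
    show "0 \<le> sin x" using x by (intro sin_ge_zero) auto
  qed auto
  from convex_onD[OF this, of t 0 "pi / 2"] assms show ?thesis by simp
qed

lemma norm_add_char_diff_1: "norm (add_char x - 1) = 2 * \<bar>sin (pi * x)\<bar>"
  using dist_exp_i_1[of "2 * pi * x"] by (simp add: add_char_def cis_conv_exp)

lemma norm_add_char_diff_1_ge:
  assumes "\<bar>x\<bar> \<le> 1 / 2"
  shows "4 * \<bar>x\<bar> \<le> norm (add_char x - 1)"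
proof -
  have "\<bar>sin (pi * x)\<bar> = \<bar>sin (pi * \<bar>x\<bar>)\<bar>" by (cases "x \<ge> 0") auto
  moreover have "2 * \<bar>x\<bar> \<le> sin (2 * \<bar>x\<bar> * (pi / 2))" using assms by (intro sin_ge_linear) auto
  ultimately show ?thesis unfolding norm_add_char_diff_1 by (simp add: mult.commute)
qed

lemma norm_add_char_diff_le: "norm (add_char x - add_char y) \<le> 2 * pi * \<bar>x - y\<bar>"
proof -
  have "add_char x - add_char y = add_char y * (add_char (x - y) - 1)"
    using add_char_add[of y "x - y"] by (simp add: algebra_simps)
  then have "norm (add_char x - add_char y) = 2 * \<bar>sin (pi * (x - y))\<bar>"
    by (simp add: norm_mult norm_add_char_diff_1)
  also have "\<dots> \<le> 2 * \<bar>pi * (x - y)\<bar>" by (intro mult_left_mono abs_sin_x_le_abs_x) auto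
  finally show ?thesis by (simp add: abs_mult)
qed

lemma norm_geometric_add_char_le:
  assumes "add_char x \<noteq> 1"
  shows "norm (\<Sum>i<N. add_char (real i * x)) \<le> 2 / norm (add_char x - 1)"
proof -
  have "(\<Sum>i<N. add_char (real i * x)) = (add_char x ^ N - 1) / (add_char x - 1)"
    using assms by (simp add: add_char_of_nat_mult geometric_sum)
  also have "norm \<dots> \<le> (1 + 1) / norm (add_char x - 1)"
    unfolding norm_divide
    by (intro divide_right_mono order_trans[OF norm_triangle_ineq4] add_mono) (auto simp: norm_power)
  finally show ?thesis by simp
qed

definition dirichlet_kernel :: "int \<Rightarrow> real \<Rightarrow> complex" where
  "dirichlet_kernel b x = (\<Sum>l\<in>{-b..b}. add_char (of_int l * x))"

lemma dirichlet_kernel_le: "b \<ge> 0 \<Longrightarrow> norm (dirichlet_kernel b x) \<le> 2 * of_int b + 1"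
  unfolding dirichlet_kernel_def by (rule order_trans[OF norm_sum]) simp

lemma dirichlet_kernel_minus: "norm (dirichlet_kernel b (- x)) = norm (dirichlet_kernel b x)"
proof -
  have "dirichlet_kernel b (- x) = cnj (dirichlet_kernel b x)"
    by (simp add: dirichlet_kernel_def add_char_minus)
  then show ?thesis by simp
qed

lemma dirichlet_kernel_le_inverse:
  assumes "0 < \<bar>x\<bar>" "\<bar>x\<bar> \<le> 1 / 2" "b \<ge> 0"
  shows "norm (dirichlet_kernel b x) \<le> 1 / \<bar>x\<bar>"
proof -
  have ne: "add_char x \<noteq> 1"
    using norm_add_char_diff_1_ge[of x] assms by auto
  have "dirichlet_kernel b x = (\<Sum>i<nat (2 * b + 1). add_char (of_int (int i - b) * x))"
    unfolding dirichlet_kernel_def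
    by (rule sum.reindex_bij_witness[of _ "\<lambda>i. int i - b" "\<lambda>l. nat (l + b)"]) auto
  also have "\<dots> = add_char (- of_int b * x) * (\<Sum>i<nat (2 * b + 1). add_char (real i * x))"
    unfolding sum_distrib_left by (intro sum.cong) (auto simp: algebra_simps simp flip: add_char_add)
  also have "norm \<dots> \<le> 2 / norm (add_char x - 1)"
    using norm_geometric_add_char_le[OF ne] by (simp add: norm_mult)
  also have "\<dots> \<le> 2 / (4 * \<bar>x\<bar>)"
    using norm_add_char_diff_1_ge[of x] assms by (intro frac_le) auto
  also have "\<dots> \<le> 1 / \<bar>x\<bar>" using assms by (simp add: field_simps)
  finally show ?thesis .
qed

lemma sum_dirichlet_trivial:
  assumes "a \<ge> 0" "b \<ge> 0"
  shows "(\<Sum>\<nu>\<in>{-2*a..2*a}. norm (dirichlet_kernel b (\<gamma> * of_int \<nu>))) \<le> (4 * of_int a + 1) * (2 * of_int b + 1)"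
proof -
  have "(\<Sum>\<nu>\<in>{-2*a..2*a}. norm (dirichlet_kernel b (\<gamma> * of_int \<nu>))) \<le> (\<Sum>\<nu>\<in>{-2*a..2*a}. 2 * of_int b + 1)"
    by (intro sum_mono dirichlet_kernel_le assms)
  then show ?thesis using assms by simp
qed

lemma sum_symmetric_int:
  fixes f :: "int \<Rightarrow> real"
  assumes "\<And>x. f (- x) = f x" "m \<ge> 0"
  shows "(\<Sum>\<nu>\<in>{-m..m}. f \<nu>) = f 0 + 2 * (\<Sum>i=1..nat m. f (int i))"
proof -
  have 1: "(\<Sum>\<nu>\<in>{1..m}. f \<nu>) = (\<Sum>i=1..nat m. f (int i))"
    by (rule sum.reindex_bij_witness[of _ int nat]) (use assms(2) in auto)
  have 2: "(\<Sum>\<nu>\<in>{-m..-1}. f \<nu>) = (\<Sum>\<nu>\<in>{1..m}. f \<nu>)"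
    by (rule sum.reindex_bij_witness[of _ uminus uminus]) (auto simp: assms(1))
  have "{-m..m} = {-m..-1} \<union> ({0} \<union> {1..m})" using assms(2) by auto
  then have "(\<Sum>\<nu>\<in>{-m..m}. f \<nu>) = (\<Sum>\<nu>\<in>{-m..-1}. f \<nu>) + (f 0 + (\<Sum>\<nu>\<in>{1..m}. f \<nu>))"
    by (simp add: sum.union_disjoint)
  then show ?thesis using 1 2 by simp
qed

lemma harm_le_ln: "n > 0 \<Longrightarrow> (\<Sum>i=1..n. 1 / real i) \<le> 1 + ln (real n)"
  using decseqD[OF decseq_harm_diff_ln, of 0 "n - 1"] by (simp add: harm_def field_simps)

text \<open>The last hypothesis keeps every \<open>\<gamma> \<nu>\<close> within
  \<open>1 / 2\<close> of 0, so its distance to the integers is its absolute value and nothing wraps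
  around. Only \<open>\<nu> = 0\<close> gets the full kernel; the rest is a harmonic sum.\<close>

lemma sum_dirichlet_small:
  assumes "a > 0" "b \<ge> 0" "\<gamma> \<noteq> 0" "\<bar>\<gamma>\<bar> * (2 * of_int a) \<le> 1 / 2"
  shows "(\<Sum>\<nu>\<in>{-2*a..2*a}. norm (dirichlet_kernel b (\<gamma> * of_int \<nu>)))
    \<le> 2 * of_int b + 1 + 2 / \<bar>\<gamma>\<bar> * (1 + ln (2 * of_int a))"
proof -
  have "(\<Sum>\<nu>\<in>{-(2*a)..2*a}. norm (dirichlet_kernel b (\<gamma> * of_int \<nu>)))
     = norm (dirichlet_kernel b (\<gamma> * of_int 0)) + 2 * (\<Sum>i=1..nat (2*a). norm (dirichlet_kernel b (\<gamma> * of_int (int i))))"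
    using assms dirichlet_kernel_minus by (intro sum_symmetric_int) auto
  also have "\<dots> \<le> (2 * of_int b + 1) + 2 * (\<Sum>i=1..nat (2*a). 1 / \<bar>\<gamma>\<bar> * (1 / real i))"
  proof (intro add_mono mult_left_mono sum_mono dirichlet_kernel_le)
    fix i assume i: "i \<in> {1..nat (2*a)}"
    have "real i \<le> 2 * of_int a" using i by (simp add: le_nat_iff) linarith
    then have "\<bar>\<gamma>\<bar> * real i \<le> \<bar>\<gamma>\<bar> * (2 * of_int a)" by (intro mult_left_mono) auto
    then have "\<bar>\<gamma> * of_int (int i)\<bar> \<le> 1 / 2" using assms(4) by (simp add: abs_mult)
    then have "norm (dirichlet_kernel b (\<gamma> * of_int (int i))) \<le> 1 / \<bar>\<gamma> * of_int (int i)\<bar>"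
      using assms i by (intro dirichlet_kernel_le_inverse) auto
    then show "norm (dirichlet_kernel b (\<gamma> * of_int (int i))) \<le> 1 / \<bar>\<gamma>\<bar> * (1 / real i)"
      by (simp add: abs_mult)
  qed (use assms in auto)
  also have "(\<Sum>i=1..nat (2*a). 1 / \<bar>\<gamma>\<bar> * (1 / real i)) = 1 / \<bar>\<gamma>\<bar> * (\<Sum>i=1..nat (2*a). 1 / real i)"
    by (simp only: sum_distrib_left)
  also have "2 * \<dots> = 2 / \<bar>\<gamma>\<bar> * (\<Sum>i=1..nat (2*a). 1 / real i)" by simp
  also have "(2 * of_int b + 1) + \<dots> \<le> 2 * of_int b + 1 + 2 / \<bar>\<gamma>\<bar> * (1 + ln (2 * of_int a))"
    using harm_le_ln[of "nat (2 * a)"] assms by (intro add_left_mono mult_left_mono) auto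
  finally show ?thesis by simp
qed

subsection \<open>Bilinear sums\<close>

text \<open>On the vectors of powers of \<open>u\<close> and \<open>v\<close> this is a polynomial
  in \<open>u v\<close> without constant term. Written as a bilinear form it lets sums of such
  vectors take the place of single ones.\<close>

definition wdot :: "nat \<Rightarrow> (nat \<Rightarrow> real) \<Rightarrow> (nat \<Rightarrow> int) \<Rightarrow> (nat \<Rightarrow> int) \<Rightarrow> real" where
  "wdot k \<gamma> w v = (\<Sum>j=1..k. \<gamma> j * of_int (w j) * of_int (v j))"

lemma wdot_sym: "wdot k \<gamma> w v = wdot k \<gamma> v w"
  by (simp add: wdot_def mult_ac)

lemma wdot_diff: "wdot k \<gamma> (\<lambda>j. w j - w' j) v = wdot k \<gamma> w v - wdot k \<gamma> w' v"
  by (simp add: wdot_def sum_subtractf[symmetric] algebra_simps)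

lemma wdot_sum: "wdot k \<gamma> (\<lambda>j. \<Sum>i\<in>I. w i j) v = (\<Sum>i\<in>I. wdot k \<gamma> (w i) v)"
  unfolding wdot_def by (subst sum.swap) (simp add: sum_distrib_left sum_distrib_right)

text \<open>Pairs, because the \<open>2 s\<close>-th power of a modulus has \<open>s\<close> factors
  and \<open>s\<close> conjugates; \<open>moments\<close> is the difference of power sums that
  results.\<close>

definition tuples :: "nat \<Rightarrow> int set \<Rightarrow> ((nat \<Rightarrow> int) \<times> (nat \<Rightarrow> int)) set" where
  "tuples s A = PiE {..<s} (\<lambda>_. A) \<times> PiE {..<s} (\<lambda>_. A)"

definition moments :: "nat \<Rightarrow> (nat \<Rightarrow> int) \<times> (nat \<Rightarrow> int) \<Rightarrow> nat \<Rightarrow> int" where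
  "moments s p j = psum {..<s} (fst p) j - psum {..<s} (snd p) j"

lemma finite_tuples [simp]: "finite A \<Longrightarrow> finite (tuples s A)"
  by (auto simp: tuples_def intro!: finite_PiE)

lemma card_tuples: "card (tuples s A) = card A ^ (2 * s)"
  by (simp add: tuples_def card_cartesian_product card_PiE power_add[symmetric] mult_2)

lemma power_sum_add_char:
  assumes "finite A"
  shows "of_real (norm (\<Sum>u\<in>A. add_char (wdot k \<gamma> (\<lambda>j. u ^ j) v)) ^ (2 * s))
      = (\<Sum>p\<in>tuples s A. add_char (wdot k \<gamma> (moments s p) v))"
proof -
  define S where "S = (\<Sum>u\<in>A. add_char (wdot k \<gamma> (\<lambda>j. u ^ j) v))"
  have "S ^ s = (\<Prod>i<s. S)" by simp
  also have "\<dots> = (\<Sum>t\<in>PiE {..<s} (\<lambda>_. A). \<Prod>i<s. add_char (wdot k \<gamma> (\<lambda>j. t i ^ j) v))"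
    unfolding S_def using assms by (subst prod_sum_PiE) auto
  also have "\<dots> = (\<Sum>t\<in>PiE {..<s} (\<lambda>_. A). add_char (wdot k \<gamma> (psum {..<s} t) v))"
    unfolding psum_def wdot_sum add_char_sum ..
  finally have S: "S ^ s = (\<Sum>t\<in>PiE {..<s} (\<lambda>_. A). add_char (wdot k \<gamma> (psum {..<s} t) v))" .
  have "complex_of_real (norm S ^ (2 * s)) = of_real ((norm (S ^ s))\<^sup>2)"
    by (simp add: norm_power power_mult[symmetric] mult.commute)
  also have "\<dots> = S ^ s * cnj (S ^ s)" by (rule complex_norm_square)
  also have "\<dots> = (\<Sum>p\<in>tuples s A. add_char (wdot k \<gamma> (moments s p) v))"
    unfolding S tuples_def moments_def wdot_diff add_char_diff cnj_sum sum_product sum.cartesian_product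
    by (simp add: case_prod_unfold)
  finally show ?thesis by (simp add: S_def)
qed

lemma power_mean_even':
  fixes a :: "'i \<Rightarrow> real"
  assumes "finite I" "s > 0"
  shows "(\<Sum>i\<in>I. a i) ^ (2 * s) \<le> real (card I) ^ (2 * s - 1) * (\<Sum>i\<in>I. a i ^ (2 * s))"
proof (cases "I = {}")
  case True
  then show ?thesis using assms by (simp add: power_0_left)
next
  case False
  then have c: "real (card I) > 0" using assms by (simp add: card_gt_0_iff)
  have "(\<Sum>i\<in>I. a i) ^ (2 * s) = real (card I) ^ (2 * s) * ((\<Sum>i\<in>I. a i) / card I) ^ (2 * s)"
    using c by (simp add: power_divide)
  also have "\<dots> \<le> real (card I) ^ (2 * s) * ((\<Sum>i\<in>I. a i ^ (2 * s)) / card I)"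
    using assms False by (intro mult_left_mono power_mean_even) auto
  also have "\<dots> = real (card I) ^ (2 * s) / card I * (\<Sum>i\<in>I. a i ^ (2 * s))" by simp
  also have "real (card I) ^ (2 * s) / card I = real (card I) ^ (2 * s - 1)"
    using c assms by (cases "2 * s") auto
  finally show ?thesis .
qed

text \<open>Hoelder in \<open>v\<close> and expansion of the power replace \<open>u\<close> by
  moment vectors. The sum over \<open>v\<close> then stands inside, and Hoelder over these vectors
  followed by a second expansion does the same to \<open>v\<close>. The cardinality factor is the
  trivial bound that the two inequalities leave outside.\<close>

lemma bilinear_moments:
  assumes "finite A" "finite B" "s > 0"
  shows "norm (\<Sum>v\<in>B. \<Sum>u\<in>A. add_char (wdot k \<gamma> (\<lambda>j. u ^ j) (\<lambda>j. v ^ j))) ^ (2 * s * (2 * s))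
    \<le> real (card A * card B) ^ (2 * s * (2 * s) - 2 * s)
      * norm (\<Sum>p\<in>tuples s A. \<Sum>q\<in>tuples s B. add_char (wdot k \<gamma> (moments s p) (moments s q)))"
proof -
  define X where "X = norm (\<Sum>v\<in>B. \<Sum>u\<in>A. add_char (wdot k \<gamma> (\<lambda>j. u ^ j) (\<lambda>j. v ^ j)))"
  define Z where "Z p = norm (\<Sum>v\<in>B. add_char (wdot k \<gamma> (\<lambda>j. v ^ j) (moments s p)))" for p
  have "X \<le> (\<Sum>v\<in>B. norm (\<Sum>u\<in>A. add_char (wdot k \<gamma> (\<lambda>j. u ^ j) (\<lambda>j. v ^ j))))"
    unfolding X_def by (rule norm_sum)
  then have "X ^ (2 * s) \<le> (\<Sum>v\<in>B. norm (\<Sum>u\<in>A. add_char (wdot k \<gamma> (\<lambda>j. u ^ j) (\<lambda>j. v ^ j)))) ^ (2 * s)"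
    by (intro power_mono) (auto simp: X_def)
  also have "\<dots> \<le> real (card B) ^ (2 * s - 1)
      * (\<Sum>v\<in>B. norm (\<Sum>u\<in>A. add_char (wdot k \<gamma> (\<lambda>j. u ^ j) (\<lambda>j. v ^ j))) ^ (2 * s))"
    by (rule power_mean_even'[OF assms(2,3)])
  also have "\<dots> \<le> real (card B) ^ (2 * s - 1) * (\<Sum>p\<in>tuples s A. Z p)"
  proof (intro mult_left_mono)
    have "complex_of_real (\<Sum>v\<in>B. norm (\<Sum>u\<in>A. add_char (wdot k \<gamma> (\<lambda>j. u ^ j) (\<lambda>j. v ^ j))) ^ (2 * s))
       = (\<Sum>p\<in>tuples s A. \<Sum>v\<in>B. add_char (wdot k \<gamma> (\<lambda>j. v ^ j) (moments s p)))"
      unfolding of_real_sum power_sum_add_char[OF assms(1)]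
      by (subst sum.swap) (simp add: wdot_sym)
    from arg_cong[OF this, of norm]
    have "(\<Sum>v\<in>B. norm (\<Sum>u\<in>A. add_char (wdot k \<gamma> (\<lambda>j. u ^ j) (\<lambda>j. v ^ j))) ^ (2 * s))
       \<le> norm (\<Sum>p\<in>tuples s A. \<Sum>v\<in>B. add_char (wdot k \<gamma> (\<lambda>j. v ^ j) (moments s p)))"
      by (simp only: norm_of_real)
    also have "\<dots> \<le> (\<Sum>p\<in>tuples s A. Z p)" unfolding Z_def by (rule norm_sum)
    finally show "(\<Sum>v\<in>B. norm (\<Sum>u\<in>A. add_char (wdot k \<gamma> (\<lambda>j. u ^ j) (\<lambda>j. v ^ j))) ^ (2 * s))
       \<le> (\<Sum>p\<in>tuples s A. Z p)" .
  qed auto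
  finally have "(X ^ (2 * s)) ^ (2 * s) \<le> (real (card B) ^ (2 * s - 1) * (\<Sum>p\<in>tuples s A. Z p)) ^ (2 * s)"
    by (intro power_mono) (auto simp: X_def)
  also have "\<dots> = (real (card B) ^ (2 * s - 1)) ^ (2 * s) * (\<Sum>p\<in>tuples s A. Z p) ^ (2 * s)"
    by (rule power_mult_distrib)
  also have "\<dots> \<le> (real (card B) ^ (2 * s - 1)) ^ (2 * s) *
      (real (card (tuples s A)) ^ (2 * s - 1) * (\<Sum>p\<in>tuples s A. Z p ^ (2 * s)))"
    using assms by (intro mult_left_mono power_mean_even') auto
  also have "(\<Sum>p\<in>tuples s A. Z p ^ (2 * s))
      = norm (\<Sum>p\<in>tuples s A. \<Sum>q\<in>tuples s B. add_char (wdot k \<gamma> (moments s p) (moments s q)))"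
  proof -
    have "complex_of_real (\<Sum>p\<in>tuples s A. Z p ^ (2 * s))
       = (\<Sum>p\<in>tuples s A. \<Sum>q\<in>tuples s B. add_char (wdot k \<gamma> (moments s p) (moments s q)))"
      unfolding of_real_sum Z_def power_sum_add_char[OF assms(2)] by (simp add: wdot_sym)
    from arg_cong[OF this, of norm] show ?thesis
      by (simp only: norm_of_real) (simp add: sum_nonneg Z_def)
  qed
  also have "(real (card B) ^ (2 * s - 1)) ^ (2 * s) * (real (card (tuples s A)) ^ (2 * s - 1)
      * norm (\<Sum>p\<in>tuples s A. \<Sum>q\<in>tuples s B. add_char (wdot k \<gamma> (moments s p) (moments s q))))
    = real (card A * card B) ^ (2 * s * (2 * s) - 2 * s)
      * norm (\<Sum>p\<in>tuples s A. \<Sum>q\<in>tuples s B. add_char (wdot k \<gamma> (moments s p) (moments s q)))"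
    by (simp add: card_tuples power_mult[symmetric] power_mult_distrib diff_mult_distrib2 mult_ac)
  finally show ?thesis unfolding X_def by (simp only: power_mult[symmetric])
qed

section \<open>Collisions of moment vectors and Dirichlet kernels\<close>

lemma sum_group_card:
  fixes g :: "'b \<Rightarrow> 'c::comm_semiring_1"
  assumes "finite P" "finite M" "f ` P \<subseteq> M"
  shows "(\<Sum>p\<in>P. g (f p)) = (\<Sum>m\<in>M. of_nat (card {p\<in>P. f p = m}) * g m)"
proof -
  have "(\<Sum>p\<in>P. g (f p)) = (\<Sum>m\<in>M. \<Sum>p\<in>{p\<in>P. f p = m}. g (f p))"
    using assms by (rule sum.group[symmetric])
  also have "\<dots> = (\<Sum>m\<in>M. of_nat (card {p\<in>P. f p = m}) * g m)"
    by (intro sum.cong) auto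
  finally show ?thesis .
qed

lemma sum_card_fibers_sq:
  assumes "finite P" "finite M" "f ` P \<subseteq> M"
  shows "(\<Sum>m\<in>M. (real (card {p\<in>P. f p = m}))\<^sup>2) = real (card {(p, p'). p \<in> P \<and> p' \<in> P \<and> f p = f p'})"
proof -
  have "{(p, p'). p \<in> P \<and> p' \<in> P \<and> f p = f p'} = (\<Union>m\<in>M. {p\<in>P. f p = m} \<times> {p\<in>P. f p = m})"
    using assms by auto
  also have "card \<dots> = (\<Sum>m\<in>M. card ({p\<in>P. f p = m} \<times> {p\<in>P. f p = m}))"
    using assms by (intro card_UN_disjoint) auto
  finally show ?thesis by (simp add: card_cartesian_product power2_eq_square)
qed

lemma wdot_restrict: "wdot k \<gamma> (restrict w {1..k}) v = wdot k \<gamma> w v"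
  unfolding wdot_def by (intro sum.cong) auto

text \<open>A double large sieve: uneven distribution of the two families of vectors enters only
  through their collision counts, and the cancellation is left to one kernel sum per
  coordinate.\<close>

lemma bilinear_le_collisions:
  fixes \<mu> :: "'p \<Rightarrow> nat \<Rightarrow> int" and \<nu> :: "'q \<Rightarrow> nat \<Rightarrow> int"
  assumes fin: "finite P" "finite Q"
    and a: "\<And>p j. p \<in> P \<Longrightarrow> j \<in> {1..k} \<Longrightarrow> \<bar>\<mu> p j\<bar> \<le> a j"
    and b: "\<And>q j. q \<in> Q \<Longrightarrow> j \<in> {1..k} \<Longrightarrow> \<bar>\<nu> q j\<bar> \<le> b j"
  shows "(norm (\<Sum>p\<in>P. \<Sum>q\<in>Q. add_char (wdot k \<gamma> (\<mu> p) (\<nu> q))))\<^sup>2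
    \<le> real (card {(p, p'). p \<in> P \<and> p' \<in> P \<and> (\<forall>j\<in>{1..k}. \<mu> p j = \<mu> p' j)})
      * real (card {(q, q'). q \<in> Q \<and> q' \<in> Q \<and> (\<forall>j\<in>{1..k}. \<nu> q j = \<nu> q' j)})
      * (\<Prod>j=1..k. \<Sum>x\<in>{-2 * a j..2 * a j}. norm (dirichlet_kernel (b j) (\<gamma> j * of_int x)))"
proof -
  define \<mu>' where "\<mu>' p = restrict (\<mu> p) {1..k}" for p
  define \<nu>' where "\<nu>' q = restrict (\<nu> q) {1..k}" for q
  define M where "M = PiE {1..k} (\<lambda>j. {- a j..a j})"
  define L where "L = PiE {1..k} (\<lambda>j. {- b j..b j})"
  define G where "G l = (\<Sum>p\<in>P. add_char (wdot k \<gamma> (\<mu> p) l))" for l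
  define r where "r l = real (card {q\<in>Q. \<nu>' q = l})" for l
  define \<rho> where "\<rho> m = real (card {p\<in>P. \<mu>' p = m})" for m
  define K where "K m m' = (\<Prod>j=1..k. norm (dirichlet_kernel (b j) (\<gamma> j * of_int (m j - m' j))))" for m m' :: "nat \<Rightarrow> int"
  define Pr where "Pr = (\<Prod>j=1..k. \<Sum>x\<in>{-2 * a j..2 * a j}. norm (dirichlet_kernel (b j) (\<gamma> j * of_int x)))"
  have finM: "finite M" and finL: "finite L" unfolding M_def L_def by (auto intro!: finite_PiE)
  have \<mu>M: "\<mu>' ` P \<subseteq> M" and \<nu>L: "\<nu>' ` Q \<subseteq> L"
    using a b by (auto simp: \<mu>'_def \<nu>'_def M_def L_def abs_le_iff minus_le_iff)
  have eq_iff: "restrict w {1..k} = restrict w' {1..k} \<longleftrightarrow> (\<forall>j\<in>{1..k}. w j = w' j)" for w w' :: "nat \<Rightarrow> int"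
    by (auto simp: fun_eq_iff restrict_def split: if_splits)
  have coll_r: "(\<Sum>l\<in>L. (r l)\<^sup>2) = real (card {(q, q'). q \<in> Q \<and> q' \<in> Q \<and> (\<forall>j\<in>{1..k}. \<nu> q j = \<nu> q' j)})"
    unfolding r_def sum_card_fibers_sq[OF fin(2) finL \<nu>L] by (simp only: \<nu>'_def eq_iff)
  have coll_\<rho>: "(\<Sum>m\<in>M. (\<rho> m)\<^sup>2) = real (card {(p, p'). p \<in> P \<and> p' \<in> P \<and> (\<forall>j\<in>{1..k}. \<mu> p j = \<mu> p' j)})"
    unfolding \<rho>_def sum_card_fibers_sq[OF fin(1) finM \<mu>M] by (simp only: \<mu>'_def eq_iff)
  have "(\<Sum>p\<in>P. \<Sum>q\<in>Q. add_char (wdot k \<gamma> (\<mu> p) (\<nu> q))) = (\<Sum>q\<in>Q. G (\<nu>' q))"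
  proof -
    have "wdot k \<gamma> (\<mu> p) (\<nu>' q) = wdot k \<gamma> (\<mu> p) (\<nu> q)" for p q
      unfolding \<nu>'_def wdot_sym[of k \<gamma> "\<mu> p"] by (rule wdot_restrict)
    then show ?thesis unfolding G_def by (subst sum.swap) simp
  qed
  also have "\<dots> = (\<Sum>l\<in>L. of_nat (card {q\<in>Q. \<nu>' q = l}) * G l)"
    by (rule sum_group_card[OF fin(2) finL \<nu>L])
  finally have "norm (\<Sum>p\<in>P. \<Sum>q\<in>Q. add_char (wdot k \<gamma> (\<mu> p) (\<nu> q))) \<le> (\<Sum>l\<in>L. r l * norm (G l))"
    using norm_sum[of "\<lambda>l. of_nat (card {q\<in>Q. \<nu>' q = l}) * G l" L] by (simp add: norm_mult r_def)
  then have "(norm (\<Sum>p\<in>P. \<Sum>q\<in>Q. add_char (wdot k \<gamma> (\<mu> p) (\<nu> q))))\<^sup>2 \<le> (\<Sum>l\<in>L. r l * norm (G l))\<^sup>2"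
    by (intro power_mono) auto
  \<comment> \<open>Cauchy-Schwarz removes the multiplicities \<open>r l\<close>. The remaining sum
    runs over the whole box \<open>L\<close>, where it factors into Dirichlet kernels.\<close>
  also have "\<dots> \<le> (\<Sum>l\<in>L. (r l)\<^sup>2) * (\<Sum>l\<in>L. (norm (G l))\<^sup>2)"
    by (rule Cauchy_Schwarz_ineq_sum)
  also have "\<dots> \<le> (\<Sum>l\<in>L. (r l)\<^sup>2) * ((\<Sum>m\<in>M. (\<rho> m)\<^sup>2) * Pr)"
  proof (intro mult_left_mono)
    have "complex_of_real (\<Sum>l\<in>L. (norm (G l))\<^sup>2)
        = (\<Sum>l\<in>L. \<Sum>p\<in>P. \<Sum>p'\<in>P. add_char (wdot k \<gamma> (\<lambda>j. \<mu> p j - \<mu> p' j) l))"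
      unfolding of_real_sum complex_norm_square G_def by (simp add: sum_product wdot_diff add_char_diff)
    also have "\<dots> = (\<Sum>p\<in>P. \<Sum>p'\<in>P. \<Sum>l\<in>L. add_char (wdot k \<gamma> (\<lambda>j. \<mu> p j - \<mu> p' j) l))"
      by (subst sum.swap, subst (2) sum.swap) simp
    also have "\<dots> = (\<Sum>p\<in>P. \<Sum>p'\<in>P. \<Prod>j=1..k. dirichlet_kernel (b j) (\<gamma> j * of_int (\<mu> p j - \<mu> p' j)))"
    proof (intro sum.cong refl)
      fix p p'
      show "(\<Sum>l\<in>L. add_char (wdot k \<gamma> (\<lambda>j. \<mu> p j - \<mu> p' j) l))
          = (\<Prod>j=1..k. dirichlet_kernel (b j) (\<gamma> j * of_int (\<mu> p j - \<mu> p' j)))"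
        unfolding L_def wdot_def add_char_sum dirichlet_kernel_def
        by (subst prod_sum_PiE) (auto simp: mult_ac)
    qed
    finally have "(\<Sum>l\<in>L. (norm (G l))\<^sup>2)
        = norm (\<Sum>p\<in>P. \<Sum>p'\<in>P. \<Prod>j=1..k. dirichlet_kernel (b j) (\<gamma> j * of_int (\<mu> p j - \<mu> p' j)))"
      by (metis (no_types, lifting) abs_of_nonneg norm_of_real sum_nonneg zero_le_power2)
    also have "\<dots> \<le> (\<Sum>p\<in>P. \<Sum>p'\<in>P. K (\<mu>' p) (\<mu>' p'))"
    proof (rule order_trans[OF norm_sum sum_mono], rule order_trans[OF norm_sum sum_mono])
      fix p p'
      show "norm (\<Prod>j=1..k. dirichlet_kernel (b j) (\<gamma> j * of_int (\<mu> p j - \<mu> p' j))) \<le> K (\<mu>' p) (\<mu>' p')"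
        unfolding K_def \<mu>'_def by (simp add: prod_norm[symmetric])
    qed
    also have "\<dots> = (\<Sum>m\<in>M. \<Sum>m'\<in>M. \<rho> m * \<rho> m' * K m m')"
    proof -
      have "(\<Sum>p\<in>P. \<Sum>p'\<in>P. K (\<mu>' p) (\<mu>' p')) = (\<Sum>p\<in>P. \<Sum>m'\<in>M. \<rho> m' * K (\<mu>' p) m')"
        unfolding \<rho>_def by (intro sum.cong refl sum_group_card[OF fin(1) finM \<mu>M])
      also have "\<dots> = (\<Sum>m\<in>M. \<rho> m * (\<Sum>m'\<in>M. \<rho> m' * K m m'))"
        unfolding \<rho>_def by (rule sum_group_card[OF fin(1) finM \<mu>M])
      finally show ?thesis by (simp add: sum_distrib_left mult_ac)
    qed
    \<comment> \<open>Schur's test: the arithmetic-geometric mean inequality and the symmetry of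
      \<open>K\<close> turn products of multiplicities into squares weighted by row sums.\<close>
    also have "\<dots> \<le> (\<Sum>m\<in>M. \<Sum>m'\<in>M. ((\<rho> m)\<^sup>2 * K m m' + (\<rho> m')\<^sup>2 * K m m') / 2)"
    proof (intro sum_mono)
      fix m m'
      have "0 \<le> (\<rho> m - \<rho> m')\<^sup>2" by simp
      then have "\<rho> m * \<rho> m' \<le> ((\<rho> m)\<^sup>2 + (\<rho> m')\<^sup>2) / 2" by (simp add: power2_diff)
      moreover have "0 \<le> K m m'" unfolding K_def by (intro prod_nonneg) auto
      ultimately have "\<rho> m * \<rho> m' * K m m' \<le> ((\<rho> m)\<^sup>2 + (\<rho> m')\<^sup>2) / 2 * K m m'" by (rule mult_right_mono)
      then show "\<rho> m * \<rho> m' * K m m' \<le> ((\<rho> m)\<^sup>2 * K m m' + (\<rho> m')\<^sup>2 * K m m') / 2"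
        by (simp add: algebra_simps)
    qed
    also have "\<dots> = (\<Sum>m\<in>M. (\<rho> m)\<^sup>2 * (\<Sum>m'\<in>M. K m m'))"
    proof -
      have sym: "K m m' = K m' m" for m m'
      proof -
        have "\<gamma> j * of_int (m' j - m j) = - (\<gamma> j * of_int (m j - m' j))" for j by (simp add: algebra_simps)
        then show ?thesis unfolding K_def by (simp only: dirichlet_kernel_minus)
      qed
      have swap: "(\<Sum>m\<in>M. \<Sum>m'\<in>M. (\<rho> m')\<^sup>2 * K m m') = (\<Sum>m\<in>M. \<Sum>m'\<in>M. (\<rho> m)\<^sup>2 * K m m')"
        by (subst sum.swap) (simp add: sym)
      have half: "(x + x) / 2 = x" for x :: real by simp
      show ?thesis
        unfolding sum_divide_distrib[symmetric] sum.distrib swap half sum_distrib_left ..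
    qed
    also have "\<dots> \<le> (\<Sum>m\<in>M. (\<rho> m)\<^sup>2 * Pr)"
    proof (intro sum_mono mult_left_mono)
      fix m assume m: "m \<in> M"
      have "(\<Sum>m'\<in>M. K m m') = (\<Prod>j=1..k. \<Sum>y\<in>{- a j..a j}. norm (dirichlet_kernel (b j) (\<gamma> j * of_int (m j - y))))"
        unfolding K_def M_def by (subst prod_sum_PiE) auto
      also have "\<dots> \<le> Pr"
        unfolding Pr_def
      proof (intro prod_mono conjI sum_nonneg)
        fix j assume j: "j \<in> {1..k}"
        then have mj: "- a j \<le> m j" "m j \<le> a j" using m by (auto simp: M_def)
        have "(\<Sum>y\<in>{- a j..a j}. norm (dirichlet_kernel (b j) (\<gamma> j * of_int (m j - y))))
            = (\<Sum>x\<in>{m j - a j..m j + a j}. norm (dirichlet_kernel (b j) (\<gamma> j * of_int x)))"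
          by (rule sum.reindex_bij_witness[of _ "\<lambda>x. m j - x" "\<lambda>y. m j - y"]) auto
        \<comment> \<open>Differences of two numbers in \<open>[-a j, a j]\<close> lie in the
          doubled interval, which therefore serves all rows at once.\<close>
        also have "\<dots> \<le> (\<Sum>x\<in>{-2 * a j..2 * a j}. norm (dirichlet_kernel (b j) (\<gamma> j * of_int x)))"
          using mj by (intro sum_mono2) auto
        finally show "(\<Sum>y\<in>{- a j..a j}. norm (dirichlet_kernel (b j) (\<gamma> j * of_int (m j - y))))
          \<le> (\<Sum>x\<in>{-2 * a j..2 * a j}. norm (dirichlet_kernel (b j) (\<gamma> j * of_int x)))" .
      qed auto
      finally show "(\<Sum>m'\<in>M. K m m') \<le> Pr" .
    qed auto
    also have "\<dots> = (\<Sum>m\<in>M. (\<rho> m)\<^sup>2) * Pr" by (simp add: sum_distrib_right)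
    finally show "(\<Sum>l\<in>L. (norm (G l))\<^sup>2) \<le> (\<Sum>m\<in>M. (\<rho> m)\<^sup>2) * Pr" .
  qed (auto intro: sum_nonneg)
  finally show ?thesis unfolding coll_r coll_\<rho> Pr_def by (simp only: mult_ac)
qed

text \<open>Moving the subtracted power sums to the other side turns a collision of two pairs of
  \<open>s\<close>-tuples into equal power sums of two \<open>2 s\<close>-tuples, which the mean
  value with parameter \<open>2 s\<close> counts.\<close>

lemma collisions_le:
  assumes "k > 0" "k * k + 2 + k * r \<le> 2 * s"
  shows "\<exists>C>0. \<forall>n. real (card {(p, p'). p \<in> tuples s {0..<2 ^ n} \<and> p' \<in> tuples s {0..<2 ^ n} \<and>
      (\<forall>j\<in>{1..k}. moments s p j = moments s p' j)}) \<le> C * 2 powr (real n * mv_exp k r (2 * s))"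
proof -
  from vinogradov_mean_value[OF assms] obtain C where "C > 0" and
    C: "\<And>n a Y R. 0 \<le> a \<Longrightarrow> a + 2 ^ n \<le> int Y \<Longrightarrow> 2 * s * Y ^ k < R \<Longrightarrow>
      mean_value k R (2 * s) {a..<a + 2 ^ n} \<le> C * real R ^ k * 2 powr (real n * mv_exp k r (2 * s))"
    by metis
  have "real (card {(p, p'). p \<in> tuples s {0..<2 ^ n} \<and> p' \<in> tuples s {0..<2 ^ n} \<and>
      (\<forall>j\<in>{1..k}. moments s p j = moments s p' j)}) \<le> C * 2 powr (real n * mv_exp k r (2 * s))" for n
  proof -
    define A :: "int set" where "A = {0..<2 ^ n}"
    define R where "R = Suc (2 * s * (2 ^ n) ^ k)"
    define S where "S = {(p, p'). p \<in> tuples s A \<and> p' \<in> tuples s A \<and>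
      (\<forall>j\<in>{1..k}. int R dvd moments s p j - moments s p' j)}"
    have finA: "finite A" by (simp add: A_def)
    have "R > 0" by (simp add: R_def)
    have ms: "norm (multisum k R x (tuples s A) (moments s)) = norm (expsum k R x A) ^ (2 * s)" for x
    proof -
      have "multisum k R x (tuples s A) (moments s) = of_real ((norm (multisum k R x (PiE {..<s} (\<lambda>_. A)) (psum {..<s})))\<^sup>2)"
        unfolding norm_sq_multisum
        by (simp add: case_prod_unfold multisum_def tuples_def dotp_def moments_def)
      also have "multisum k R x (PiE {..<s} (\<lambda>_. A)) (psum {..<s}) = expsum k R x A ^ s"
        by (simp add: expsum_power[OF finA])
      finally show ?thesis by (simp add: norm_power power_mult[symmetric] mult.commute)
    qed
    have "real R ^ k * real (card S) = (\<Sum>x\<in>freqs k R. (norm (multisum k R x (tuples s A) (moments s)))\<^sup>2)"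
      unfolding S_def using mean_sq_multisum[of "tuples s A" R k "moments s"] finA \<open>R > 0\<close> by simp
    also have "\<dots> = mean_value k R (2 * s) A"
      unfolding ms mean_value_def by (simp add: power_mult[symmetric] mult_ac)
    also have "\<dots> \<le> C * real R ^ k * 2 powr (real n * mv_exp k r (2 * s))"
      using C[of 0 n "2 ^ n" R] by (simp add: A_def R_def)
    finally have "real R ^ k * real (card S) \<le> real R ^ k * (C * 2 powr (real n * mv_exp k r (2 * s)))"
      by (simp add: mult_ac)
    then have "real (card S) \<le> C * 2 powr (real n * mv_exp k r (2 * s))"
      using \<open>R > 0\<close> by (simp add: mult_le_cancel_left_pos)
    moreover have "card {(p, p'). p \<in> tuples s A \<and> p' \<in> tuples s A \<and>
      (\<forall>j\<in>{1..k}. moments s p j = moments s p' j)} \<le> card S"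
    proof (rule card_mono)
      have "S \<subseteq> tuples s A \<times> tuples s A" by (auto simp: S_def)
      then show "finite S" using finA by (meson finite_SigmaI finite_subset finite_tuples)
      show "{(p, p'). p \<in> tuples s A \<and> p' \<in> tuples s A \<and>
          (\<forall>j\<in>{1..k}. moments s p j = moments s p' j)} \<subseteq> S" unfolding S_def by auto
    qed
    ultimately show ?thesis unfolding A_def by linarith
  qed
  then show ?thesis using \<open>C > 0\<close> by blast
qed

lemma moments_le:
  assumes "p \<in> tuples s {0..<2 ^ n}"
  shows "\<bar>moments s p j\<bar> \<le> int s * 2 ^ (n * j)"
proof -
  have "0 \<le> psum {..<s} t j \<and> psum {..<s} t j \<le> int s * (2 ^ n) ^ j" if "t \<in> PiE {..<s} (\<lambda>_. {0..<2 ^ n})" for t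
    using psum_bounds[of "{..<s}" t "2 ^ n" j] that by (auto simp: PiE_iff less_imp_le)
  moreover have "fst p \<in> PiE {..<s} (\<lambda>_. {0..<2 ^ n})" "snd p \<in> PiE {..<s} (\<lambda>_. {0..<2 ^ n})"
    using assms unfolding tuples_def by (simp_all add: mem_Times_iff)
  ultimately have "0 \<le> psum {..<s} (fst p) j \<and> psum {..<s} (fst p) j \<le> int s * (2 ^ n) ^ j"
      "0 \<le> psum {..<s} (snd p) j \<and> psum {..<s} (snd p) j \<le> int s * (2 ^ n) ^ j"
    by blast+
  then show ?thesis unfolding moments_def power_mult by linarith
qed

text \<open>The exponent \<open>8 s^2\<close> is twice \<open>2 s * 2 s\<close>, since the collision
  bound is for a square. The factors \<open>2 ^ n\<close> and \<open>2 ^ n'\<close> enter the mean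
  values symmetrically; only the kernels distinguish the two sides.\<close>

lemma bilinear_sum_le:
  assumes "k > 0" "s > 0" "k * k + 2 + k * r \<le> 2 * s"
  shows "\<exists>C>0. \<forall>n n' \<gamma>.
    norm (\<Sum>v\<in>{0..<2 ^ n'}. \<Sum>u\<in>{0..<2 ^ n}. add_char (wdot k \<gamma> (\<lambda>j. u ^ j) (\<lambda>j. v ^ j))) ^ (8 * s * s)
    \<le> C * (2 ^ (n + n')) ^ (8 * s * s - 4 * s) * 2 powr (real (n + n') * mv_exp k r (2 * s))
      * (\<Prod>j=1..k. \<Sum>x\<in>{-2 * (int s * 2 ^ (n * j))..2 * (int s * 2 ^ (n * j))}.
          norm (dirichlet_kernel (int s * 2 ^ (n' * j)) (\<gamma> j * of_int x)))"
proof -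
  from collisions_le[OF assms(1,3)] obtain C where "C > 0" and
    C: "\<And>n. real (card {(p, p'). p \<in> tuples s {0..<2 ^ n} \<and> p' \<in> tuples s {0..<2 ^ n} \<and>
      (\<forall>j\<in>{1..k}. moments s p j = moments s p' j)}) \<le> C * 2 powr (real n * mv_exp k r (2 * s))"
    by blast
  have "norm (\<Sum>v\<in>{0..<2 ^ n'}. \<Sum>u\<in>{0..<2 ^ n}. add_char (wdot k \<gamma> (\<lambda>j. u ^ j) (\<lambda>j. v ^ j))) ^ (8 * s * s)
    \<le> C * C * (2 ^ (n + n')) ^ (8 * s * s - 4 * s) * 2 powr (real (n + n') * mv_exp k r (2 * s))
      * (\<Prod>j=1..k. \<Sum>x\<in>{-2 * (int s * 2 ^ (n * j))..2 * (int s * 2 ^ (n * j))}.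
          norm (dirichlet_kernel (int s * 2 ^ (n' * j)) (\<gamma> j * of_int x)))" for n n' \<gamma>
  proof -
    define A B :: "int set" where "A = {0..<2 ^ n}" and "B = {0..<2 ^ n'}"
    define X where "X = norm (\<Sum>v\<in>B. \<Sum>u\<in>A. add_char (wdot k \<gamma> (\<lambda>j. u ^ j) (\<lambda>j. v ^ j)))"
    define W where "W = norm (\<Sum>p\<in>tuples s A. \<Sum>q\<in>tuples s B. add_char (wdot k \<gamma> (moments s p) (moments s q)))"
    define Pr where "Pr = (\<Prod>j=1..k. \<Sum>x\<in>{-2 * (int s * 2 ^ (n * j))..2 * (int s * 2 ^ (n * j))}.
          norm (dirichlet_kernel (int s * 2 ^ (n' * j)) (\<gamma> j * of_int x)))"
    define N where "N D = real (card {(p, p'). p \<in> tuples s D \<and> p' \<in> tuples s D \<and>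
      (\<forall>j\<in>{1..k}. moments s p j = moments s p' j)})" for D
    have "Pr \<ge> 0" unfolding Pr_def by (intro prod_nonneg sum_nonneg ballI norm_ge_zero)
    have cards: "real (card A * card B) = 2 ^ (n + n')"
      by (simp add: A_def B_def nat_power_eq power_add)
    have "X ^ (8 * s * s) = (X ^ (2 * s * (2 * s)))\<^sup>2" by (simp add: power_mult[symmetric] mult_ac)
    also have "\<dots> \<le> ((2 ^ (n + n')) ^ (2 * s * (2 * s) - 2 * s) * W)\<^sup>2"
      using bilinear_moments[of A B s k \<gamma>] \<open>s > 0\<close> unfolding cards
      by (intro power_mono) (auto simp: A_def B_def X_def W_def)
    also have "\<dots> = (2 ^ (n + n')) ^ (8 * s * s - 4 * s) * W\<^sup>2"
      by (simp add: power_mult_distrib power_mult[symmetric] algebra_simps diff_mult_distrib2)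
    also have "W\<^sup>2 \<le> N A * N B * Pr"
      unfolding W_def N_def Pr_def
      by (rule bilinear_le_collisions) (use moments_le in \<open>auto simp: A_def B_def\<close>)
    also have "N A * N B * Pr \<le> (C * 2 powr (real n * mv_exp k r (2 * s))) * (C * 2 powr (real n' * mv_exp k r (2 * s))) * Pr"
      using C[of n] C[of n'] \<open>C > 0\<close> \<open>Pr \<ge> 0\<close>
      by (intro mult_right_mono mult_mono) (auto simp: N_def A_def B_def)
    also have "\<dots> = C * C * 2 powr (real (n + n') * mv_exp k r (2 * s)) * Pr"
      by (simp add: distrib_right powr_add)
    finally show ?thesis unfolding X_def Pr_def A_def B_def by (simp add: mult_ac)
  qed
  then show ?thesis using \<open>C > 0\<close> by (intro exI[of _ "C * C"] conjI allI) (auto simp: mult_ac)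
qed

subsection \<open>Reduction to a bilinear sum\<close>

text \<open>A second moment argument with geometric sums \<open>Z i\<close> of length
  \<open>L = 2 p^2\<close>. Avoidance bounds each by \<open>p\<close>. If all frequencies
  \<open>l\<close> gave sums below \<open>t\<close>, the off-diagonal terms would total less than
  \<open>L^2 t\<close>, which is \<open>p^2\<close> times \<open>card I\<close>, against a diagonal
  of twice that size, and the mean square of \<open>Z\<close> would exceed
  \<open>p^2\<close>.\<close>

lemma large_sum_if_avoiding:
  fixes x :: "'i \<Rightarrow> real"
  assumes I: "finite I" "I \<noteq> {}" and p: "p \<ge> (2::nat)"
    and avoid: "\<forall>i\<in>I. 1 / real p \<le> frac (x i)"
  shows "\<exists>l::int. l \<noteq> 0 \<and> \<bar>l\<bar> < 2 * (int p)\<^sup>2 \<and>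
    real (card I) / (4 * (real p)\<^sup>2) \<le> norm (\<Sum>i\<in>I. add_char (of_int l * x i))"
proof (rule ccontr)
  assume neg: "\<not> ?thesis"
  define L where "L = 2 * p\<^sup>2"
  define t where "t = real (card I) / (4 * (real p)\<^sup>2)"
  \<comment> \<open>The shift moves the centre of the avoided interval to 0, so every
    \<open>y i\<close> has distance at least \<open>1 / (2 p)\<close> from the integers.\<close>
  define y where "y i = x i - 1 / (2 * real p)" for i
  define Z where "Z i = (\<Sum>j<L. add_char (real j * y i))" for i
  have small: "norm (\<Sum>i\<in>I. add_char (of_int l * x i)) < t" if "l \<noteq> 0" "\<bar>l\<bar> < int L" for l
    using neg that unfolding t_def L_def by force
  have "t > 0" using I p by (simp add: t_def card_gt_0_iff)
  have Zle: "norm (Z i) \<le> real p" if i: "i \<in> I" for i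
  proof -
    define w where "w = frac (x i) - 1 / (2 * real p)"
    define h where "h = 1 / (2 * real p)"
    have h: "h \<ge> 0" "1 / real p = 2 * h" "2 / real p = 4 * h" by (simp_all add: h_def)
    have w: "h \<le> w" "w \<le> 1 - h"
      using avoid[rule_format, OF i] frac_lt_1[of "x i"] h unfolding w_def h_def[symmetric] by linarith+
    have "y i = w + of_int \<lfloor>x i\<rfloor>" by (simp add: w_def y_def frac_def)
    then have yw: "add_char (y i) = add_char w" by (simp add: add_char_add)
    have "4 * h \<le> norm (add_char w - 1)"
    proof (cases "w \<le> 1 / 2")
      case True
      then show ?thesis using norm_add_char_diff_1_ge[of w] w h by (simp add: abs_of_nonneg)
    next
      case False
      have "add_char (w - 1) = add_char w"
        using add_char_diff[of w "of_int 1"] add_char_of_int[of 1] by simp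
      then show ?thesis using norm_add_char_diff_1_ge[of "w - 1"] False w h by (simp add: abs_of_nonpos)
    qed
    then have "2 / real p \<le> norm (add_char w - 1)" unfolding h .
    moreover have "0 < 2 / real p" using p by simp
    ultimately have *: "2 / real p \<le> norm (add_char (y i) - 1)" "add_char (y i) \<noteq> 1" unfolding yw by auto
    have "norm (Z i) \<le> 2 / norm (add_char (y i) - 1)"
      unfolding Z_def by (rule norm_geometric_add_char_le[OF *(2)])
    also have "\<dots> \<le> 2 / (2 / real p)" using * p by (intro divide_left_mono mult_pos_pos) auto
    finally show ?thesis by simp
  qed
  have "complex_of_real (\<Sum>i\<in>I. (norm (Z i))\<^sup>2)
      = (\<Sum>i\<in>I. \<Sum>q\<in>{..<L} \<times> {..<L}. add_char ((real (fst q) - real (snd q)) * y i))"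
    unfolding of_real_sum complex_norm_square Z_def cnj_sum sum_product sum.cartesian_product
    by (simp add: case_prod_unfold left_diff_distrib add_char_diff)
  also have "\<dots> = (\<Sum>q\<in>{..<L} \<times> {..<L}. \<Sum>i\<in>I. add_char ((real (fst q) - real (snd q)) * y i))"
    by (rule sum.swap)
  also have "\<dots> = (\<Sum>q\<in>{..<L} \<times> {..<L}. if fst q = snd q then of_nat (card I) else
      (\<Sum>i\<in>I. add_char ((real (fst q) - real (snd q)) * y i)))"
    by (intro sum.cong) auto
  also have "\<dots> = (\<Sum>q\<in>{..<L} \<times> {..<L}. if fst q = snd q then of_nat (card I) else 0)
     + (\<Sum>q\<in>{..<L} \<times> {..<L}. if fst q = snd q then 0 else
      (\<Sum>i\<in>I. add_char ((real (fst q) - real (snd q)) * y i)))" (is "_ = ?D + ?E")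
    unfolding sum.distrib[symmetric] by (intro sum.cong) auto
  also have "?D = of_nat (L * card I)"
  proof -
    have "?D = (\<Sum>a<L. \<Sum>b<L. if a = b then of_nat (card I) else 0)"
      unfolding sum.cartesian_product by (intro sum.cong) auto
    then show ?thesis by simp
  qed
  finally have eq: "complex_of_real (\<Sum>i\<in>I. (norm (Z i))\<^sup>2) - of_nat (L * card I) = ?E" by simp
  have "L > 0" using p by (simp add: L_def)
  have "norm ?E \<le> (\<Sum>q\<in>{..<L} \<times> {..<L}. if fst q = snd q then 0 else t)"
  proof (rule order_trans[OF norm_sum sum_mono])
    fix q assume q: "q \<in> {..<L} \<times> {..<L}"
    show "norm (if fst q = snd q then 0 else \<Sum>i\<in>I. add_char ((real (fst q) - real (snd q)) * y i))
        \<le> (if fst q = snd q then 0 else t)"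
    proof (cases "fst q = snd q")
      case False
      define l where "l = int (fst q) - int (snd q)"
      have l: "l \<noteq> 0" "\<bar>l\<bar> < int L" using q False by (auto simp: l_def)
      have "(\<Sum>i\<in>I. add_char ((real (fst q) - real (snd q)) * y i))
          = add_char (- of_int l / (2 * real p)) * (\<Sum>i\<in>I. add_char (of_int l * x i))"
        unfolding sum_distrib_left
        by (intro sum.cong) (auto simp: l_def y_def algebra_simps diff_divide_distrib simp flip: add_char_add)
      also have "norm \<dots> \<le> t" using small[OF l] by (simp add: norm_mult)
      finally show ?thesis using False by simp
    qed simp
  qed
  also have "\<dots> < (\<Sum>q\<in>{..<L} \<times> {..<L}. t)"
    using \<open>t > 0\<close> \<open>L > 0\<close> by (intro sum_strict_mono_ex1 bexI[of _ "(0, 0)"]) auto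
  also have "\<dots> = real (card I) * (real p)\<^sup>2"
    using p by (simp add: L_def t_def card_cartesian_product power2_eq_square)
  finally have "norm (complex_of_real (\<Sum>i\<in>I. (norm (Z i))\<^sup>2) - of_nat (L * card I)) < real (card I) * (real p)\<^sup>2"
    unfolding eq .
  also have "complex_of_real (\<Sum>i\<in>I. (norm (Z i))\<^sup>2) - of_nat (L * card I)
      = of_real ((\<Sum>i\<in>I. (norm (Z i))\<^sup>2) - real (L * card I))" by simp
  finally have "\<bar>(\<Sum>i\<in>I. (norm (Z i))\<^sup>2) - real (L * card I)\<bar> < real (card I) * (real p)\<^sup>2"
    by (simp only: norm_of_real)
  moreover have "(\<Sum>i\<in>I. (norm (Z i))\<^sup>2) \<le> (\<Sum>i\<in>I. (real p)\<^sup>2)"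
    by (intro sum_mono power_mono Zle) auto
  moreover have "(\<Sum>i\<in>I. (real p)\<^sup>2) = real (card I) * (real p)\<^sup>2" by simp
  moreover have "real (L * card I) = 2 * (real (card I) * (real p)\<^sup>2)" by (simp add: L_def)
  ultimately show False by linarith
qed

text \<open>The residue of the integer part lies between 1 and \<open>p - 1\<close>, and the
  fractional part of \<open>X\<close> cannot carry it to the next multiple of
  \<open>p\<close>.\<close>

lemma frac_divide_ge:
  fixes X :: real
  assumes "X \<ge> 0" "p > 0" "\<not> p dvd nat \<lfloor>X\<rfloor>"
  shows "1 / real p \<le> frac (X / real p)"
proof -
  define m where "m = nat \<lfloor>X\<rfloor>"
  define d r where "d = m div p" and "r = m mod p"
  have m: "m = p * d + r" by (simp add: d_def r_def)
  have r: "1 \<le> r" "r < p" using assms by (auto simp: r_def m_def mod_greater_zero_iff_not_dvd Suc_le_eq)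
  have X: "real m \<le> X" "X < real m + 1" using assms by (auto simp: m_def)
  have "real m = real p * real d + real r" by (simp add: m)
  moreover have "real r + 1 \<le> real p" "1 \<le> real r" using r by linarith+
  ultimately have 1: "real p * real d + 1 \<le> X" "X < real p * real d + real p" using X by linarith+
  then have "real d + 1 / real p \<le> X / real p" "X / real p < real d + 1"
    using divide_right_mono[OF 1(1), of "real p"] divide_strict_right_mono[OF 1(2), of "real p"] \<open>p > 0\<close>
    by (simp_all add: add_divide_distrib)
  moreover from this have "\<lfloor>X / real p\<rfloor> = int d"
    using \<open>p > 0\<close> by (intro floor_unique) (auto intro: order_trans[rotated])
  ultimately show ?thesis by (simp add: frac_def)
qed

text \<open>Convergence of the series at \<open>1 / 2\<close> bounds the coefficients by a multiple
  of \<open>2 ^ n\<close>; for \<open>z\<close> at most \<open>1 / 4\<close> the tail is then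
  geometric with ratio at most \<open>1 / 2\<close>.\<close>

lemma binomial_approximation:
  fixes c :: real
  shows "\<exists>B>0. \<forall>z. 0 \<le> z \<and> z \<le> 1 / 4 \<longrightarrow> \<bar>(1 + z) powr c - (\<Sum>j\<le>k. (c gchoose j) * z ^ j)\<bar> \<le> B * z ^ Suc k"
proof -
  have "(\<lambda>n. (c gchoose n) * (1 / 2) ^ n) sums (1 + 1 / 2) powr c"
    by (rule gen_binomial_real) auto
  then have "(\<lambda>n. (c gchoose n) * (1 / 2) ^ n) \<longlonglongrightarrow> 0"
    using summable_LIMSEQ_zero sums_summable by blast
  then have "Bseq (\<lambda>n. (c gchoose n) * (1 / 2) ^ n)" using convergent_imp_Bseq convergentI by blast
  then obtain K where "K > 0" and K: "\<And>n. norm ((c gchoose n) * (1 / 2) ^ n) \<le> K" by (auto simp: Bseq_def)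
  have "\<bar>(1 + z) powr c - (\<Sum>j\<le>k. (c gchoose j) * z ^ j)\<bar> \<le> (K * 2 ^ Suc k * 2) * z ^ Suc k"
    if z: "0 \<le> z" "z \<le> 1 / 4" for z
  proof -
    define a where "a n = (c gchoose n) * z ^ n" for n
    have a: "a sums (1 + z) powr c" unfolding a_def using z by (intro gen_binomial_real) auto
    have abound: "norm (a (n + Suc k)) \<le> K * (2 * z) ^ Suc k * (2 * z) ^ n" for n
    proof -
      have "norm (a (n + Suc k)) = norm ((c gchoose (n + Suc k)) * (1 / 2) ^ (n + Suc k)) * (2 * z) ^ (n + Suc k)"
        using z by (simp add: a_def abs_mult power_mult_distrib power_divide field_simps)
      also have "\<dots> \<le> K * (2 * z) ^ (n + Suc k)" using z by (intro mult_right_mono K) auto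
      finally show ?thesis by (simp add: power_add mult_ac)
    qed
    have geo: "(\<lambda>n. K * (2 * z) ^ Suc k * (2 * z) ^ n) sums (K * (2 * z) ^ Suc k * (1 / (1 - 2 * z)))"
      using z by (intro sums_mult geometric_sums) auto
    have "(1 + z) powr c - (\<Sum>j\<le>k. a j) = (\<Sum>n. a (n + Suc k))"
      using suminf_minus_initial_segment[OF sums_summable[OF a], of "Suc k"] sums_unique[OF a]
      by (simp add: lessThan_Suc_atMost)
    also have "norm \<dots> \<le> (\<Sum>n. K * (2 * z) ^ Suc k * (2 * z) ^ n)"
      by (intro norm_suminf_le abound sums_summable[OF geo])
    also have "\<dots> = K * (2 * z) ^ Suc k * (1 / (1 - 2 * z))" using sums_unique[OF geo] by simp
    also have "\<dots> \<le> K * (2 * z) ^ Suc k * 2"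
      using z \<open>K > 0\<close> by (intro mult_left_mono) (auto simp: field_simps)
    finally show ?thesis unfolding a_def by (simp add: power_mult_distrib mult_ac)
  qed
  then show ?thesis using \<open>K > 0\<close> by (intro exI[of _ "K * 2 ^ Suc k * 2"]) auto
qed

text \<open>The coefficient of \<open>(u v) ^ j\<close> in the expansion of \<open>l / p\<close>
  times the \<open>c\<close>-th power of \<open>2 ^ (8 n) + u v\<close>.\<close>

definition coef :: "real \<Rightarrow> nat \<Rightarrow> nat \<Rightarrow> int \<Rightarrow> nat \<Rightarrow> real" where
  "coef c n p l j = of_int l / real p * (c gchoose j) * 2 powr (8 * real n * (c - real j))"

text \<open>The ratio \<open>z\<close> of \<open>u v\<close> to \<open>2 ^ (8 n)\<close> is at most
  \<open>2 ^ (-4 n)\<close>, which explains \<open>8 c - 4 (k + 1)\<close>; the factor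
  \<open>p\<close> next to it comes from \<open>l / p\<close>, at most \<open>2 p\<close> in
  absolute value. The term of degree 0 is a constant phase \<open>\<theta> l\<close> and disappears
  in the norm.\<close>

lemma large_bilinear_sum_if_avoiding:
  fixes c :: real
  shows "\<exists>B>0. \<forall>n p. n \<ge> 1 \<longrightarrow> p \<ge> 2 \<longrightarrow>
    (\<forall>u\<in>{0..<2 ^ n}. \<forall>v\<in>{0..<2 ^ (3 * n)}. \<not> p dvd nat \<lfloor>(2 ^ (8 * n) + of_int (u * v)) powr c\<rfloor>) \<longrightarrow>
    (\<exists>l::int. l \<noteq> 0 \<and> \<bar>l\<bar> < 2 * (int p)\<^sup>2 \<and>
      2 ^ (4 * n) * (1 / (4 * (real p)\<^sup>2) - B * real p * 2 powr (real n * (8 * c - 4 * (real k + 1))))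
      \<le> norm (\<Sum>v\<in>{0..<2 ^ (3 * n)}. \<Sum>u\<in>{0..<2 ^ n}.
          add_char (wdot k (coef c n p l) (\<lambda>j. u ^ j) (\<lambda>j. v ^ j))))"
proof -
  obtain B where "B > 0" and B: "\<And>z. 0 \<le> z \<Longrightarrow> z \<le> 1 / 4 \<Longrightarrow>
      \<bar>(1 + z) powr c - (\<Sum>j\<le>k. (c gchoose j) * z ^ j)\<bar> \<le> B * z ^ Suc k"
    using binomial_approximation[of c k] by blast
  have "\<exists>l::int. l \<noteq> 0 \<and> \<bar>l\<bar> < 2 * (int p)\<^sup>2 \<and>
      2 ^ (4 * n) * (1 / (4 * (real p)\<^sup>2) - (4 * pi * B) * real p * 2 powr (real n * (8 * c - 4 * (real k + 1))))
      \<le> norm (\<Sum>v\<in>{0..<2 ^ (3 * n)}. \<Sum>u\<in>{0..<2 ^ n}.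
          add_char (wdot k (coef c n p l) (\<lambda>j. u ^ j) (\<lambda>j. v ^ j)))"
    if n: "n \<ge> 1" and p: "p \<ge> 2"
      and avoid: "\<forall>u\<in>{0..<2 ^ n}. \<forall>v\<in>{0..<2 ^ (3 * n)}. \<not> p dvd nat \<lfloor>(2 ^ (8 * n) + of_int (u * v)) powr c\<rfloor>" for n p
  proof -
    define I :: "(int \<times> int) set" where "I = {0..<2 ^ (3 * n)} \<times> {0..<2 ^ n}"
    define X where "X i = (2 ^ (8 * n) + of_int (snd i * fst i)) powr c" for i :: "int \<times> int"
    define W where "W l i = wdot k (coef c n p l) (\<lambda>j. snd i ^ j) (\<lambda>j. fst i ^ j)" for l and i :: "int \<times> int"
    define \<theta> where "\<theta> l = of_int l / real p * 2 powr (8 * real n * c)" for l :: int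
    define \<epsilon> where "\<epsilon> = 2 * real p * B * 2 powr (real n * (8 * c - 4 * (real k + 1)))"
    have finI: "finite I" "I \<noteq> {}" by (auto simp: I_def)
    have cardI: "real (card I) = 2 ^ (4 * n)"
      by (simp add: I_def card_cartesian_product nat_power_eq flip: power_add)
    have fracs: "\<forall>i\<in>I. 1 / real p \<le> frac (X i / real p)"
      using avoid p unfolding X_def I_def by (intro ballI frac_divide_ge) auto
    note ex = large_sum_if_avoiding[OF finI p fracs, unfolded cardI]
    obtain l :: int where l: "l \<noteq> 0" "\<bar>l\<bar> < 2 * (int p)\<^sup>2"
      and large: "2 ^ (4 * n) / (4 * (real p)\<^sup>2) \<le> norm (\<Sum>i\<in>I. add_char (of_int l * (X i / real p)))"
      by (rule exE[OF ex]) (elim conjE, rule that)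
    have "real_of_int \<bar>l\<bar> \<le> real_of_int (2 * (int p)\<^sup>2)" using l by (simp only: of_int_le_iff)
    then have lp: "\<bar>of_int l / real p\<bar> \<le> 2 * real p"
      using p by (simp add: abs_divide field_simps power2_eq_square)
    have approx: "\<bar>of_int l * (X i / real p) - (\<theta> l + W l i)\<bar> \<le> \<epsilon>" if i: "i \<in> I" for i
    proof -
      define z where "z = of_int (snd i * fst i) / (2::real) ^ (8 * n)"
      have ib: "0 \<le> fst i" "fst i \<le> 2 ^ (3 * n)" "0 \<le> snd i" "snd i \<le> 2 ^ n" using i by (auto simp: I_def)
      have "snd i * fst i \<le> 2 ^ n * 2 ^ (3 * n)" using ib by (intro mult_mono) auto
      also have "\<dots> = 2 ^ (4 * n)" by (simp flip: power_add)
      finally have "real_of_int (snd i * fst i) \<le> real_of_int (2 ^ (4 * n))" by (simp only: of_int_le_iff)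
      then have "z \<le> 2 ^ (4 * n) / 2 ^ (8 * n)" unfolding z_def by (intro divide_right_mono) auto
      also have "(2::real) ^ (8 * n) = 2 ^ (4 * n) * 2 ^ (4 * n)" by (simp flip: power_add)
      also have "(2::real) ^ (4 * n) / (2 ^ (4 * n) * 2 ^ (4 * n)) = 2 powr (- 4 * real n)"
        by (simp add: powr_minus powr_realpow[symmetric] field_simps)
      finally have z2: "z \<le> 2 powr (- 4 * real n)" .
      also have "\<dots> \<le> 2 powr (- 2)" using n by (intro powr_mono) auto
      also have "\<dots> = 1 / 4" by (simp add: powr_minus powr_numeral)
      finally have z: "0 \<le> z" "z \<le> 1 / 4" using ib by (auto simp: z_def)
      have M: "(2::real) ^ (8 * n) = 2 powr (8 * real n)" by (simp add: powr_realpow[symmetric])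
      have "X i = (2 ^ (8 * n) * (1 + z)) powr c"
        unfolding X_def z_def by (simp add: distrib_left)
      also have "\<dots> = 2 powr (8 * real n * c) * (1 + z) powr c"
        using z by (subst powr_mult) (auto simp: M powr_powr)
      finally have X: "X i = 2 powr (8 * real n * c) * (1 + z) powr c" .
      have summand: "of_int l / real p * 2 powr (8 * real n * c) * ((c gchoose j) * z ^ j)
          = coef c n p l j * of_int (snd i ^ j) * of_int (fst i ^ j)" for j
      proof -
        have "2 powr (8 * real n * (c - real j)) = 2 powr (8 * real n * c) / (2 ^ (8 * n)) ^ j"
          by (simp add: powr_diff right_diff_distrib M powr_realpow[symmetric] powr_powr)
        then show ?thesis by (simp add: coef_def z_def power_divide power_mult_distrib)
      qed
      have "\<theta> l + W l i = of_int l / real p * 2 powr (8 * real n * c) * (\<Sum>j\<le>k. (c gchoose j) * z ^ j)"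
      proof -
        have "(\<Sum>j\<le>k. (c gchoose j) * z ^ j) = 1 + (\<Sum>j=1..k. (c gchoose j) * z ^ j)"
          by (simp add: atMost_atLeast0 sum.atLeast_Suc_atMost)
        then show ?thesis
          unfolding \<theta>_def W_def wdot_def summand[symmetric] by (simp only: distrib_left sum_distrib_left mult_1_right)
      qed
      then have "of_int l * (X i / real p) - (\<theta> l + W l i)
          = of_int l / real p * 2 powr (8 * real n * c) * ((1 + z) powr c - (\<Sum>j\<le>k. (c gchoose j) * z ^ j))"
        unfolding X by (simp add: algebra_simps diff_divide_distrib)
      also have "\<bar>\<dots>\<bar> \<le> 2 * real p * 2 powr (8 * real n * c) * (B * z ^ Suc k)"
        unfolding abs_mult[of "_ * _"] abs_mult[of "_ / _"] using lp B[OF z] by (intro mult_mono) auto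
      also have "\<dots> \<le> 2 * real p * 2 powr (8 * real n * c) * (B * (2 powr (- 4 * real n)) ^ Suc k)"
        using z z2 \<open>B > 0\<close> by (intro mult_left_mono power_mono) auto
      also have "(2 powr (- 4 * real n)) ^ Suc k = 2 powr (- 4 * real n * (real k + 1))"
        by (subst powr_realpow[symmetric]) (auto simp: powr_powr add.commute simp del: power_Suc)
      also have "2 * real p * 2 powr (8 * real n * c) * (B * 2 powr (- 4 * real n * (real k + 1))) = \<epsilon>"
        unfolding \<epsilon>_def by (simp add: algebra_simps flip: powr_add)
      finally show ?thesis .
    qed
    have "norm (\<Sum>i\<in>I. add_char (of_int l * (X i / real p)))
        \<le> norm (\<Sum>i\<in>I. add_char (\<theta> l + W l i)) + 2 ^ (4 * n) * (2 * pi * \<epsilon>)"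
    proof -
      have "(\<Sum>i\<in>I. add_char (of_int l * (X i / real p))) = (\<Sum>i\<in>I. add_char (\<theta> l + W l i))
          + (\<Sum>i\<in>I. add_char (of_int l * (X i / real p)) - add_char (\<theta> l + W l i))"
        by (simp add: sum_subtractf)
      moreover have "norm (\<Sum>i\<in>I. add_char (of_int l * (X i / real p)) - add_char (\<theta> l + W l i)) \<le> (\<Sum>i\<in>I. 2 * pi * \<epsilon>)"
        using approx by (intro order_trans[OF norm_sum sum_mono] order_trans[OF norm_add_char_diff_le] mult_left_mono) auto
      ultimately show ?thesis
        using norm_triangle_ineq[of "\<Sum>i\<in>I. add_char (\<theta> l + W l i)"
            "\<Sum>i\<in>I. add_char (of_int l * (X i / real p)) - add_char (\<theta> l + W l i)"] cardI by simp
    qed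
    also have "(\<Sum>i\<in>I. add_char (\<theta> l + W l i)) = add_char (\<theta> l) * (\<Sum>i\<in>I. add_char (W l i))"
      by (simp add: add_char_add sum_distrib_left)
    also have "norm \<dots> = norm (\<Sum>i\<in>I. add_char (W l i))" by (simp add: norm_mult)
    also have "(\<Sum>i\<in>I. add_char (W l i)) = (\<Sum>v\<in>{0..<2 ^ (3 * n)}. \<Sum>u\<in>{0..<2 ^ n}.
          add_char (wdot k (coef c n p l) (\<lambda>j. u ^ j) (\<lambda>j. v ^ j)))"
      unfolding I_def W_def sum.cartesian_product by (simp add: case_prod_unfold)
    finally have "2 ^ (4 * n) * (1 / (4 * (real p)\<^sup>2) - 2 * pi * \<epsilon>)
        \<le> norm (\<Sum>v\<in>{0..<2 ^ (3 * n)}. \<Sum>u\<in>{0..<2 ^ n}. add_char (wdot k (coef c n p l) (\<lambda>j. u ^ j) (\<lambda>j. v ^ j)))"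
      using large by (simp add: right_diff_distrib)
    moreover have "2 * pi * \<epsilon> = (4 * pi * B) * real p * 2 powr (real n * (8 * c - 4 * (real k + 1)))"
      by (simp add: \<epsilon>_def)
    ultimately show ?thesis using l by auto
  qed
  then show ?thesis using \<open>B > 0\<close> by (intro exI[of _ "4 * pi * B"] conjI allI impI) auto
qed

subsection \<open>The bilinear sum is small\<close>

lemma eventually_le_two_powr:
  fixes A a :: real
  assumes "a > 0"
  shows "eventually (\<lambda>n. A * (real n + 1) \<le> 2 powr (a * real n)) sequentially"
  using assms by real_asymp

text \<open>The point where \<open>c\<close> must not be a natural number: otherwise the
  coefficients with \<open>j > c\<close> vanish, and with them the whole window.\<close>

lemma gbinomial_nonzero:
  fixes c :: real
  assumes "c \<notin> \<nat>"
  shows "c gchoose j \<noteq> 0"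
proof -
  have "c - real i \<noteq> 0" for i using assms by auto
  then show ?thesis by (simp add: gbinomial_prod_rev)
qed

text \<open>The lower end of the window keeps coefficient times range below \<open>1 / 2\<close>, so
  the harmonic bound applies. Its two terms are \<open>2 ^ (3 n j)\<close> and the inverse of the
  coefficient, about \<open>2 ^ (8 n (j - c))\<close>; both must beat \<open>2 ^ (4 n j)\<close> by
  \<open>2 ^ (0.6 c n)\<close>, and for the second this is what the upper end provides.\<close>

lemma kernel_sum_small_window:
  fixes c :: real
  assumes c: "c > 2" "c \<notin> \<nat>" and s: "s > 0" and j: "1.2 * c \<le> real j" "real j \<le> 1.8 * c"
  shows "eventually (\<lambda>n. \<forall>p l. 2 \<le> p \<longrightarrow> real p \<le> 2 powr (0.1 * real n) \<longrightarrow> l \<noteq> 0 \<longrightarrow> \<bar>l\<bar> < 2 * (int p)\<^sup>2 \<longrightarrow>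
    (\<Sum>x\<in>{-2 * (int s * 2 ^ (n * j))..2 * (int s * 2 ^ (n * j))}.
        norm (dirichlet_kernel (int s * 2 ^ (3 * n * j)) (coef c n p l j * of_int x)))
    \<le> 2 powr (4 * real n * real j) * 2 powr (- 0.6 * c * real n)) sequentially"
proof -
  define g where "g = \<bar>c gchoose j\<bar>"
  have "g > 0" using gbinomial_nonzero[OF c(2)] by (simp add: g_def)
  have e1: "eventually (\<lambda>n. (8 * g * real s) * (real n + 1) \<le> 2 powr (0.7 * real n)) sequentially"
    by (rule eventually_le_two_powr) simp
  have e2: "eventually (\<lambda>n. (6 * real s) * (real n + 1) \<le> 2 powr (0.6 * real n)) sequentially"
    by (rule eventually_le_two_powr) simp
  have e3: "eventually (\<lambda>n. (4 / g * (1 + 2 * real s + real j)) * (real n + 1) \<le> 2 powr (0.3 * real n)) sequentially"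
    by (rule eventually_le_two_powr) simp
  from e1 e2 e3 show ?thesis
  proof eventually_elim
    case (elim n)
    show ?case
    proof (intro allI impI)
      fix p :: nat and l :: int
      assume p: "2 \<le> p" "real p \<le> 2 powr (0.1 * real n)" and l: "l \<noteq> 0" "\<bar>l\<bar> < 2 * (int p)\<^sup>2"
      define \<gamma> where "\<gamma> = coef c n p l j"
      define a b where "a = int s * 2 ^ (n * j)" and "b = int s * 2 ^ (3 * n * j)"
      have ra: "real_of_int a = real s * 2 powr (real n * real j)"
        and rb: "real_of_int b = real s * 2 powr (3 * real n * real j)"
        by (simp_all add: a_def b_def powr_realpow[symmetric])
      have ab: "a > 0" "b \<ge> 0" using s by (simp_all add: a_def b_def)
      have "real_of_int \<bar>l\<bar> \<le> real_of_int (2 * (int p)\<^sup>2)" using l by (simp only: of_int_le_iff)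
      then have lp: "\<bar>of_int l / real p\<bar> \<le> 2 * real p"
        using p by (simp add: abs_divide field_simps power2_eq_square)
      have "real_of_int 1 \<le> real_of_int \<bar>l\<bar>" using l(1) by (simp only: of_int_le_iff)
      then have lp': "1 / real p \<le> \<bar>of_int l / real p\<bar>" using p by (simp add: abs_divide divide_right_mono)
      have \<gamma>eq: "\<bar>\<gamma>\<bar> = \<bar>of_int l / real p\<bar> * g * 2 powr (8 * real n * (c - real j))"
        by (simp add: \<gamma>_def coef_def g_def abs_mult)
      have "\<gamma> \<noteq> 0" using l(1) p \<open>g > 0\<close> \<gamma>eq by auto
      have \<gamma>hi: "\<bar>\<gamma>\<bar> \<le> 2 * real p * g * 2 powr (8 * real n * (c - real j))"
        unfolding \<gamma>eq using lp \<open>g > 0\<close> by (intro mult_right_mono) auto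
      have \<gamma>lo: "1 / real p * g * 2 powr (8 * real n * (c - real j)) \<le> \<bar>\<gamma>\<bar>"
        unfolding \<gamma>eq using lp' \<open>g > 0\<close> by (intro mult_right_mono) auto
      have "\<bar>\<gamma>\<bar> * (2 * of_int a) \<le> 2 * 2 powr (0.1 * real n) * g * 2 powr (8 * real n * (c - real j)) * (2 * of_int a)"
        using \<gamma>hi p(2) \<open>g > 0\<close> ab
        by (intro mult_right_mono order_trans[OF \<gamma>hi]) (auto intro!: mult_right_mono)
      also have "\<dots> = (4 * g * real s) * 2 powr (0.1 * real n + 8 * real n * (c - real j) + real n * real j)"
        unfolding ra by (simp add: powr_add)
      also have "\<dots> \<le> (4 * g * real s) * 2 powr (- 0.7 * real n)"
      proof (intro mult_left_mono powr_mono)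
        \<comment> \<open>At \<open>j = 1.2 c\<close> the left side is \<open>0.8 - 0.4 c\<close>,
          negative because \<open>c > 2\<close>; the \<open>0.8\<close> pays for \<open>p\<close>
          and the constants.\<close>
        have "8 * c - 7 * real j + 0.8 \<le> 0" using j(1) c by simp
        then have "real n * (8 * c - 7 * real j + 0.8) \<le> 0" by (intro mult_nonneg_nonpos) auto
        then show "0.1 * real n + 8 * real n * (c - real j) + real n * real j \<le> - 0.7 * real n"
          by (simp add: algebra_simps)
      qed (use \<open>g > 0\<close> in auto)
      also have "\<dots> \<le> 1 / 2"
      proof -
        have "8 * g * real s * 1 \<le> 8 * g * real s * (real n + 1)" using \<open>g > 0\<close> by (intro mult_left_mono) auto
        then have "8 * g * real s \<le> 2 powr (0.7 * real n)" using elim(1) by linarith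
        then show ?thesis by (simp add: powr_minus field_simps)
      qed
      finally have "\<bar>\<gamma>\<bar> * (2 * of_int a) \<le> 1 / 2" .
      from sum_dirichlet_small[OF ab \<open>\<gamma> \<noteq> 0\<close> this]
      have "(\<Sum>x\<in>{-2 * a..2 * a}. norm (dirichlet_kernel b (\<gamma> * of_int x)))
          \<le> (2 * of_int b + 1) + 2 / \<bar>\<gamma>\<bar> * (1 + ln (2 * of_int a))" .
      also have "\<dots> \<le> 2 powr (4 * real n * real j) * 2 powr (- 0.6 * c * real n) / 2
          + 2 powr (4 * real n * real j) * 2 powr (- 0.6 * c * real n) / 2"
      proof (rule add_mono)
        have "1 * 1 \<le> b" unfolding b_def using s by (intro mult_mono) auto
        then have "1 \<le> real_of_int b" by simp
        then have "2 * of_int b + 1 \<le> 3 * real s * 2 powr (3 * real n * real j)" unfolding rb by simp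
        also have "\<dots> = (6 * real s) / 2 * 2 powr (3 * real n * real j)" by simp
        also have "\<dots> \<le> 2 powr (0.6 * real n) / 2 * 2 powr (3 * real n * real j)"
        proof (intro mult_right_mono divide_right_mono)
          have "6 * real s * 1 \<le> 6 * real s * (real n + 1)" by (intro mult_left_mono) auto
          then show "6 * real s \<le> 2 powr (0.6 * real n)" using elim(2) by linarith
        qed auto
        also have "\<dots> = 2 powr (0.6 * real n + 3 * real n * real j) / 2" by (simp add: powr_add)
        also have "\<dots> \<le> 2 powr (4 * real n * real j + - 0.6 * c * real n) / 2"
        proof (intro divide_right_mono powr_mono)
          have "0 \<le> real n * (real j - 0.6 * c - 0.6)" using j c by (intro mult_nonneg_nonneg) auto
          then show "0.6 * real n + 3 * real n * real j \<le> 4 * real n * real j + - 0.6 * c * real n"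
            by (simp add: algebra_simps)
        qed auto
        finally show "2 * of_int b + 1 \<le> 2 powr (4 * real n * real j) * 2 powr (- 0.6 * c * real n) / 2"
          by (simp only: powr_add)
      next
        have ln: "1 + ln (2 * of_int a) \<le> (1 + 2 * real s + real j) * (real n + 1)"
        proof -
          have "ln (2 * real_of_int a) = ln (2 * real s) + real n * real j * ln 2"
            unfolding ra using s by (simp add: ln_mult ln_powr)
          also have "\<dots> \<le> (2 * real s - 1) + real n * real j * 1"
            using s ln_le_minus_one[of "2 * real s"] ln_2_less_1 by (intro add_mono mult_left_mono) auto
          also have "\<dots> \<le> (1 + 2 * real s + real j) * (real n + 1) - 1"
            by (simp add: algebra_simps)
          finally show ?thesis by simp
        qed
        have "2 / \<bar>\<gamma>\<bar> \<le> 2 / (1 / real p * g * 2 powr (8 * real n * (c - real j)))"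
          using \<gamma>lo p \<open>g > 0\<close> by (intro frac_le mult_pos_pos) auto
        also have "\<dots> = 2 * real p / g * 2 powr (8 * real n * (real j - c))"
        proof -
          have "8 * real n * (real j - c) = - (8 * real n * (c - real j))" by (simp add: algebra_simps)
          then show ?thesis by (simp only: powr_minus) (simp add: field_simps)
        qed
        also have "\<dots> \<le> 2 * 2 powr (0.1 * real n) / g * 2 powr (8 * real n * (real j - c))"
          using p(2) \<open>g > 0\<close> by (intro mult_right_mono divide_right_mono) auto
        finally have "2 / \<bar>\<gamma>\<bar> * (1 + ln (2 * of_int a))
            \<le> (2 * 2 powr (0.1 * real n) / g * 2 powr (8 * real n * (real j - c))) * ((1 + 2 * real s + real j) * (real n + 1))"
          using ln \<open>g > 0\<close> ab by (intro mult_mono) auto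
        also have "\<dots> = 2 powr (0.1 * real n + 8 * real n * (real j - c)) * (4 / g * (1 + 2 * real s + real j) * (real n + 1)) / 2"
          unfolding powr_add using \<open>g > 0\<close> by (simp add: field_simps)
        also have "\<dots> \<le> 2 powr (0.1 * real n + 8 * real n * (real j - c)) * 2 powr (0.3 * real n) / 2"
          using elim(3) by (intro divide_right_mono mult_left_mono) auto
        also have "\<dots> = 2 powr (0.1 * real n + 8 * real n * (real j - c) + 0.3 * real n) / 2"
          by (simp only: powr_add)
        also have "\<dots> \<le> 2 powr (4 * real n * real j + - 0.6 * c * real n) / 2"
        proof (intro divide_right_mono powr_mono)
          \<comment> \<open>At \<open>j = 1.8 c\<close> the left side is \<open>0.4 - 0.2 c\<close>,
            again negative because \<open>c > 2\<close>; the \<open>0.4\<close> pays for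
            \<open>p\<close>, the logarithm and the constants.\<close>
          have "4 * real j - 7.4 * c + 0.4 \<le> 0" using j c by simp
          then have "real n * (4 * real j - 7.4 * c + 0.4) \<le> 0" by (intro mult_nonneg_nonpos) auto
          then show "0.1 * real n + 8 * real n * (real j - c) + 0.3 * real n \<le> 4 * real n * real j + - 0.6 * c * real n"
            by (simp add: algebra_simps)
        qed auto
        finally show "2 / \<bar>\<gamma>\<bar> * (1 + ln (2 * of_int a)) \<le> 2 powr (4 * real n * real j) * 2 powr (- 0.6 * c * real n) / 2"
          by (simp only: powr_add)
      qed
      finally show "(\<Sum>x\<in>{-2 * (int s * 2 ^ (n * j))..2 * (int s * 2 ^ (n * j))}.
          norm (dirichlet_kernel (int s * 2 ^ (3 * n * j)) (coef c n p l j * of_int x)))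
          \<le> 2 powr (4 * real n * real j) * 2 powr (- 0.6 * c * real n)"
        by (simp add: a_def b_def \<gamma>_def)
    qed
  qed
qed

lemma kernel_sum_trivial:
  assumes "s > 0"
  shows "(\<Sum>x\<in>{-2 * (int s * 2 ^ (n * j))..2 * (int s * 2 ^ (n * j))}.
        norm (dirichlet_kernel (int s * 2 ^ (3 * n * j)) (\<gamma> * of_int x)))
    \<le> 15 * (real s)\<^sup>2 * 2 powr (4 * real n * real j)"
proof -
  define x y :: real where "x = real s * 2 ^ (n * j)" and "y = real s * 2 ^ (3 * n * j)"
  have "1 * 1 \<le> x" "1 * 1 \<le> y" unfolding x_def y_def using assms by (intro mult_mono; simp)+
  have "(\<Sum>z\<in>{-2 * (int s * 2 ^ (n * j))..2 * (int s * 2 ^ (n * j))}.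
        norm (dirichlet_kernel (int s * 2 ^ (3 * n * j)) (\<gamma> * of_int z))) \<le> (4 * x + 1) * (2 * y + 1)"
    using sum_dirichlet_trivial[of "int s * 2 ^ (n * j)" "int s * 2 ^ (3 * n * j)" \<gamma>]
    by (simp add: x_def y_def)
  also have "\<dots> \<le> (5 * x) * (3 * y)"
    using \<open>1 * 1 \<le> x\<close> \<open>1 * 1 \<le> y\<close> by (intro mult_mono) auto
  also have "\<dots> = 15 * (real s)\<^sup>2 * 2 ^ (n * j + 3 * n * j)"
    unfolding power_add by (simp add: x_def y_def power2_eq_square)
  also have "(2::real) ^ (n * j + 3 * n * j) = 2 powr (4 * real n * real j)"
    by (simp add: powr_realpow[symmetric] algebra_simps)
  finally show ?thesis .
qed

text \<open>The trivial volumes of all coordinates multiply to exactly what the two mean values save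
  through \<open>- k (k + 1) / 2\<close>. After that cancellation only the gains of the window
  coordinates remain.\<close>

lemma kernel_product_le:
  fixes c :: real
  assumes c: "c > 2" "c \<notin> \<nat>" and s: "s > 0" and W: "W = {j\<in>{1..k}. 1.2 * c \<le> real j \<and> real j \<le> 1.8 * c}"
  shows "eventually (\<lambda>n. \<forall>p l. 2 \<le> p \<longrightarrow> real p \<le> 2 powr (0.1 * real n) \<longrightarrow> l \<noteq> 0 \<longrightarrow> \<bar>l\<bar> < 2 * (int p)\<^sup>2 \<longrightarrow>
    (\<Prod>j=1..k. \<Sum>x\<in>{-2 * (int s * 2 ^ (n * j))..2 * (int s * 2 ^ (n * j))}.
        norm (dirichlet_kernel (int s * 2 ^ (3 * n * j)) (coef c n p l j * of_int x)))
    \<le> (15 * (real s)\<^sup>2) ^ k * 2 powr (4 * real n * (real (k * (k + 1)) / 2) - 0.6 * c * real n * real (card W))) sequentially"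
proof -
  have "eventually (\<lambda>n. \<forall>j\<in>W. \<forall>p l. 2 \<le> p \<longrightarrow> real p \<le> 2 powr (0.1 * real n) \<longrightarrow> l \<noteq> 0 \<longrightarrow> \<bar>l\<bar> < 2 * (int p)\<^sup>2 \<longrightarrow>
    (\<Sum>x\<in>{-2 * (int s * 2 ^ (n * j))..2 * (int s * 2 ^ (n * j))}.
        norm (dirichlet_kernel (int s * 2 ^ (3 * n * j)) (coef c n p l j * of_int x)))
    \<le> 2 powr (4 * real n * real j) * 2 powr (- 0.6 * c * real n)) sequentially"
    using W by (intro eventually_ball_finite ballI kernel_sum_small_window c s) auto
  then show ?thesis
  proof eventually_elim
    case (elim n)
    show ?case
    proof (intro allI impI)
      fix p :: nat and l :: int
      assume p: "2 \<le> p" "real p \<le> 2 powr (0.1 * real n)" "l \<noteq> 0" "\<bar>l\<bar> < 2 * (int p)\<^sup>2"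
      define S where "S j = (\<Sum>x\<in>{-2 * (int s * 2 ^ (n * j))..2 * (int s * 2 ^ (n * j))}.
        norm (dirichlet_kernel (int s * 2 ^ (3 * n * j)) (coef c n p l j * of_int x)))" for j
      have H: "1 \<le> 15 * (real s)\<^sup>2"
      proof -
        have "1 \<le> (real s)\<^sup>2" using s by (intro one_le_power) auto
        then show ?thesis by simp
      qed
      have "(\<Prod>j=1..k. S j) \<le> (\<Prod>j=1..k. 15 * (real s)\<^sup>2 * 2 powr (4 * real n * real j)
          * (if j \<in> W then 2 powr (- 0.6 * c * real n) else 1))"
      proof (intro prod_mono conjI)
        fix j assume "j \<in> {1..k}"
        show "0 \<le> S j" unfolding S_def by (intro sum_nonneg) auto
        show "S j \<le> 15 * (real s)\<^sup>2 * 2 powr (4 * real n * real j) * (if j \<in> W then 2 powr (- 0.6 * c * real n) else 1)"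
        proof (cases "j \<in> W")
          case True
          have "S j \<le> 1 * (2 powr (4 * real n * real j) * 2 powr (- 0.6 * c * real n))"
            using elim True p unfolding S_def by simp
          also have "\<dots> \<le> 15 * (real s)\<^sup>2 * (2 powr (4 * real n * real j) * 2 powr (- 0.6 * c * real n))"
            using H by (intro mult_right_mono) auto
          finally show ?thesis using True by (simp add: mult_ac)
        next
          case False
          then show ?thesis using kernel_sum_trivial[OF s, of n j "coef c n p l j"] unfolding S_def by simp
        qed
      qed
      also have "\<dots> = (15 * (real s)\<^sup>2) ^ k * (\<Prod>j=1..k. 2 powr (4 * real n * real j))
          * (\<Prod>j=1..k. if j \<in> W then 2 powr (- 0.6 * c * real n) else 1)"
        unfolding prod.distrib by simp
      also have "(\<Prod>j=1..k. if j \<in> W then 2 powr (- 0.6 * c * real n) else 1) = (2 powr (- 0.6 * c * real n)) ^ card W"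
      proof -
        have "(\<Prod>j=1..k. if j \<in> W then 2 powr (- 0.6 * c * real n) else 1) = (\<Prod>j\<in>{1..k} \<inter> W. 2 powr (- 0.6 * c * real n))"
          by (rule prod.inter_restrict[symmetric]) simp
        also have "{1..k} \<inter> W = W" using W by auto
        finally show ?thesis by simp
      qed
      also have "\<dots> = 2 powr (- 0.6 * c * real n * real (card W))"
        by (subst powr_realpow[symmetric]) (auto simp: powr_powr)
      also have "(\<Prod>j=1..k. 2 powr (4 * real n * real j)) = 2 powr (\<Sum>j=1..k. 4 * real n * real j)"
        by (simp add: powr_sum)
      also have "(\<Sum>j=1..k. 4 * real n * real j) = 4 * real n * (real (k * (k + 1)) / 2)"
      proof -
        have "(\<Sum>j=1..k. real j) = real (k * (k + 1)) / 2"
          by (induction k) (auto simp: field_simps)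
        then show ?thesis by (simp only: sum_distrib_left[symmetric])
      qed
      finally have prod_S: "(\<Prod>j=1..k. S j) \<le> (15 * (real s)\<^sup>2) ^ k * 2 powr (4 * real n * (real (k * (k + 1)) / 2))
          * 2 powr (- 0.6 * c * real n * real (card W))" .
      show "(\<Prod>j=1..k. \<Sum>x\<in>{-2 * (int s * 2 ^ (n * j))..2 * (int s * 2 ^ (n * j))}.
        norm (dirichlet_kernel (int s * 2 ^ (3 * n * j)) (coef c n p l j * of_int x)))
        \<le> (15 * (real s)\<^sup>2) ^ k * 2 powr (4 * real n * (real (k * (k + 1)) / 2) - 0.6 * c * real n * real (card W))"
      proof -
        have "x - 0.6 * c * real n * real (card W) = x + - 0.6 * c * real n * real (card W)" for x by simp
        then show ?thesis
          using prod_S unfolding S_def by (simp only: powr_add mult.assoc)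
      qed
    qed
  qed
qed

section \<open>Numerical constants and choice of parameters\<close>

lemma defect_bound:
  fixes c :: real
  assumes "c > 2" "k > 0" "real k \<le> 3 * c"
  shows "defect k (9 * k) \<le> 0.02 * c\<^sup>2"
proof -
  \<comment> \<open>Every \<open>k\<close> steps of the induction at least halve the defect. Nine
    such blocks turn the initial value, at most \<open>5.25 c^2\<close>, into less than
    \<open>0.02 c^2\<close>.\<close>
  have "1 - 1 / real k \<le> exp (- 1 / real k)" using exp_ge_add_one_self[of "- 1 / real k"] by simp
  then have "(1 - 1 / real k) ^ k \<le> exp (- 1 / real k) ^ k"
    using \<open>k > 0\<close> by (intro power_mono) auto
  also have "\<dots> = exp (- 1)" using \<open>k > 0\<close> by (simp flip: exp_of_nat_mult)
  also have "\<dots> \<le> 1 / 2" using exp_ge_add_one_self[of 1] by (simp add: exp_minus field_simps)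
  finally have "((1 - 1 / real k) ^ k) ^ 9 \<le> (1 / 2) ^ 9"
    using \<open>k > 0\<close> by (intro power_mono) auto
  then have 1: "(1 - 1 / real k) ^ (9 * k) \<le> 1 / 512"
    by (simp add: power_mult[symmetric] mult.commute power_divide)
  have "real k * (real k + 1) \<le> (3 * c) * (3.5 * c)" using assms by (intro mult_mono) auto
  then have "real (k * (k + 1)) / 2 \<le> 5.25 * c\<^sup>2" by (simp add: power2_eq_square algebra_simps)
  then have "defect k (9 * k) \<le> 5.25 * c\<^sup>2 * (1 / 512)"
    unfolding defect_def using 1 \<open>k > 0\<close> by (intro mult_mono) auto
  also have "\<dots> \<le> 0.02 * c\<^sup>2" by simp
  finally show ?thesis .
qed

text \<open>The window has length \<open>0.6 c > 1.2\<close>, so \<open>m\<close>, its integer part,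
  is at least 1 and rounding loses no more than half.\<close>

lemma card_window_ge:
  fixes c :: real
  assumes "c > 2" "2 * c \<le> real k"
  shows "0.3 * c \<le> real (card {j\<in>{1..k}. 1.2 * c \<le> real j \<and> real j \<le> 1.8 * c})"
proof -
  define j0 m where "j0 = nat \<lceil>1.2 * c\<rceil>" and "m = nat \<lfloor>0.6 * c\<rfloor>"
  have j0: "1.2 * c \<le> real j0" "real j0 < 1.2 * c + 1"
    unfolding j0_def using assms(1) by (simp_all add: ceiling_correct) linarith+
  have m: "real m \<le> 0.6 * c" "0.6 * c < real m + 1"
    unfolding m_def using assms(1) by (simp_all add: floor_correct) linarith+
  have "0.6 * c > 1.2" using assms(1) by simp
  then have "m \<ge> 1" using m by linarith
  then have "0.3 * c \<le> real m" using m by linarith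
  also have "m = card {j0..<j0 + m}" by simp
  also have "real \<dots> \<le> real (card {j\<in>{1..k}. 1.2 * c \<le> real j \<and> real j \<le> 1.8 * c})"
  proof (intro of_nat_mono card_mono subsetI)
    fix j assume j: "j \<in> {j0..<j0 + m}"
    then have "real j0 \<le> real j" "real j \<le> real j0 + real m - 1" by auto
    then have "1.2 * c \<le> real j" "real j \<le> 1.8 * c" using j0 m by linarith+
    moreover from this have "real 1 \<le> real j" "real j \<le> real k" using assms by simp_all
    ultimately show "j \<in> {j\<in>{1..k}. 1.2 * c \<le> real j \<and> real j \<le> 1.8 * c}" by simp
  qed auto
  finally show ?thesis .
qed

text \<open>If there were no such \<open>u, v\<close>, the \<open>e\<close>-th power of a bilinear
  sum would be too large by a power of \<open>p\<close> worth \<open>2 ^ (0.01 c^2 n)\<close>, while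
  the upper bound saves \<open>2 ^ (0.1 c^2 n)\<close>.\<close>

lemma prime_dvd_floor_power:
  fixes c :: real
  assumes c: "c > 2" "c \<notin> \<nat>" and \<delta>: "0 \<le> \<delta>" "\<delta> \<le> 2 / 10 ^ 8 / c\<^sup>2"
  shows "eventually (\<lambda>n. \<forall>p\<ge>2. real p \<le> 2 * 2 powr (8 * \<delta> * real n) \<longrightarrow>
    (\<exists>u\<in>{0..<2 ^ n}. \<exists>v\<in>{0..<2 ^ (3 * n)}. p dvd nat \<lfloor>(2 ^ (8 * n) + of_int (u * v)) powr c\<rfloor>)) sequentially"
proof -
  \<comment> \<open>\<open>k\<close> is at least \<open>2 c + 1\<close>, so the truncation exponent
    is at most \<open>-8\<close>, and at most \<open>3 c\<close> because \<open>c > 2\<close>. With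
    \<open>r = 9 k\<close>, the value \<open>s = 6 k^2\<close> meets
    \<open>k^2 + 2 + 9 k^2 \<le> 2 s\<close>.\<close>
  define k where "k = nat \<lceil>2 * c\<rceil> + 1"
  define r where "r = 9 * k"
  define s where "s = 6 * k * k"
  define W where "W = {j\<in>{1..k}. 1.2 * c \<le> real j \<and> real j \<le> 1.8 * c}"
  define e where "e = 8 * s * s"
  have k: "2 * c + 1 \<le> real k" "real k \<le> 3 * c" "k > 0"
    unfolding k_def using c(1) by (simp_all add: ceiling_correct) linarith+
  have "k \<ge> 2" using k c(1) by linarith
  have s: "s > 0" "k * k + 2 + k * r \<le> 2 * s"
    using \<open>k \<ge> 2\<close> mult_le_mono[OF \<open>k \<ge> 2\<close> \<open>k \<ge> 2\<close>] by (auto simp: s_def r_def)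
  have defect: "defect k r \<le> 0.02 * c\<^sup>2"
    unfolding r_def by (rule defect_bound[OF c(1) k(3,2)])
  have cardW: "0.3 * c \<le> real (card W)"
    unfolding W_def by (rule card_window_ge) (use c k in auto)
  have "\<delta> * c\<^sup>2 \<le> 2 / 10 ^ 8" using mult_right_mono[OF \<delta>(2), of "c\<^sup>2"] c by simp
  have "4 \<le> c\<^sup>2" using power_mono[of 2 c 2] c by simp
  then have "\<delta> * 4 \<le> \<delta> * c\<^sup>2" using \<delta> by (intro mult_left_mono) auto
  then have "8 * \<delta> \<le> 0.05" using \<open>\<delta> * c\<^sup>2 \<le> 2 / 10 ^ 8\<close> by simp
  \<comment> \<open>The origin of \<open>10 ^ 8\<close>: since \<open>16 e\<close> is at most
    \<open>373248 c^4\<close>, this range of \<open>\<delta>\<close> keeps the loss caused by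
    \<open>p\<close> below a tenth of the saving \<open>0.1 c^2\<close>.\<close>
  have budget: "16 * \<delta> * real e \<le> 0.01 * c\<^sup>2"
  proof -
    have "real e = 288 * real k ^ 4" by (simp add: e_def s_def power4_eq_xxxx)
    also have "\<dots> \<le> 288 * (3 * c) ^ 4" using k by (intro mult_left_mono power_mono) auto
    also have "\<dots> = 23328 * (c\<^sup>2 * c\<^sup>2)" by (simp add: power_mult_distrib power4_eq_xxxx power2_eq_square)
    finally have "16 * \<delta> * real e \<le> 16 * \<delta> * (23328 * (c\<^sup>2 * c\<^sup>2))" using \<delta> by (intro mult_left_mono) auto
    also have "\<dots> = 373248 * ((\<delta> * c\<^sup>2) * c\<^sup>2)" by simp
    also have "\<dots> \<le> 373248 * ((2 / 10 ^ 8) * c\<^sup>2)"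
      using \<open>\<delta> * c\<^sup>2 \<le> 2 / 10 ^ 8\<close> by (intro mult_left_mono mult_right_mono) auto
    also have "\<dots> \<le> 0.01 * c\<^sup>2" by simp
    finally show ?thesis .
  qed
  from bilinear_sum_le[OF k(3) s] obtain C where "C > 0" and C: "\<And>n n' \<gamma>.
    norm (\<Sum>v\<in>{0..<2 ^ n'}. \<Sum>u\<in>{0..<2 ^ n}. add_char (wdot k \<gamma> (\<lambda>j. u ^ j) (\<lambda>j. v ^ j))) ^ (8 * s * s)
    \<le> C * (2 ^ (n + n')) ^ (8 * s * s - 4 * s) * 2 powr (real (n + n') * mv_exp k r (2 * s))
      * (\<Prod>j=1..k. \<Sum>x\<in>{-2 * (int s * 2 ^ (n * j))..2 * (int s * 2 ^ (n * j))}.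
          norm (dirichlet_kernel (int s * 2 ^ (n' * j)) (\<gamma> j * of_int x)))"
    by blast
  from large_bilinear_sum_if_avoiding[of c k] obtain B where "B > 0" and B: "\<And>n p. n \<ge> 1 \<Longrightarrow> p \<ge> 2 \<Longrightarrow>
    \<forall>u\<in>{0..<2 ^ n}. \<forall>v\<in>{0..<2 ^ (3 * n)}. \<not> p dvd nat \<lfloor>(2 ^ (8 * n) + of_int (u * v)) powr c\<rfloor> \<Longrightarrow>
    \<exists>l::int. l \<noteq> 0 \<and> \<bar>l\<bar> < 2 * (int p)\<^sup>2 \<and>
      2 ^ (4 * n) * (1 / (4 * (real p)\<^sup>2) - B * real p * 2 powr (real n * (8 * c - 4 * (real k + 1))))
      \<le> norm (\<Sum>v\<in>{0..<2 ^ (3 * n)}. \<Sum>u\<in>{0..<2 ^ n}.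
          add_char (wdot k (coef c n p l) (\<lambda>j. u ^ j) (\<lambda>j. v ^ j)))"
    by blast
  define H where "H = C * (15 * (real s)\<^sup>2) ^ k"
  have "H > 0" using \<open>C > 0\<close> s by (simp add: H_def)
  have e1: "eventually (\<lambda>n. 2 * (real n + 1) \<le> 2 powr (0.05 * real n)) sequentially"
    by (rule eventually_le_two_powr) simp
  have e2: "eventually (\<lambda>n. 8 * B * (real n + 1) \<le> 2 powr (7 * real n)) sequentially"
    by (rule eventually_le_two_powr) simp
  have e3: "eventually (\<lambda>n. (2 * 32 ^ e * H) * (real n + 1) \<le> 2 powr (0.09 * c\<^sup>2 * real n)) sequentially"
    by (rule eventually_le_two_powr) (use c in simp)
  have e4: "eventually (\<lambda>n::nat. n \<ge> 1) sequentially" by (rule eventually_ge_at_top)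
  from e1 e2 e3 e4 kernel_product_le[OF c s(1) W_def] show ?thesis
  proof eventually_elim
    case (elim n)
    show ?case
    proof (intro allI impI, rule ccontr)
      fix p :: nat
      assume p: "p \<ge> 2" "real p \<le> 2 * 2 powr (8 * \<delta> * real n)"
        and no: "\<not> (\<exists>u\<in>{0..<2 ^ n}. \<exists>v\<in>{0..<2 ^ (3 * n)}. p dvd nat \<lfloor>(2 ^ (8 * n) + of_int (u * v)) powr c\<rfloor>)"
      have psmall: "real p \<le> 2 powr (0.1 * real n)"
      proof -
        have "2 * 1 \<le> 2 * (real n + 1)" by (intro mult_left_mono) auto
        then have "2 \<le> 2 powr (0.05 * real n)" using elim(1) by linarith
        moreover have "2 powr (8 * \<delta> * real n) \<le> 2 powr (0.05 * real n)"
          using \<open>8 * \<delta> \<le> 0.05\<close> by (intro powr_mono mult_right_mono) auto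
        ultimately have "2 * 2 powr (8 * \<delta> * real n) \<le> 2 powr (0.05 * real n) * 2 powr (0.05 * real n)"
          by (intro mult_mono) auto
        also have "\<dots> = 2 powr (0.1 * real n)" by (simp flip: powr_add)
        finally show ?thesis using p(2) by linarith
      qed
      have "\<forall>u\<in>{0..<2 ^ n}. \<forall>v\<in>{0..<2 ^ (3 * n)}. \<not> p dvd nat \<lfloor>(2 ^ (8 * n) + of_int (u * v)) powr c\<rfloor>"
        using no by blast
      note ex = B[OF elim(4) p(1) this]
      define Z where "Z l = norm (\<Sum>v\<in>{0..<2 ^ (3 * n)}. \<Sum>u\<in>{0..<2 ^ n}.
          add_char (wdot k (coef c n p l) (\<lambda>j. u ^ j) (\<lambda>j. v ^ j)))" for l
      obtain l :: int where l: "l \<noteq> 0" "\<bar>l\<bar> < 2 * (int p)\<^sup>2" and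
        large: "2 ^ (4 * n) * (1 / (4 * (real p)\<^sup>2) - B * real p * 2 powr (real n * (8 * c - 4 * (real k + 1)))) \<le> Z l"
        by (rule exE[OF ex]) (elim conjE, rule that, unfold Z_def)
      \<comment> \<open>Truncation may take half of the main term. The exponents are
        \<open>7\<close> for \<open>8 B\<close>, \<open>0.3\<close> for \<open>p^3\<close> and
        \<open>-8\<close> for the remainder, with negative sum.\<close>
      have error: "B * real p * 2 powr (real n * (8 * c - 4 * (real k + 1))) \<le> 1 / (8 * (real p)\<^sup>2)"
      proof -
        have "8 * B * 1 \<le> 8 * B * (real n + 1)" using \<open>B > 0\<close> by (intro mult_left_mono) auto
        then have B7: "8 * B \<le> 2 powr (7 * real n)" using elim(2) by linarith
        have "2 powr (real n * (8 * c - 4 * (real k + 1))) \<le> 2 powr (- 8 * real n)"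
        proof (intro powr_mono)
          have "real n * (8 * c - 4 * (real k + 1)) \<le> real n * (- 8)" using k(1) by (intro mult_left_mono) auto
          then show "real n * (8 * c - 4 * (real k + 1)) \<le> - 8 * real n" by simp
        qed auto
        then have "8 * B * real p ^ 3 * 2 powr (real n * (8 * c - 4 * (real k + 1)))
            \<le> 2 powr (7 * real n) * (2 powr (0.1 * real n)) ^ 3 * 2 powr (- 8 * real n)"
          using B7 psmall \<open>B > 0\<close> by (intro mult_mono power_mono) auto
        also have "(2 powr (0.1 * real n)) ^ 3 = 2 powr (0.3 * real n)"
          by (subst powr_realpow[symmetric]) (auto simp: powr_powr mult.commute)
        also have "2 powr (7 * real n) * 2 powr (0.3 * real n) * 2 powr (- 8 * real n) = 2 powr (- 0.7 * real n)"
          by (simp flip: powr_add)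
        also have "\<dots> \<le> 2 powr 0" by (intro powr_mono) auto
        finally have "8 * B * real p ^ 3 * 2 powr (real n * (8 * c - 4 * (real k + 1))) \<le> 1" by simp
        then show ?thesis using p(1) by (simp add: field_simps power2_eq_square power3_eq_cube)
      qed
      have "2 ^ (4 * n) * (1 / (8 * (real p)\<^sup>2))
          \<le> 2 ^ (4 * n) * (1 / (4 * (real p)\<^sup>2) - B * real p * 2 powr (real n * (8 * c - 4 * (real k + 1))))"
      proof (intro mult_left_mono)
        have "1 / (4 * (real p)\<^sup>2) = 1 / (8 * (real p)\<^sup>2) + 1 / (8 * (real p)\<^sup>2)" by simp
        then show "1 / (8 * (real p)\<^sup>2) \<le> 1 / (4 * (real p)\<^sup>2) - B * real p * 2 powr (real n * (8 * c - 4 * (real k + 1)))"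
          using error by linarith
      qed auto
      with large have "2 ^ (4 * n) * (1 / (8 * (real p)\<^sup>2)) \<le> Z l" by linarith
      then have "(2 ^ (4 * n) * (1 / (8 * (real p)\<^sup>2))) ^ e \<le> Z l ^ e" by (intro power_mono) auto
      also have "Z l ^ e \<le> C * (2 ^ (4 * n)) ^ (e - 4 * s) * 2 powr (4 * real n * mv_exp k r (2 * s))
          * (\<Prod>j=1..k. \<Sum>x\<in>{-2 * (int s * 2 ^ (n * j))..2 * (int s * 2 ^ (n * j))}.
              norm (dirichlet_kernel (int s * 2 ^ (3 * n * j)) (coef c n p l j * of_int x)))"
        unfolding Z_def e_def using C[where n = n and n' = "3 * n" and \<gamma> = "coef c n p l"] by simp
      also have "\<dots> \<le> C * (2 ^ (4 * n)) ^ (e - 4 * s) * 2 powr (4 * real n * mv_exp k r (2 * s))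
          * ((15 * (real s)\<^sup>2) ^ k * 2 powr (4 * real n * (real (k * (k + 1)) / 2) - 0.6 * c * real n * real (card W)))"
        using elim(5) p(1) psmall l \<open>C > 0\<close> by (intro mult_left_mono) auto
      also have "\<dots> = (2 ^ (4 * n)) ^ (e - 4 * s) * (H * 2 powr (4 * real n * mv_exp k r (2 * s)
          + (4 * real n * (real (k * (k + 1)) / 2) - 0.6 * c * real n * real (card W))))"
        unfolding H_def powr_add by simp
      \<comment> \<open>Here \<open>k (k + 1) / 2\<close> cancels, and \<open>16 s n\<close>
        supplies the \<open>4 s\<close> factors \<open>2 ^ (4 n)\<close> missing from the trivial
        bound.\<close>
      also have "4 * real n * mv_exp k r (2 * s) + (4 * real n * (real (k * (k + 1)) / 2) - 0.6 * c * real n * real (card W))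
          = real n * (16 * real s) + real n * (4 * defect k r - 0.6 * c * real (card W))"
        unfolding mv_exp_def by (simp add: algebra_simps)
      also have "2 powr \<dots> = (2 ^ (4 * n)) ^ (4 * s) * 2 powr (real n * (4 * defect k r - 0.6 * c * real (card W)))"
        unfolding powr_add by (simp add: powr_realpow[symmetric] powr_powr mult_ac flip: power_mult)
      also have "(2 ^ (4 * n)) ^ (e - 4 * s) * (H * ((2 ^ (4 * n)) ^ (4 * s) * 2 powr (real n * (4 * defect k r - 0.6 * c * real (card W)))))
          = (2 ^ (4 * n)) ^ e * (H * 2 powr (real n * (4 * defect k r - 0.6 * c * real (card W))))"
      proof -
        have "4 * s \<le> e" using s(1) by (simp add: e_def)
        then have "((2::real) ^ (4 * n)) ^ e = (2 ^ (4 * n)) ^ (e - 4 * s) * (2 ^ (4 * n)) ^ (4 * s)"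
          by (simp flip: power_add)
        then show ?thesis by simp
      qed
      finally have "(1 / (8 * (real p)\<^sup>2)) ^ e \<le> H * 2 powr (real n * (4 * defect k r - 0.6 * c * real (card W)))"
        unfolding power_mult_distrib[of "2 ^ (4 * n)"] by (simp add: mult_le_cancel_left_pos)
      also have "\<dots> \<le> H * 2 powr (- 0.1 * c\<^sup>2 * real n)"
      proof (intro mult_left_mono powr_mono)
        \<comment> \<open>The window yields \<open>0.18 c^2\<close> and the defect takes
          \<open>0.08 c^2\<close>, which leaves \<open>0.1 c^2\<close>.\<close>
        have "0.6 * c * (0.3 * c) \<le> 0.6 * c * real (card W)" using cardW c by (intro mult_left_mono) auto
        then have "4 * defect k r - 0.6 * c * real (card W) \<le> - 0.1 * c\<^sup>2"
          using defect by (simp add: power2_eq_square)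
        then have "real n * (4 * defect k r - 0.6 * c * real (card W)) \<le> real n * (- 0.1 * c\<^sup>2)"
          by (intro mult_left_mono) auto
        then show "real n * (4 * defect k r - 0.6 * c * real (card W)) \<le> - 0.1 * c\<^sup>2 * real n"
          by (simp add: mult_ac)
      qed (use \<open>H > 0\<close> in auto)
      finally have upper: "(1 / (8 * (real p)\<^sup>2)) ^ e \<le> H * 2 powr (- 0.1 * c\<^sup>2 * real n)" .
      have "8 * (real p)\<^sup>2 \<le> 8 * (2 * 2 powr (8 * \<delta> * real n))\<^sup>2"
        using p(2) by (intro mult_left_mono power_mono) auto
      also have "\<dots> = 32 * 2 powr (16 * \<delta> * real n)"
        by (simp add: power2_eq_square mult.assoc flip: powr_add)
      finally have "(8 * (real p)\<^sup>2) ^ e \<le> (32 * 2 powr (16 * \<delta> * real n)) ^ e" by (intro power_mono) auto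
      also have "\<dots> = 32 ^ e * 2 powr (16 * \<delta> * real n * real e)"
        by (simp add: power_mult_distrib powr_realpow[symmetric] powr_powr)
      also have "\<dots> \<le> 32 ^ e * 2 powr (0.01 * c\<^sup>2 * real n)"
      proof (intro mult_left_mono powr_mono)
        have "16 * \<delta> * real e * real n \<le> 0.01 * c\<^sup>2 * real n" using budget by (intro mult_right_mono) auto
        then show "16 * \<delta> * real n * real e \<le> 0.01 * c\<^sup>2 * real n" by (simp add: mult_ac)
      qed auto
      finally have lower: "(8 * (real p)\<^sup>2) ^ e \<le> 32 ^ e * 2 powr (0.01 * c\<^sup>2 * real n)" .
      have "1 = (8 * (real p)\<^sup>2) ^ e * (1 / (8 * (real p)\<^sup>2)) ^ e"
        unfolding power_mult_distrib[symmetric] using p(1) by simp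
      also have "\<dots> \<le> (32 ^ e * 2 powr (0.01 * c\<^sup>2 * real n)) * (H * 2 powr (- 0.1 * c\<^sup>2 * real n))"
        using upper lower by (intro mult_mono) auto
      also have "\<dots> = 32 ^ e * H * 2 powr (- 0.09 * c\<^sup>2 * real n)"
      proof -
        have "0.01 * c\<^sup>2 * real n + - 0.1 * c\<^sup>2 * real n = - 0.09 * c\<^sup>2 * real n" by simp
        then have *: "2 powr (0.01 * c\<^sup>2 * real n) * 2 powr (- 0.1 * c\<^sup>2 * real n) = 2 powr (- 0.09 * c\<^sup>2 * real n)"
          by (simp only: powr_add[symmetric])
        show ?thesis unfolding *[symmetric] by (simp only: mult_ac)
      qed
      finally have "2 powr (0.09 * c\<^sup>2 * real n) \<le> 32 ^ e * H"
        by (simp add: powr_minus field_simps)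
      moreover have "2 * 32 ^ e * H * 1 \<le> 2 * 32 ^ e * H * (real n + 1)" using \<open>H > 0\<close> by (intro mult_left_mono) auto
      moreover have "32 ^ e * H > 0" using \<open>H > 0\<close> by simp
      ultimately show False using elim(3) by linarith
    qed
  qed
qed

section \<open>From divisibility to the largest prime factor\<close>

theorem theorem2:
  shows "\<exists>\<beta>::real. \<beta> > 0 \<and>
    (\<forall>c::real. c > 2 \<and> c \<notin> \<nat> \<longrightarrow>
      infinite {n::nat. n \<ge> 2 \<and>
        real (largest_prime_factor (nat \<lfloor>real n powr c\<rfloor>)) > real n powr (\<beta> / c\<^sup>2)})"
\<comment> \<open>This \<open>\<beta>\<close> is half of \<open>\<delta> c^2\<close>; the other half
  makes room for \<open>x\<close> being as large as \<open>2 ^ (8 n + 1)\<close>.\<close>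
proof (intro exI[of _ "1 / 10 ^ 8"] conjI allI impI)
  fix c :: real
  assume "c > 2 \<and> c \<notin> \<nat>"
  then have c: "c > 2" "c \<notin> \<nat>" by auto
  define \<delta> where "\<delta> = 2 / 10 ^ 8 / c\<^sup>2"
  have \<delta>: "\<delta> > 0" using c by (simp add: \<delta>_def)
  have "4 \<le> c\<^sup>2" using power_mono[of 2 c 2] c by simp
  then have "\<delta> \<le> 2 / 10 ^ 8 / 4" unfolding \<delta>_def by (intro divide_left_mono) auto
  then have "8 * \<delta> \<le> 1" by simp
  from prime_dvd_floor_power[OF c less_imp_le[OF \<delta>] eq_refl[OF \<delta>_def]]
  obtain n0 where n0: "\<forall>n\<ge>n0. \<forall>p\<ge>2. real p \<le> 2 * 2 powr (8 * \<delta> * real n) \<longrightarrow>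
      (\<exists>u\<in>{0..<2 ^ n}. \<exists>v\<in>{0..<2 ^ (3 * n)}. p dvd nat \<lfloor>(2 ^ (8 * n) + of_int (u * v)) powr c\<rfloor>)"
    unfolding eventually_sequentially ..
  show "infinite {n::nat. n \<ge> 2 \<and> real (largest_prime_factor (nat \<lfloor>real n powr c\<rfloor>)) > real n powr (1 / 10 ^ 8 / c\<^sup>2)}"
    unfolding infinite_nat_iff_unbounded
  proof
    fix m :: nat
    define n1 where "n1 = n0 + m + 1"
    \<comment> \<open>The prime comes first and \<open>n\<close> is fitted to it, so no prime has to
      be found in a prescribed range.\<close>
    obtain p where p: "prime p" "nat \<lceil>2 powr (8 * \<delta> * real n1)\<rceil> < p"
      using bigger_prime by metis
    then have "2 powr (8 * \<delta> * real n1) \<le> real p" by linarith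
    have "p \<ge> 2" using p prime_ge_2_nat by auto
    \<comment> \<open>The largest \<open>n\<close> with
      \<open>2 powr (8 \<delta> n) \<le> p\<close>. As \<open>8 \<delta> \<le> 1\<close>, the prime
      is less than twice that power, which is the slack allowed in
      \<open>prime_dvd_floor_power\<close>.\<close>
    define n where "n = nat \<lfloor>log 2 (real p) / (8 * \<delta>)\<rfloor>"
    have "8 * \<delta> * real n1 \<le> log 2 (real p)"
      using \<open>2 powr (8 * \<delta> * real n1) \<le> real p\<close> \<open>p \<ge> 2\<close> by (simp add: le_log_iff)
    then have "real n1 \<le> log 2 (real p) / (8 * \<delta>)" using \<delta> by (simp add: field_simps)
    then have "n1 \<le> n" unfolding n_def by (simp add: le_nat_floor)
    then have "0 \<le> log 2 (real p) / (8 * \<delta>)" using \<open>real n1 \<le> log 2 (real p) / (8 * \<delta>)\<close> by linarith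
    then have "real n \<le> log 2 (real p) / (8 * \<delta>)" "log 2 (real p) / (8 * \<delta>) < real n + 1"
      unfolding n_def by (simp_all add: floor_correct)
    then have n: "8 * \<delta> * real n \<le> log 2 (real p)" "log 2 (real p) < 8 * \<delta> * real n + 8 * \<delta>"
      using \<delta> by (simp_all add: field_simps)
    have plow: "2 powr (8 * \<delta> * real n) \<le> real p" using n(1) \<open>p \<ge> 2\<close> by (simp add: le_log_iff)
    have "real p < 2 powr (8 * \<delta> * real n + 8 * \<delta>)" using n(2) \<open>p \<ge> 2\<close> by (simp add: log_less_iff)
    also have "\<dots> \<le> 2 powr (8 * \<delta> * real n + 1)" using \<open>8 * \<delta> \<le> 1\<close> by (intro powr_mono) auto
    also have "\<dots> = 2 * 2 powr (8 * \<delta> * real n)" by (simp add: powr_add)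
    finally have "\<exists>u\<in>{0..<2 ^ n}. \<exists>v\<in>{0..<2 ^ (3 * n)}. p dvd nat \<lfloor>(2 ^ (8 * n) + of_int (u * v)) powr c\<rfloor>"
      using \<open>n1 \<le> n\<close> \<open>p \<ge> 2\<close> by (intro n0[rule_format]) (auto simp: n1_def)
    then obtain u v :: int where uv: "u \<in> {0..<2 ^ n}" "v \<in> {0..<2 ^ (3 * n)}"
      and dvd: "p dvd nat \<lfloor>(2 ^ (8 * n) + of_int (u * v)) powr c\<rfloor>"
      by blast
    define x where "x = 2 ^ (8 * n) + nat (u * v)"
    have uv0: "0 \<le> u * v" using uv by simp
    then have rx: "real x = 2 ^ (8 * n) + of_int (u * v)" by (simp add: x_def)
    have "u * v \<le> 2 ^ n * 2 ^ (3 * n)" using uv by (intro mult_mono) auto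
    also have "\<dots> \<le> 2 ^ (8 * n)" unfolding power_add[symmetric] by (intro power_increasing) auto
    finally have "real_of_int (u * v) \<le> real_of_int (2 ^ (8 * n))" by (simp only: of_int_le_iff)
    then have "real x \<le> 2 ^ (8 * n + 1)" unfolding rx by simp
    then have xhi: "real x \<le> 2 powr (8 * real n + 1)" by (simp add: powr_realpow[symmetric] powr_add)
    have "n < 2 ^ n" by (rule less_exp)
    also have "\<dots> \<le> 2 ^ (8 * n)" by (intro power_increasing) auto
    also have "\<dots> \<le> x" by (simp add: x_def)
    finally have "n < x" .
    then have "m < x" "x \<ge> 2" using \<open>n1 \<le> n\<close> by (auto simp: n1_def)
    have "1 \<le> real x powr c" using \<open>x \<ge> 2\<close> c by (intro ge_one_powr_ge_zero) auto
    then have "nat \<lfloor>real x powr c\<rfloor> \<noteq> 0" by linarith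
    then have "p \<in> prime_factors (nat \<lfloor>real x powr c\<rfloor>)"
      using dvd p(1) by (auto simp: rx in_prime_factors_iff)
    then have "p \<le> largest_prime_factor (nat \<lfloor>real x powr c\<rfloor>)"
      unfolding largest_prime_factor_def by (intro Max_ge) auto
    moreover have "real x powr (1 / 10 ^ 8 / c\<^sup>2) < real p"
    proof -
      have "real x powr (1 / 10 ^ 8 / c\<^sup>2) \<le> (2 powr (8 * real n + 1)) powr (\<delta> / 2)"
        unfolding \<delta>_def using xhi by (simp add: powr_mono2)
      also have "\<dots> = 2 powr ((8 * real n + 1) * (\<delta> / 2))" by (simp add: powr_powr)
      also have "\<dots> < 2 powr (8 * \<delta> * real n)"
      proof (intro powr_less_mono)
        have "8 * real n + 1 < 16 * real n" using \<open>n1 \<le> n\<close> by (simp add: n1_def)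
        then have "(8 * real n + 1) * (\<delta> / 2) < 16 * real n * (\<delta> / 2)" using \<delta> by (intro mult_strict_right_mono) auto
        then show "(8 * real n + 1) * (\<delta> / 2) < 8 * \<delta> * real n" by simp
      qed auto
      finally show ?thesis using plow by linarith
    qed
    ultimately show "\<exists>x>m. x \<in> {n. n \<ge> 2 \<and> real (largest_prime_factor (nat \<lfloor>real n powr c\<rfloor>)) > real n powr (1 / 10 ^ 8 / c\<^sup>2)}"
      using \<open>m < x\<close> \<open>x \<ge> 2\<close> by (intro exI[of _ x]) auto
  qed
qed simp

end
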